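(* Let $g\in\mathbb{F}_q[t]$ be a non-constant square-free polynomial that is not a Carmichael polynomial. Then there exist infinitely many cyclotomic function fields $\mathbb{F}_q(t)(\Lambda_M)$ whose discriminants are relatively prime to $g$ such that $g$ is not Carmichael in them.
   Context: $\mathbb{F}_q$ is the finite field with $q$ elements. A finite ring $S$ is a Carmichael ring if $S$ is not a field and $a^{|S|}=a$ for every $a\in S$; an ideal $I$ of a ring $R$ is a Carmichael ideal if $R/I$ is a Carmichael ring. A polynomial $g\in\mathbb{F}_q[t]$ is a Carmichael polynomial if $(g)$ is a Carmichael ideal of $\mathbb{F}_q[t]$. For a finite extension $K$ of $\mathbb{F}_q(t)$, $\mathcal{O}_K$ denotes the integral closure of $\mathbb{F}_q[t]$ in $K$, and an element $\alpha\in\mathcal{O}_K$ is Carmichael in $K$ if $\alpha\mathcal{O}_K$ is a Carmichael ideal of $\mathcal{O}_K$. The discriminant of $K$ is the discriminant ideal of $\mathcal{O}_K$ over $\mathbb{F}_q[t]$; "relatively prime to $g$" means no irreducible factor of $g$ divides it. Cyclotomic function fields (Carlitz): let $\overline{\mathbb{F}_q(t)}$ be an algebraic closure and let $\rho:\mathbb{F}_q[t]\to\mathrm{End}_{\mathbb{F}_q}(\overline{\mathbb{F}_q(t)})$, $M\mapsto\rho_M$, be the $\mathbb{F}_q$-algebra homomorphism determined by $\rho_a(\alpha)=a\alpha$ for $a\in\mathbb{F}_q$ and $\rho_t(\alpha)=t\alpha+\alpha^q$. For a non-constant $M\in\mathbb{F}_q[t]$, $\Lambda_M=\{\alpha\in\overline{\mathbb{F}_q(t)}:\rho_M(\alpha)=0\}$,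 and $\mathbb{F}_q(t)(\Lambda_M)$ is the field generated by $\Lambda_M$ over $\mathbb{F}_q(t)$, called the $M$-th cyclotomic function field. *)

theory Defs
  imports "HOL-Algebra.Algebraic_Closure_Type" "HOL-Algebra.QuotRing"
    "HOL-Combinatorics.Permutations" "HOL-Computational_Algebra.Computational_Algebra"
begin

(* Conventions:
   'a :: {finite, field} is F_q (q = CARD('a));
   F_q[t] = 'a poly;  F_q(t) = 'a poly fract;
   a fixed algebraic closure of F_q(t) is 'a poly fract alg_closure, with embedding to_ac. *)

type_synonym 'a clos = "'a poly fract alg_closure"

definition emb :: "'a::{finite,field} poly \<Rightarrow> 'a clos" where
  "emb p = to_ac (to_fract p)"

definition carmichael_ring :: "('b, 'm) ring_scheme \<Rightarrow> bool" where
  "carmichael_ring S \<longleftrightarrow> finite (carrier S) \<and> \<not> Ring.field S \<and>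
     (\<forall>a \<in> carrier S. a [^]\<^bsub>S\<^esub> card (carrier S) = a)"

definition carmichael_ideal :: "('b, 'm) ring_scheme \<Rightarrow> 'b set \<Rightarrow> bool" where
  "carmichael_ideal R I \<longleftrightarrow> carmichael_ring (R Quot I)"

definition carmichael_poly :: "'a::{finite,field} poly \<Rightarrow> bool" where
  "carmichael_poly g \<longleftrightarrow>
     carmichael_ideal (ring_of_type_algebra :: 'a poly ring) {g * h | h. True}"

primrec carlitz_iter :: "nat \<Rightarrow> 'a::{finite,field} clos \<Rightarrow> 'a clos" where
  "carlitz_iter 0 x = x"
| "carlitz_iter (Suc n) x = emb [:0, 1:] * carlitz_iter n x + (carlitz_iter n x) ^ card (UNIV :: 'a set)"

definition carlitz :: "'a::{finite,field} poly \<Rightarrow> 'a clos \<Rightarrow> 'a clos" where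
  "carlitz M x = (\<Sum>i\<le>degree M. emb [:coeff M i:] * carlitz_iter i x)"

definition carlitz_torsion :: "'a::{finite,field} poly \<Rightarrow> 'a clos set" where
  "carlitz_torsion M = {x. carlitz M x = 0}"

definition is_subfield_of_clos :: "'a::field alg_closure set \<Rightarrow> bool" where
  "is_subfield_of_clos S \<longleftrightarrow> 0 \<in> S \<and> 1 \<in> S \<and>
     (\<forall>x\<in>S. \<forall>y\<in>S. x + y \<in> S \<and> x - y \<in> S \<and> x * y \<in> S) \<and>
     (\<forall>x\<in>S. inverse x \<in> S)"

definition cyclotomic_field :: "'a::{finite,field} poly \<Rightarrow> 'a clos set" where
  "cyclotomic_field M =
     \<Inter> {S. range to_ac \<union> carlitz_torsion M \<subseteq> S \<and> is_subfield_of_clos S}"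

definition int_closure :: "'a::{finite,field} clos set \<Rightarrow> 'a clos set" where
  "int_closure K = {x \<in> K. \<exists>p :: 'a poly poly.
      lead_coeff p = 1 \<and> poly (map_poly emb p) x = 0}"

definition OK_ring :: "'a::{finite,field} clos set \<Rightarrow> 'a clos ring" where
  "OK_ring K = \<lparr>carrier = int_closure K, monoid.mult = (*), one = 1,
                 ring.zero = 0, add = (+)\<rparr>"

definition carmichael_in :: "'a::{finite,field} clos set \<Rightarrow> 'a clos \<Rightarrow> bool" where
  "carmichael_in K \<alpha> \<longleftrightarrow>
     carmichael_ideal (OK_ring K) {\<alpha> * x | x. x \<in> int_closure K}"

definition is_basis :: "'a::field alg_closure set \<Rightarrow> nat \<Rightarrow> (nat \<Rightarrow> 'a alg_closure) \<Rightarrow> bool" where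
  "is_basis K n b \<longleftrightarrow> (\<forall>i<n. b i \<in> K) \<and>
     (\<forall>c. (\<Sum>i<n. to_ac (c i) * b i) = 0 \<longrightarrow> (\<forall>i<n. c i = 0)) \<and>
     (\<forall>x\<in>K. \<exists>c. x = (\<Sum>i<n. to_ac (c i) * b i))"

definition ext_degree :: "'a::field alg_closure set \<Rightarrow> nat" where
  "ext_degree K = (THE n. \<exists>b. is_basis K n b)"

definition field_trace :: "'a::field alg_closure set \<Rightarrow> 'a alg_closure \<Rightarrow> 'a" where
  "field_trace K x = (SOME t. \<exists>n b A. is_basis K n b \<and>
      (\<forall>j<n. x * b j = (\<Sum>i<n. to_ac (A i j) * b i)) \<and> t = (\<Sum>i<n. A i i))"

definition det_nat :: "nat \<Rightarrow> (nat \<Rightarrow> nat \<Rightarrow> 'b::comm_ring_1) \<Rightarrow> 'b" where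
  "det_nat n A = (\<Sum>p | p permutes {..<n}. of_int (sign p) * (\<Prod>i<n. A i (p i)))"

definition disc_tuple :: "'a::field alg_closure set \<Rightarrow> (nat \<Rightarrow> 'a alg_closure) \<Rightarrow> 'a" where
  "disc_tuple K x = det_nat (ext_degree K) (\<lambda>i j. field_trace K (x i * x j))"

definition disc_ideal :: "'a::{finite,field} clos set \<Rightarrow> 'a poly set" where
  "disc_ideal K = {d. \<exists>(m::nat) (c :: nat \<Rightarrow> 'a poly) (x :: nat \<Rightarrow> nat \<Rightarrow> 'a clos). (\<forall>j<m. \<forall>i<ext_degree K. x j i \<in> int_closure K) \<and>
      to_fract d = (\<Sum>j<m. to_fract (c j) * disc_tuple K (x j))}"

definition disc_rel_prime :: "'a::{finite,field} clos set \<Rightarrow> 'a poly \<Rightarrow> bool" where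
  "disc_rel_prime K g \<longleftrightarrow>
     (\<forall>P. irreducible P \<and> P dvd g \<longrightarrow> \<not> (\<forall>d\<in>disc_ideal K. P dvd d))"

end

theory Submission
  imports Defs "Jordan_Normal_Form.Char_Poly" "HOL-Library.Cardinality" "HOL-Number_Theory.Number_Theory"
begin

text \<open>
  A prime \<open>P\<close> that is a primitive root modulo an irreducible \<open>M\<close> is inert in the cyclotomic function field
  of \<open>M\<close>, since modulo \<open>P\<close> the Frobenius acts on the \<open>M\<close>-torsion of the Carlitz module as \<open>\<rho>\<^sub>P\<close>. As \<open>g\<close> is
  squarefree and not Carmichael, either \<open>g\<close> is irreducible or some prime factor \<open>P\<close> of \<open>g\<close> has a degree \<open>d\<close> that does not
  divide \<open>D = deg g\<close>. If \<open>P\<close> is inert in a field \<open>K\<close> of degree \<open>n\<close>, then \<open>O\<^sub>K/(g)\<close> has \<open>q\<^sup>n\<^sup>D\<close> elements and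
  the residue field \<open>O\<^sub>K/(P)\<close> has \<open>q\<^sup>n\<^sup>d\<close>; so \<open>O\<^sub>K/(g)\<close> is a field in the first case, and in the second one
  \<open>a \<mapsto> a ^ (q\<^sup>n\<^sup>D)\<close> is not the identity on the residue field.

  Infinitely many such \<open>M\<close> exist by an Artin-type argument. Let \<open>m\<close> be a large prime. The primes dividing \<open>q\<^sup>m - 1\<close> but
  not \<open>q - 1\<close> exceed \<open>m\<close>, and a union bound shows that they exclude a negligible proportion of the irreducible
  polynomials \<open>M\<close> of degree \<open>m\<close>. For the primes dividing \<open>q - 1\<close> one needs that the norm residue symbol \<open>(P/M)\<close> is a
  generator of \<open>F\<^sub>q\<^sup>*\<close>, which by reciprocity is a condition on \<open>M\<close> modulo \<open>P\<close>. A positive proportion of the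
  \<open>M\<close> satisfies it because the \<open>L\<close>-polynomials of the nontrivial characters have no inverse root of absolute value \<open>q\<close>.
\<close>


section \<open>Algebras over the finite field\<close>

hide_const (open) Divisibility.prime Divisibility.irreducible UnivPoly.deg up_ring.monom up_ring.coeff Coset.order

text \<open>P is a primitive root modulo M iff P^((q^m-1)/l) is not 1 modulo M for every prime l
  dividing q^m - 1. If l divides q - 1, this power is the norm of P modulo M raised to (q-1)/l.
  Prescribing the norm to be a generator settles all those l at once; each of them alone excludes a
  fixed proportion of the M, which a union bound cannot control in general. A prime degree m forces
  q to have order m modulo every other l, hence l > m.

  The character sums need only be o(q^m), so Mertens' 3-4-1 argument replaces Weil's bound. It is
  inconclusive for real characters at the inverse roots q and -q, since 3 - 4 + 1 = 0; these get an
  argument of their own.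

  The ring O_K is never determined: it is compared with F_q[t][z] only at primes dividing g, where
  Phi + X Phi' = M keeps Phi separable. Irreducibility of Phi over F_q(t) is itself deduced from the
  inertness of P. Reduction modulo a prime is evaluation at a root in the algebraic closure of F_q,
  which avoids residue rings. The fields obtained are told apart by their degrees.\<close>

lemma card_field_ge_2: "2 \<le> CARD('a::{finite,field})"
proof -
  have "card {0, 1 :: 'a} \<le> CARD('a)" by (intro card_mono) auto
  thus ?thesis by simp
qed

lemma field_power_card_minus_1:
  fixes x :: "'a::{finite,field}"
  assumes "x \<noteq> 0"
  shows "x ^ (CARD('a) - 1) = 1"
proof -
  let ?U = "UNIV - {0::'a}"
  have inj: "inj_on ((*) x) ?U" using assms by (auto simp: inj_on_def)
  have "(*) x ` ?U = ?U"
    by (rule card_subset_eq) (use assms inj in \<open>auto simp: card_image\<close>)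
  hence "prod id ?U = prod id ((*) x ` ?U)" by simp
  also have "\<dots> = (\<Prod>y\<in>?U. x * y)" using inj by (simp add: prod.reindex)
  also have "\<dots> = x ^ (CARD('a) - 1) * prod id ?U"
    by (simp add: prod.distrib)
  finally have "prod id ?U * 1 = prod id ?U * x ^ (CARD('a) - 1)" by (simp add: mult.commute)
  moreover have "prod id ?U \<noteq> 0" by (subst prod_zero_iff) auto
  ultimately show ?thesis by (metis mult_left_cancel)
qed

lemma field_power_card: "(x::'a::{finite,field}) ^ CARD('a) = x"
proof (cases "x = 0")
  case False
  have "x ^ CARD('a) = x ^ (CARD('a) - 1) * x"
    using card_field_ge_2[where 'a='a] by (metis Suc_diff_1 finite_UNIV_card_ge_0 finite power_Suc2)
  thus ?thesis using field_power_card_minus_1[OF False] by simp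
qed (use card_field_ge_2[where 'a='a] in auto)

lemma poly_eqI_finite:
  fixes p r :: "'b::idom poly"
  assumes "degree p < card S" "degree r < card S" "\<And>x. x \<in> S \<Longrightarrow> poly p x = poly r x"
  shows "p = r"
proof (rule ccontr)
  assume "p \<noteq> r"
  hence nz: "p - r \<noteq> 0" by simp
  have "S \<subseteq> {x. poly (p - r) x = 0}" using assms(3) by auto
  hence "card S \<le> card {x. poly (p - r) x = 0}" using poly_roots_finite[OF nz] by (rule card_mono[rotated])
  also have "\<dots> \<le> degree (p - r)" by (rule card_poly_roots_bound[OF nz])
  also have "\<dots> < card S" using assms(1,2) by (metis degree_diff_le_max le_less_trans max_less_iff_conj)
  finally show False by simp
qed

lemma card_roots_le:
  fixes p :: "'b::idom poly"
  assumes "p \<noteq> 0" "\<And>x. x \<in> S \<Longrightarrow> poly p x = 0"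
  shows "card S \<le> degree p"
proof -
  have "card S \<le> card {x. poly p x = 0}" using assms poly_roots_finite[OF assms(1)] by (intro card_mono) auto
  thus ?thesis using card_poly_roots_bound[OF assms(1)] by simp
qed

lemma card_power_eq_le:
  assumes "n > 0" shows "card {x::'b::idom. x ^ n = c} \<le> n" "finite {x::'b::idom. x ^ n = c}"
proof -
  let ?p = "monom (1::'b) n - [:c:]"
  have nz: "?p \<noteq> 0" using assms by (metis coeff_monom coeff_pCons_Suc coeff_0 diff_eq_diff_eq eq_iff_diff_eq_0 gr0_implies_Suc one_neq_zero)
  have eq: "{x::'b. x ^ n = c} = {x. poly ?p x = 0}" by (auto simp: poly_monom)
  have "degree ?p \<le> n" by (intro degree_diff_le) (auto simp: degree_monom_eq)
  thus "card {x::'b. x ^ n = c} \<le> n" unfolding eq using card_poly_roots_bound[OF nz] by linarith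
  show "finite {x::'b. x ^ n = c}" unfolding eq using poly_roots_finite[OF nz] .
qed

text \<open>The same computations are used in three rings: F_q[t], the algebraic closure of F_q,
  where reductions modulo primes take their values, and the algebraic closure of F_q(t).\<close>

locale fq_algebra = inj_idom_hom \<iota> for \<iota> :: "'a::{finite,field} \<Rightarrow> 'b::idom" +
  fixes q :: nat
  assumes q_eq: "q = CARD('a)"
begin

lemma q_ge_2: "q \<ge> 2" unfolding q_eq by (rule card_field_ge_2)
lemma q_pos [simp]: "q > 0" using q_ge_2 by simp
lemma iota_pow_q: "\<iota> c ^ q = \<iota> c" unfolding q_eq by (simp add: field_power_card flip: hom_power)

lemma inj_iota: "inj \<iota>" by (simp add: inj_def)

text \<open>Both sides are monic of degree q and vanish on F_q, so the difference has degree below q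
  and q roots.\<close>

lemma monom_q_minus_X: "monom 1 q - monom 1 1 = (\<Prod>c\<in>UNIV. [:- \<iota> c, 1:])"
proof -
  let ?p = "monom (1::'b) q - monom 1 1" and ?r = "\<Prod>c\<in>(UNIV::'a set). [:- \<iota> c, 1:]"
  have dr: "degree ?r = q" by (subst degree_prod_sum_eq) (auto simp: q_eq)
  have lr: "lead_coeff ?r = 1" by (simp add: lead_coeff_prod)
  have "degree (?p - ?r) < q"
  proof -
    have "degree (monom (1::'b) q - ?r) < q"
    proof (rule degree_lessI)
      show "monom (1::'b) q - ?r \<noteq> 0 \<or> 0 < q" by simp
      show "\<forall>k\<ge>q. coeff (monom (1::'b) q - ?r) k = 0"
      proof safe
        fix k assume "k \<ge> q" thus "coeff (monom (1::'b) q - ?r) k = 0"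
          using lr dr by (cases "k = q") (auto simp: coeff_eq_0)
      qed
    qed
    moreover have "degree (monom (1::'b) 1) < q" using q_ge_2 by (simp add: degree_monom_eq)
    moreover have "?p - ?r = (monom 1 q - ?r) - monom 1 1" by simp
    ultimately show ?thesis by (metis degree_diff_less)
  qed
  moreover have "poly (?p - ?r) x = poly 0 x" if x: "x \<in> range \<iota>" for x
  proof -
    from x obtain c where c: "x = \<iota> c" by auto
    have "poly ?r x = 0" unfolding poly_prod c by (subst prod_zero_iff) auto
    moreover have "poly ?p x = 0" using iota_pow_q[of c] unfolding c
      by (simp add: poly_monom)
    ultimately show ?thesis by simp
  qed
  moreover have "card (range \<iota>) = q" by (simp add: card_image inj_iota q_eq)
  ultimately have "?p - ?r = 0" by (intro poly_eqI_finite[of _ "range \<iota>"]) (auto simp: q_pos)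
  thus ?thesis by simp
qed

lemma pow_q_minus: "(x::'b) ^ q - x = (\<Prod>c\<in>UNIV. x - \<iota> c)"
proof -
  have "x ^ q - x = poly (monom 1 q - monom 1 1) x" by (simp add: poly_monom)
  also have "\<dots> = (\<Prod>c\<in>UNIV. x - \<iota> c)" unfolding monom_q_minus_X by (simp add: poly_prod)
  finally show ?thesis .
qed

lemma fixed_iff: "(x::'b) ^ q = x \<longleftrightarrow> x \<in> range \<iota>"
proof -
  have "x ^ q = x \<longleftrightarrow> (\<Prod>c\<in>UNIV. x - \<iota> c) = 0" by (simp flip: pow_q_minus)
  also have "\<dots> \<longleftrightarrow> x \<in> range \<iota>" by (subst prod_zero_iff) auto
  finally show ?thesis .
qed

text \<open>\<open>X\<^sup>q - X\<close> is invariant under translation by the finite field, so for fixed \<open>y\<close> the additivity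
  defect, a polynomial in \<open>x\<close> of degree below \<open>q\<close>, vanishes at \<open>q\<close> points.\<close>

lemma frob_add: "((x::'b) + y) ^ q = x ^ q + y ^ q"
proof -
  have trans: "(z + \<iota> c) ^ q - (z + \<iota> c) = z ^ q - z" for z c
  proof -
    have "(z + \<iota> c) ^ q - (z + \<iota> c) = (\<Prod>c'\<in>UNIV. z + \<iota> c - \<iota> c')" by (rule pow_q_minus)
    also have "\<dots> = (\<Prod>c'\<in>UNIV. z - \<iota> c')"
      by (rule prod.reindex_bij_witness[of _ "\<lambda>c'. c' + c" "\<lambda>c'. c' - c"]) (auto simp: hom_distribs)
    finally show ?thesis by (simp add: pow_q_minus)
  qed
  define p where "p = [:y, 1:] ^ q - monom 1 q - [:y ^ q:]"
  have "degree p < q" unfolding p_def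
  proof (rule degree_lessI)
    show "[:y, 1:] ^ q - monom 1 q - [:y ^ q:] \<noteq> 0 \<or> 0 < q" by simp
    show "\<forall>k\<ge>q. coeff ([:y, 1:] ^ q - monom 1 q - [:y ^ q:]) k = 0"
    proof safe
      fix k assume k: "k \<ge> q"
      have d: "degree ([:y, 1:] ^ q) = q" by (simp add: degree_power_eq)
      have l: "coeff ([:y, 1:] ^ q) q = 1" using lead_coeff_power[of "[:y,1:]" q] d by simp
      have "coeff [:y ^ q:] k = 0" using k q_pos by (cases k) auto
      thus "coeff ([:y, 1:] ^ q - monom 1 q - [:y ^ q:]) k = 0"
        using k d l by (cases "k = q") (auto simp: coeff_eq_0)
    qed
  qed
  moreover have "poly p x = poly 0 x" if "x \<in> range \<iota>" for x
  proof -
    from that obtain c where c: "x = \<iota> c" by auto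
    have "x ^ q = x" using that fixed_iff by blast
    moreover have "(y + x) ^ q - (y + x) = y ^ q - y" unfolding c by (rule trans)
    ultimately show ?thesis by (simp add: p_def poly_monom algebra_simps)
  qed
  moreover have "card (range \<iota>) = q" by (simp add: card_image inj_iota q_eq)
  ultimately have "p = 0" by (intro poly_eqI_finite[of _ "range \<iota>"]) (auto simp: q_pos)
  hence "poly p x = 0" by simp
  thus ?thesis by (simp add: p_def poly_monom algebra_simps)
qed

lemma frob_sum: "(\<Sum>x\<in>A. f x :: 'b) ^ q = (\<Sum>x\<in>A. f x ^ q)"
  by (induction A rule: infinite_finite_induct) (auto simp: frob_add q_pos zero_power)

lemma frob_minus: "(- (x::'b)) ^ q = - (x ^ q)"
proof -
  have "(x + - x) ^ q = x ^ q + (- x) ^ q" by (rule frob_add)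
  thus ?thesis using q_pos by (simp add: zero_power add_eq_0_iff)
qed

lemma frob_diff: "((x::'b) - y) ^ q = x ^ q - y ^ q"
  using frob_add[of x "-y"] by (simp add: frob_minus)

lemma frobi_diff: "((x::'b) - y) ^ (q ^ i) = x ^ (q ^ i) - y ^ (q ^ i)"
  by (induction i) (simp_all add: power_mult frob_diff mult.commute[of q])

lemma frobi_sum: "(\<Sum>x\<in>A. f x :: 'b) ^ (q ^ i) = (\<Sum>x\<in>A. f x ^ (q ^ i))"
  by (induction i) (simp_all add: power_mult frob_sum mult.commute[of q])

lemma frobi_inj: "(x::'b) ^ (q ^ i) = y ^ (q ^ i) \<longleftrightarrow> x = y"
proof
  assume "x ^ (q ^ i) = y ^ (q ^ i)"
  hence "(x - y) ^ (q ^ i) = 0" by (simp add: frobi_diff)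
  thus "x = y" by simp
qed auto

lemma iota_frobi [simp]: "\<iota> c ^ (q ^ i) = \<iota> c"
  by (induction i) (simp_all add: power_mult mult.commute[of q] iota_pow_q)

text \<open>Specialization of t to \<open>\<tau>\<close>. For a root \<open>\<tau>\<close> of an
  irreducible P this is reduction modulo P; for the image of t it is the embedding of
  F_q[t].\<close>

definition ev :: "'b \<Rightarrow> 'a poly \<Rightarrow> 'b" where "ev \<tau> p = poly (map_poly \<iota> p) \<tau>"

sublocale mp: map_poly_inj_idom_hom \<iota> ..

lemma ev_hom: "comm_ring_hom (ev \<tau>)"
  by unfold_locales (auto simp: ev_def mp.hom_add mp.hom_mult)

lemma ev_add [simp]: "ev \<tau> (x + y) = ev \<tau> x + ev \<tau> y" 
  and ev_mult [simp]: "ev \<tau> (x * y) = ev \<tau> x * ev \<tau> y" 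
  and ev_minus [simp]: "ev \<tau> (- x) = - ev \<tau> x"
  and ev_diff [simp]: "ev \<tau> (x - y) = ev \<tau> x - ev \<tau> y" 
  and ev_0 [simp]: "ev \<tau> 0 = 0" 
  and ev_1 [simp]: "ev \<tau> 1 = 1" 
  and ev_pow [simp]: "ev \<tau> (x ^ n) = ev \<tau> x ^ n"
  and ev_X [simp]: "ev \<tau> [:0,1:] = \<tau>"
  by (auto simp: ev_def mp.hom_add mp.hom_mult mp.hom_minus mp.hom_uminus mp.hom_power)

lemma ev_const [simp]: "ev \<tau> [:c:] = \<iota> c"
  by (simp add: ev_def poly_altdef coeff_map_poly)

lemma ev_sum: "ev \<tau> (\<Sum>i\<in>A. f i) = (\<Sum>i\<in>A. ev \<tau> (f i))"
  by (induction A rule: infinite_finite_induct) auto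

lemma ev_altdef: "ev \<tau> p = (\<Sum>i\<le>degree p. \<iota> (coeff p i) * \<tau> ^ i)"
  by (simp add: ev_def poly_altdef)

lemma ev_frobi: "ev \<tau> p ^ (q ^ i) = ev (\<tau> ^ (q ^ i)) p"
  by (simp add: ev_altdef frobi_sum power_mult_distrib flip: power_mult)
    (simp add: mult.commute)

end

section \<open>Polynomials over a field: Bezout identities, irreducible factors, counting\<close>

lemma irreducible_poly_degree_pos:
  "irreducible (P :: 'a::field poly) \<Longrightarrow> degree P > 0"
  by (metis gr0I irreducible_def is_unit_iff_degree)

text \<open>A nonzero element of least degree in the ideal generated by A and B divides both,
  because remainders stay in the ideal; so it is a unit.\<close>

lemma poly_bezout:
  fixes A B :: "'a::field poly"
  assumes B: "B \<noteq> 0" and common: "\<And>D. D dvd A \<Longrightarrow> D dvd B \<Longrightarrow> is_unit D"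
  obtains u v where "u * A + v * B = 1"
proof -
  define I where "I = {u * A + v * B | u v. True}"
  have "B = 0 * A + 1 * B" by simp
  hence BI: "B \<in> I" unfolding I_def by blast
  have "A = 1 * A + 0 * B" by simp
  hence AI: "A \<in> I" unfolding I_def by blast
  define D where "D = (ARG_MIN degree x. x \<in> I \<and> x \<noteq> 0)"
  have D: "D \<in> I" "D \<noteq> 0" and Dmin: "\<And>x. x \<in> I \<Longrightarrow> x \<noteq> 0 \<Longrightarrow> degree D \<le> degree x"
    using arg_min_natI[of "\<lambda>x. x \<in> I \<and> x \<noteq> 0" B degree] arg_min_nat_le[of "\<lambda>x. x \<in> I \<and> x \<noteq> 0" _ degree] BI B
    unfolding D_def by auto
  have dvd: "D dvd x" if "x \<in> I" for x
  proof -
    have "x mod D = x - (x div D) * D" by (simp add: minus_div_mult_eq_mod)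
    also have "\<dots> \<in> I"
    proof -
      from that obtain u v where "x = u * A + v * B" by (auto simp: I_def)
      moreover from D(1) obtain u' v' where "D = u' * A + v' * B" by (auto simp: I_def)
      ultimately have "x - (x div D) * D = (u - (x div D) * u') * A + (v - (x div D) * v') * B"
        by (simp add: algebra_simps)
      thus ?thesis unfolding I_def by blast
    qed
    finally have "x mod D \<in> I" .
    moreover have "x mod D = 0 \<or> degree (x mod D) < degree D" using D(2) degree_mod_less by blast
    ultimately have "x mod D = 0" using Dmin[of "x mod D"] by (meson not_less)
    thus ?thesis by (simp add: dvd_eq_mod_eq_0)
  qed
  have "is_unit D" by (rule common[OF dvd[OF AI] dvd[OF BI]])
  then obtain e where e: "1 = D * e" by (elim dvdE)
  from D(1) obtain u v where "D = u * A + v * B" by (auto simp: I_def)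
  hence "(e * u) * A + (e * v) * B = 1" using e by (simp add: algebra_simps)
  thus ?thesis by (rule that)
qed

lemma irreducible_bezout:
  fixes P A :: "'a::field poly"
  assumes irr: "irreducible P" and nd: "\<not> P dvd A"
  obtains u v where "u * A + v * P = 1"
proof -
  have unit: "is_unit D" if D: "D dvd A" "D dvd P" for D
  proof (rule ccontr)
    assume nu: "\<not> is_unit D"
    obtain k where k: "P = D * k" using D(2) by (elim dvdE)
    hence "is_unit k" using irr nu by (auto dest: irreducibleD)
    hence "P dvd D" unfolding k by (metis dvd_refl mult_unit_dvd_iff)
    thus False using D(1) nd dvd_trans by blast
  qed
  have "P \<noteq> 0" using irr by auto
  then obtain u v where "u * A + v * P = 1" by (rule poly_bezout) (rule unit)
  thus ?thesis by (rule that)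
qed

lemma irreducible_dvd_mult_iff:
  fixes P :: "'a::field poly"
  assumes "irreducible P" shows "P dvd a * b \<longleftrightarrow> P dvd a \<or> P dvd b"
  using field_poly_irreducible_imp_prime[OF assms] by (simp add: prime_elem_dvd_mult_iff)

lemma irreducible_dvd_power:
  fixes P :: "'a::field poly"
  assumes "irreducible P" "P dvd a ^ n" shows "P dvd a"
  using field_poly_irreducible_imp_prime[OF assms(1)] assms(2) by (rule prime_elem_dvd_power)

lemma exists_monic_irreducible_factor:
  fixes p :: "'a::field poly"
  assumes "degree p > 0"
  obtains P where "irreducible P" "lead_coeff P = 1" "P dvd p"
  using assms
proof (induction "degree p" arbitrary: p thesis rule: less_induct)
  case less
  show ?case
  proof (cases "irreducible p")
    case True
    let ?P = "smult (inverse (lead_coeff p)) p"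
    have "p \<noteq> 0" using True by auto
    have "irreducible ?P" using True \<open>p \<noteq> 0\<close> by simp
    moreover have "lead_coeff ?P = 1" using \<open>p \<noteq> 0\<close> by simp
    moreover have "?P dvd p" using \<open>p \<noteq> 0\<close> by (simp add: smult_dvd_iff)
    ultimately show ?thesis by (rule less.prems(1))
  next
    case False
    have p0: "p \<noteq> 0" using less.prems by auto
    have "\<not> is_unit p" using less.prems(2) p0 by (simp add: is_unit_iff_degree)
    then obtain a b where ab: "p = a * b" "\<not> is_unit a" "\<not> is_unit b"
      using False p0 by (auto simp: irreducible_def)
    have nz: "a \<noteq> 0" "b \<noteq> 0" using ab(1) p0 by auto
    hence da: "degree a > 0" "degree b > 0" using ab by (auto simp: is_unit_iff_degree)
    have "degree a < degree p" unfolding ab(1) using nz da by (simp add: degree_mult_eq)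
    from less.hyps[OF this _ da(1)] obtain P where "irreducible P" "lead_coeff P = 1" "P dvd a" by blast
    thus ?thesis using less.prems(1) ab(1) by (metis dvd_mult2)
  qed
qed

text \<open>The coefficient set is arbitrary because it will be F_q in one use and, for
  \<open>box\<close>, a set of polynomials of bounded degree in another. Vanishing coefficients
  instead of a degree bound make \<open>n = 0\<close> harmless.\<close>

lemma card_polys_with_coeffs:
  fixes S :: "'c::zero set"
  assumes "finite S" "0 \<in> S"
  shows "card {p. (\<forall>i. coeff p i \<in> S) \<and> (\<forall>i\<ge>n. coeff p i = 0)} = card S ^ n"
    and "finite {p. (\<forall>i. coeff p i \<in> S) \<and> (\<forall>i\<ge>n. coeff p i = 0)}"
proof -
  let ?T = "\<lambda>n. {p. (\<forall>i. coeff p i \<in> S) \<and> (\<forall>i\<ge>n. coeff p i = 0)}"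
  have "card (?T n) = card S ^ n \<and> finite (?T n)"
  proof (induction n)
    case 0
    have "?T 0 = {0}" using assms by (auto simp: poly_eq_iff)
    thus ?case by simp
  next
    case (Suc n)
    have "?T (Suc n) = (\<lambda>(c,p). pCons c p) ` (S \<times> ?T n)"
    proof (intro equalityI subsetI)
      fix p assume p: "p \<in> ?T (Suc n)"
      obtain c r where cr: "p = pCons c r" by (cases p) auto
      have "c \<in> S" using p unfolding cr by (metis (mono_tags) mem_Collect_eq coeff_pCons_0)
      moreover have "coeff r i \<in> S" for i using p unfolding cr by (metis (mono_tags) mem_Collect_eq coeff_pCons_Suc)
      moreover have "coeff r i = 0" if "i \<ge> n" for i
        using p that unfolding cr by (metis (mono_tags) mem_Collect_eq coeff_pCons_Suc Suc_le_mono)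
      ultimately show "p \<in> (\<lambda>(c,p). pCons c p) ` (S \<times> ?T n)" unfolding cr by auto
    next
      fix p assume "p \<in> (\<lambda>(c,p). pCons c p) ` (S \<times> ?T n)"
      thus "p \<in> ?T (Suc n)" by (auto simp: coeff_pCons split: nat.splits)
    qed
    moreover have "inj_on (\<lambda>(c,p). pCons c p) (S \<times> ?T n)" by (auto simp: inj_on_def)
    ultimately show ?case using Suc assms by (simp add: card_image card_cartesian_product)
  qed
  thus "card (?T n) = card S ^ n" "finite (?T n)" by auto
qed

lemma degree_less_iff_coeff:
  assumes "n > 0" shows "degree p < n \<longleftrightarrow> (\<forall>i\<ge>n. coeff p i = 0)"
  using assms by (metis coeff_eq_0 le_degree leI le_less_trans degree_0 leading_coeff_0_iff not_less)

lemma card_polys_degree_less: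
  assumes "n > 0" 
  shows "card {p :: 'a::{finite,zero} poly. degree p < n} = CARD('a) ^ n" 
    and "finite {p :: 'a::{finite,zero} poly. degree p < n}"
  using card_polys_with_coeffs[of "UNIV :: 'a set" n] by (simp_all add: degree_less_iff_coeff[OF assms])

section \<open>Roots of irreducible polynomials and their Frobenius orbits\<close>

context fq_algebra
begin

lemma ev_eq_0_iff:
  assumes "irreducible P" "ev \<beta> P = 0"
  shows "ev \<beta> A = 0 \<longleftrightarrow> P dvd A"
proof
  assume A: "ev \<beta> A = 0"
  show "P dvd A"
  proof (rule ccontr)
    assume "\<not> P dvd A"
    then obtain u v where "u * A + v * P = 1" by (rule irreducible_bezout[OF assms(1)])
    hence "ev \<beta> (u * A + v * P) = 1" by simp
    thus False using A assms(2) by simp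
  qed
qed (use assms(2) in auto)

lemma ev_eq_iff:
  assumes "irreducible P" "ev \<beta> P = 0"
  shows "ev \<beta> A = ev \<beta> B \<longleftrightarrow> P dvd A - B"
  using ev_eq_0_iff[OF assms, of "A - B"] by simp

lemma frob_hom: "comm_ring_hom (\<lambda>x::'b. x ^ q)"
  by unfold_locales (auto simp: frob_add power_mult_distrib)

lemma descend_poly:
  assumes "\<And>i. coeff G i ^ q = coeff G i"
  obtains G0 where "G = map_poly \<iota> G0"
proof -
  have *: "coeff G i = \<iota> (inv_into UNIV \<iota> (coeff G i))" for i
    using assms fixed_iff by (metis f_inv_into_f)
  have "inv_into UNIV \<iota> 0 = 0" using inj_iota by (metis hom_zero inv_f_f)
  hence "G = map_poly \<iota> (map_poly (inv_into UNIV \<iota>) G)"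
    by (intro poly_eqI) (simp add: coeff_map_poly * [symmetric])
  thus ?thesis by (rule that)
qed

text \<open>All q-power conjugates of \<open>\<beta>\<close> are roots of P, so the orbit has at
  most d elements. The monic polynomial whose roots form the orbit is fixed by Frobenius, so it
  comes from F_q and is a multiple of P; comparing degrees identifies the two up to a
  constant.\<close>

lemma frobenius_orbit:
  assumes irr: "irreducible P" and root: "ev \<beta> P = 0"
  defines "d \<equiv> degree P"
  shows "\<beta> ^ (q ^ d) = \<beta>" "inj_on (\<lambda>i. \<beta> ^ (q ^ i)) {..<d}"
    and "map_poly \<iota> P = smult (\<iota> (lead_coeff P)) (\<Prod>i<d. [:- (\<beta> ^ (q ^ i)), 1:])"
proof -
  let ?f = "\<lambda>i. \<beta> ^ (q ^ i)"
  have P0: "P \<noteq> 0" using irr by auto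
  have roots: "poly (map_poly \<iota> P) (?f i) = 0" for i
    using root by (metis ev_def ev_frobi q_pos zero_less_power zero_power)
  have shift: "?f j = ?f i \<Longrightarrow> i \<le> j \<Longrightarrow> ?f (j - i) = \<beta>" for i j
  proof -
    assume a: "?f j = ?f i" "i \<le> j"
    hence "q ^ j = q ^ (j - i) * q ^ i" by (simp flip: power_add)
    hence "?f (j - i) ^ (q ^ i) = \<beta> ^ (q ^ i)" using a by (metis power_mult)
    thus ?thesis by (simp only: frobi_inj)
  qed
  have "\<not> inj_on ?f {..d}"
  proof
    assume "inj_on ?f {..d}"
    hence "card (?f ` {..d}) = Suc d" by (simp add: card_image)
    moreover have "card (?f ` {..d}) \<le> degree (map_poly \<iota> P)"
      by (rule card_roots_le) (use P0 roots in auto)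
    ultimately show False by (simp add: d_def)
  qed
  then obtain i0 j0 where ij: "i0 < j0" "j0 \<le> d" "?f i0 = ?f j0"
    unfolding inj_on_def by (metis atMost_iff linorder_neqE_nat)
  define e where "e = (LEAST e. e > 0 \<and> ?f e = \<beta>)"
  have e0: "e > 0 \<and> ?f e = \<beta>" unfolding e_def 
    by (rule LeastI[of _ "j0 - i0"]) (use ij shift[of j0 i0] in auto)
  have emin: "e \<le> k" if "k > 0" "?f k = \<beta>" for k unfolding e_def using that by (intro Least_le) auto
  have ed: "e \<le> d" using emin[of "j0 - i0"] shift[of j0 i0] ij by simp
  have inj: "inj_on ?f {..<e}"
  proof (rule linorder_inj_onI)
    fix i j assume ij: "i < j" "i \<in> {..<e}" "j \<in> {..<e}"
    show "?f i \<noteq> ?f j"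
    proof
      assume "?f i = ?f j"
      hence "?f (j - i) = \<beta>" using shift[of j i] ij by simp
      thus False using emin[of "j - i"] ij by simp
    qed
  qed auto
  define G where "G = (\<Prod>i<e. [:- ?f i, 1:])"
  have dG: "degree G = e" unfolding G_def by (subst degree_prod_sum_eq) auto
  have lG: "lead_coeff G = 1" unfolding G_def by (simp add: lead_coeff_prod)
  interpret F: comm_ring_hom "\<lambda>x::'b. x ^ q" by (rule frob_hom)
  interpret FP: map_poly_comm_ring_hom "\<lambda>x::'b. x ^ q" ..
  \<comment> \<open>Frobenius moves factor i to factor i + 1, and the last one returns to the first
    because \<open>?f e = \<beta>\<close>.\<close>
  have "map_poly (\<lambda>x. x ^ q) G = (\<Prod>i<e. [:- ?f (Suc i), 1:])"
    unfolding G_def FP.hom_prod by (intro prod.cong refl)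
      (simp add: hom_distribs frob_minus F.map_poly_pCons_hom power_mult mult.commute[of q])
  also have "\<dots> = G"
  proof -
    obtain e' where e': "e = Suc e'" using e0 by (cases e) auto
    have "(\<Prod>i<e. [:- ?f (Suc i), 1:]) = (\<Prod>i<e'. [:- ?f (Suc i), 1:]) * [:- ?f e, 1:]"
      by (simp add: e')
    also have "\<dots> = [:- ?f 0, 1:] * (\<Prod>i<e'. [:- ?f (Suc i), 1:])" using e0 by simp
    also have "\<dots> = G" unfolding G_def e' by (rule prod.lessThan_Suc_shift[symmetric])
    finally show ?thesis .
  qed
  finally have "map_poly (\<lambda>x. x ^ q) G = G" .
  hence "coeff G i ^ q = coeff G i" for i by (metis F.coeff_map_poly_hom)
  then obtain G0 where G0: "G = map_poly \<iota> G0" by (rule descend_poly)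
  have "poly G \<beta> = 0" unfolding G_def poly_prod using e0 by (subst prod_zero_iff) (auto intro!: bexI[of _ 0])
  hence "P dvd G0" using ev_eq_0_iff[OF irr root] by (simp add: ev_def G0)
  then obtain c where c: "G0 = P * c" by (elim dvdE)
  have dG0: "degree G0 = e" using dG by (simp add: G0)
  have "G0 \<noteq> 0" using dG0 e0 by auto
  hence nz: "c \<noteq> 0" using c by auto
  hence "e = d + degree c" using dG0 c P0 by (simp add: degree_mult_eq d_def)
  hence de: "e = d" "degree c = 0" using ed by auto
  then obtain c0 where c0: "c = [:c0:]" by (metis degree_eq_zeroE)
  have "lead_coeff G0 = 1" using lG by (simp add: G0 flip: hom_one)
  hence lc: "lead_coeff P * c0 = 1" using c c0 nz by (auto simp: mult.commute)
  have "smult (lead_coeff P) G0 = P" using lc by (simp add: c c0 mult.commute[of _ c0])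
  hence "map_poly \<iota> P = smult (\<iota> (lead_coeff P)) G" unfolding G0 by (metis map_poly_smult hom_mult hom_zero)
  thus "map_poly \<iota> P = smult (\<iota> (lead_coeff P)) (\<Prod>i<d. [:- (\<beta> ^ (q ^ i)), 1:])"
    by (simp add: G_def de)
  show "\<beta> ^ (q ^ d) = \<beta>" "inj_on ?f {..<d}" using e0 inj de by auto
qed

lemma ev_as_prod:
  assumes "irreducible P" "ev \<beta> P = 0"
  shows "ev x P = \<iota> (lead_coeff P) * (\<Prod>i<degree P. x - \<beta> ^ (q ^ i))"
  unfolding ev_def frobenius_orbit(3)[OF assms] by (simp add: poly_prod)

lemma ev_frob_period:
  assumes "irreducible P" "ev \<beta> P = 0"
  shows "ev \<beta> A ^ (q ^ degree P) = ev \<beta> A"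
  by (simp add: ev_frobi frobenius_orbit(1)[OF assms])

lemma frob_ne:
  assumes "irreducible P" "ev \<beta> P = 0" "0 < i" "i < degree P"
  shows "\<beta> ^ (q ^ i) \<noteq> \<beta>"
  using inj_onD[OF frobenius_orbit(2)[OF assms(1,2)], of i 0] assms(3,4) by auto

lemma inj_on_ev:
  assumes "irreducible P" "ev \<beta> P = 0"
  shows "inj_on (ev \<beta>) {r. degree r < degree P}"
proof (rule inj_onI)
  fix r s assume rs: "r \<in> {r. degree r < degree P}" "s \<in> {r. degree r < degree P}" "ev \<beta> r = ev \<beta> s"
  hence "P dvd r - s" using ev_eq_iff[OF assms] by simp
  moreover have "degree (r - s) < degree P" using rs by (simp add: degree_diff_less)
  ultimately show "r = s" by (metis dvd_imp_degree_le eq_iff_diff_eq_0 not_less)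
qed

lemma ev_mod:
  assumes "ev \<beta> P = 0" shows "ev \<beta> (A mod P) = ev \<beta> A"
proof -
  have "ev \<beta> (A div P * P + A mod P) = ev \<beta> (A mod P)" using assms by (simp only: ev_add ev_mult) simp
  thus ?thesis by simp
qed

end

section \<open>Monic polynomials and the von Mangoldt identity\<close>

definition monics :: "nat \<Rightarrow> 'a::{finite,field} poly set" where
  "monics k = {A. degree A = k \<and> lead_coeff A = 1}"

definition monic_irr :: "'a::{finite,field} poly set" where
  "monic_irr = {Q. irreducible Q \<and> lead_coeff Q = 1}"

lemma monic_irr_degree_pos: "Q \<in> monic_irr \<Longrightarrow> degree Q > 0"
  by (simp add: monic_irr_def irreducible_poly_degree_pos)

lemma monics_altdef: "monics k = (\<lambda>r. monom 1 k + r) ` {r::'a::{finite,field} poly. \<forall>i\<ge>k. coeff r i = 0}"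
proof (intro equalityI subsetI)
  fix A :: "'a poly" assume A: "A \<in> monics k"
  have "coeff (A - monom 1 k) i = 0" if "i \<ge> k" for i
    using A that by (cases "i = k") (auto simp: monics_def coeff_eq_0)
  moreover have "A = monom 1 k + (A - monom 1 k)" by simp
  ultimately show "A \<in> (\<lambda>r. monom 1 k + r) ` {r. \<forall>i\<ge>k. coeff r i = 0}" by blast
next
  fix A :: "'a poly" assume "A \<in> (\<lambda>r. monom 1 k + r) ` {r. \<forall>i\<ge>k. coeff r i = 0}"
  then obtain r where r: "A = monom 1 k + r" "\<forall>i\<ge>k. coeff r i = 0" by auto
  have "coeff A k = 1" using r by simp
  moreover have "coeff A i = 0" if "i > k" for i using r that by simp
  ultimately have "degree A = k"
    by (metis degree_le le_degree le_antisym zero_neq_one)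
  thus "A \<in> monics k" using \<open>coeff A k = 1\<close> by (simp add: monics_def)
qed

lemma card_monics: "card (monics k :: 'a::{finite,field} poly set) = CARD('a) ^ k"
  and finite_monics [simp]: "finite (monics k :: 'a::{finite,field} poly set)"
proof -
  have inj: "inj_on (\<lambda>r::'a poly. monom 1 k + r) Y" for Y by (auto simp: inj_on_def)
  show "card (monics k :: 'a poly set) = CARD('a) ^ k" "finite (monics k :: 'a poly set)"
    unfolding monics_altdef card_image[OF inj]
    using card_polys_with_coeffs[of "UNIV :: 'a set" k] by simp_all
qed

lemma monic_irr_dvd_eq:
  assumes "Q \<in> monic_irr" "Q' \<in> monic_irr" "Q dvd Q'"
  shows "Q = Q'"
proof -
  obtain c where c: "Q' = Q * c" using assms(3) by (elim dvdE)
  have "\<not> is_unit Q" using assms(1) by (auto simp: monic_irr_def)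
  hence "is_unit c" using c assms(2) by (auto simp: monic_irr_def dest: irreducibleD)
  then obtain c0 where c0: "c = [:c0:]" by (metis is_unit_iff_degree degree_eq_zeroE dvd_0_left_iff zero_neq_one)
  have "lead_coeff Q' = 1" "lead_coeff Q = 1" using assms by (auto simp: monic_irr_def)
  hence "c0 = 1" unfolding c c0 by (auto split: if_splits)
  thus ?thesis using c c0 by simp
qed

lemma irreducible_power_dvd_mult:
  fixes Q :: "'a::field poly"
  assumes "irreducible Q" "\<not> Q dvd R" "Q ^ e dvd R * B"
  shows "Q ^ e dvd B"
  using assms(3)
proof (induction e arbitrary: B)
  case (Suc e)
  have "Q dvd R * B" using Suc.prems by (metis dvd_mult_left power_Suc)
  hence "Q dvd B" using assms irreducible_dvd_mult_iff by blast
  then obtain B' where B': "B = Q * B'" by (elim dvdE)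
  have "Q * Q ^ e dvd Q * (R * B')" using Suc.prems by (simp add: B' mult.left_commute)
  hence "Q ^ e dvd R * B'" using assms(1) by (metis dvd_mult_cancel_left irreducible_def)
  from Suc.IH[OF this] show ?case unfolding B' by (simp add: mult_dvd_mono)
qed auto

text \<open>An irreducible factor of multiplicity r occurs in r pairs, so that multiplicities are
  counted without a factorization.\<close>

definition prime_powers_dvd :: "'a::{finite,field} poly \<Rightarrow> ('a poly \<times> nat) set" where
  "prime_powers_dvd A = {(Q, e). Q \<in> monic_irr \<and> e \<ge> 1 \<and> Q ^ e dvd A}"

lemma sum_degree_prime_powers_dvd:
  fixes A :: "'a::{finite,field} poly"
  assumes "lead_coeff A = 1"
  shows "finite (prime_powers_dvd A) \<and> (\<Sum>(Q,e)\<in>prime_powers_dvd A. degree Q) = degree A"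
  using assms
proof (induction "degree A" arbitrary: A rule: less_induct)
  case less
  show ?case
  proof (cases "degree A = 0")
    case True
    hence A: "A = 1" using less.prems by (auto elim!: degree_eq_zeroE simp: one_pCons)
    have "prime_powers_dvd A = {}"
    proof -
      have "\<not> Q ^ e dvd 1" if "Q \<in> monic_irr" "e \<ge> 1" for Q :: "'a poly" and e
        using that by (metis (no_types, lifting) monic_irr_def mem_Collect_eq irreducible_def is_unit_power_iff not_one_le_zero)
      thus ?thesis unfolding A prime_powers_dvd_def by auto
    qed
    thus ?thesis using True by simp
  next
    case False
    hence "degree A > 0" by simp
    then obtain Q0 where Q0: "irreducible Q0" "lead_coeff Q0 = 1" "Q0 dvd A"
      by (rule exists_monic_irreducible_factor)
    then obtain B where B: "A = Q0 * B" by (elim dvdE)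
    have A0: "A \<noteq> 0" using False by auto
    have Q0m: "Q0 \<in> monic_irr" using Q0 by (simp add: monic_irr_def)
    have lB: "lead_coeff B = 1" using less.prems Q0(2) unfolding B by (simp add: lead_coeff_mult)
    have nz: "Q0 \<noteq> 0" "B \<noteq> 0" using A0 B by auto
    have dA: "degree A = degree Q0 + degree B" unfolding B using nz by (rule degree_mult_eq)
    have dQ0: "degree Q0 > 0" using Q0m by (rule monic_irr_degree_pos)
    \<comment> \<open>Passing from B to \<open>Q0 * B\<close> raises each exponent of
      \<open>Q0\<close> by one; the pair \<open>(Q0, 1)\<close> is the only new one.\<close>
    define \<phi> where "\<phi> = (\<lambda>(Q :: 'a poly, e::nat). if Q = Q0 then (Q, Suc e) else (Q, e))"
    have inj: "inj_on \<phi> Y" for Y by (auto simp: inj_on_def \<phi>_def split: if_splits)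
    have eq: "prime_powers_dvd A = insert (Q0, 1) (\<phi> ` prime_powers_dvd B)"
    proof (intro equalityI subsetI)
      fix x assume "x \<in> prime_powers_dvd A"
      then obtain Q e where x: "x = (Q, e)" "Q \<in> monic_irr" "e \<ge> 1" "Q ^ e dvd A"
        by (auto simp: prime_powers_dvd_def)
      show "x \<in> insert (Q0, 1) (\<phi> ` prime_powers_dvd B)"
      proof (cases "Q = Q0")
        case True
        show ?thesis
        proof (cases "e = 1")
          case e1: False
          then obtain e' where e': "e = Suc e'" "e' \<ge> 1" using x(3) by (cases e) auto
          have "Q0 ^ e' dvd B" using x(4) nz unfolding True B e' by simp
          hence "(Q0, e') \<in> prime_powers_dvd B" using e' Q0m by (simp add: prime_powers_dvd_def)
          hence "\<phi> (Q0, e') \<in> \<phi> ` prime_powers_dvd B" by (rule imageI)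
          thus ?thesis by (simp add: \<phi>_def x True e')
        qed (simp add: x True)
      next
        case False
        hence "\<not> Q dvd Q0" using x(2) Q0m monic_irr_dvd_eq by blast
        hence "Q ^ e dvd B" using x irreducible_power_dvd_mult[of Q Q0 e B] by (simp add: monic_irr_def B)
        hence "(Q, e) \<in> prime_powers_dvd B" using x by (simp add: prime_powers_dvd_def)
        hence "\<phi> (Q, e) \<in> \<phi> ` prime_powers_dvd B" by (rule imageI)
        thus ?thesis using False by (simp add: \<phi>_def x)
      qed
    next
      fix x assume "x \<in> insert (Q0, 1) (\<phi> ` prime_powers_dvd B)"
      thus "x \<in> prime_powers_dvd A" using Q0 Q0m
        by (auto simp: prime_powers_dvd_def \<phi>_def B split: if_splits)
    qed
    have fB: "finite (prime_powers_dvd B)" and sB: "(\<Sum>(Q,e)\<in>prime_powers_dvd B. degree Q) = degree B"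
      using less.hyps[of B] lB dA dQ0 by auto
    have ni: "(Q0, 1) \<notin> \<phi> ` prime_powers_dvd B"
      by (auto simp: \<phi>_def prime_powers_dvd_def split: if_splits)
    have "(\<Sum>(Q,e)\<in>\<phi> ` prime_powers_dvd B. degree Q) = degree B"
      unfolding sum.reindex[OF inj] sB[symmetric] by (intro sum.cong) (auto simp: \<phi>_def)
    thus ?thesis using fB ni unfolding eq by (simp add: dA)
  qed
qed

definition coeff_sum :: "('a::{finite,field} poly \<Rightarrow> complex) \<Rightarrow> nat \<Rightarrow> complex" where
  "coeff_sum h k = (\<Sum>A\<in>monics k. h A)"

text \<open>The coefficient of u^j in u L'/L, where L is the generating series of
  \<open>coeff_sum h\<close>: a prime power Q^e of degree j contributes deg Q times h(Q)^e.\<close>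

definition mangoldt_sum :: "('a::{finite,field} poly \<Rightarrow> complex) \<Rightarrow> nat \<Rightarrow> complex" where
  "mangoldt_sum h j = (\<Sum>Q | Q \<in> monic_irr \<and> degree Q dvd j. of_nat (degree Q) * h Q ^ (j div degree Q))"

lemma finite_monic_irr_dvd: 
  assumes "j > 0" shows "finite {Q :: 'a::{finite,field} poly. Q \<in> monic_irr \<and> degree Q dvd j}"
proof (rule finite_subset)
  show "{Q :: 'a poly. Q \<in> monic_irr \<and> degree Q dvd j} \<subseteq> {Q. degree Q < Suc j}"
    using assms by (auto dest: dvd_imp_le)
  show "finite {Q::'a poly. degree Q < Suc j}" using card_polys_degree_less(2)[of "Suc j"] by simp
qed

locale mult_function =
  fixes h :: "'a::{finite,field} poly \<Rightarrow> complex"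
  assumes h_mult: "h (A * B) = h A * h B" and h_1: "h 1 = 1"
    and h_norm: "h A = 0 \<or> norm (h A) = 1"
begin

lemma h_power: "h (A ^ n) = h A ^ n"
  by (induction n) (auto simp: h_1 h_mult)

lemma coeff_sum_0: "coeff_sum h 0 = 1"
proof -
  have "monics 0 = {1 :: 'a poly}" 
    by (auto simp: monics_def one_pCons elim: degree_eq_zeroE)
  thus ?thesis by (simp add: coeff_sum_def h_1)
qed

text \<open>For monic A of degree k, the degrees of Q over all prime powers Q^e dividing A sum to k.
  Summing k h(A) over A and writing A = Q^e B with j = e deg Q gives the convolution, that is, u L'
  = (u L'/L) L coefficient by coefficient.\<close>

lemma coeff_sum_recursion:
  "of_nat k * coeff_sum h k = (\<Sum>j=1..k. mangoldt_sum h j * coeff_sum h (k - j))"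
proof -
  define D where "D = (\<lambda>j. {Q :: 'a poly. Q \<in> monic_irr \<and> degree Q dvd j})"
  have fD: "finite (D j)" if "j \<in> {1..k}" for j using that finite_monic_irr_dvd[of j] by (simp add: D_def)
  let ?T1 = "SIGMA j:{1..k}. D j \<times> monics (k - j)"
  let ?T2 = "SIGMA A:monics k. prime_powers_dvd A"
  have mon: "lead_coeff A = 1" if "A \<in> monics k" for k and A :: "'a poly" using that by (auto simp: monics_def)
  have nz: "Q \<noteq> 0" if "Q \<in> monic_irr" for Q :: "'a poly" using that by (auto simp: monic_irr_def)
  have "(\<Sum>j=1..k. mangoldt_sum h j * coeff_sum h (k - j)) 
     = (\<Sum>j=1..k. \<Sum>(Q,B)\<in>D j \<times> monics (k - j). of_nat (degree Q) * h Q ^ (j div degree Q) * h B)"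
    unfolding mangoldt_sum_def coeff_sum_def D_def by (simp add: sum_product sum.cartesian_product)
  also have "\<dots> = (\<Sum>(j,Q,B)\<in>?T1. of_nat (degree Q) * h Q ^ (j div degree Q) * h B)"
    by (subst sum.Sigma) (auto simp: fD)
  also have "\<dots> = (\<Sum>(A,Q,e)\<in>?T2. of_nat (degree Q) * h A)"
  proof (rule sum.reindex_bij_witness[of _ "\<lambda>(A,Q,e). (e * degree Q, Q, A div Q ^ e)" "\<lambda>(j,Q,B). (Q ^ (j div degree Q) * B, Q, j div degree Q)"], goal_cases)
    case (1 x)
    then obtain j Q B where x: "x = (j, Q, B)" "j \<ge> 1" "j \<le> k" "Q \<in> monic_irr" "degree Q dvd j" "B \<in> monics (k - j)"
      by (auto simp: D_def)
    thus ?case using nz[of Q] by simp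
  next
    case (2 x)
    then obtain j Q B where x: "x = (j, Q, B)" "j \<ge> 1" "j \<le> k" "Q \<in> monic_irr" "degree Q dvd j" "B \<in> monics (k - j)"
      by (auto simp: D_def)
    have B0: "B \<noteq> 0" using x(6) by (auto simp: monics_def)
    have "degree (Q ^ (j div degree Q) * B) = k"
      using x nz[of Q] B0 by (simp add: degree_mult_eq degree_power_eq monics_def)
    moreover have "lead_coeff (Q ^ (j div degree Q) * B) = 1"
      using x mon[OF x(6)] by (simp add: lead_coeff_mult lead_coeff_power monic_irr_def)
    moreover have "j div degree Q \<ge> 1" using x monic_irr_degree_pos[of Q]
      by (metis dvd_imp_le div_greater_zero_iff less_one linorder_not_less less_le_trans zero_less_one)
    ultimately show ?case using x by (auto simp: monics_def prime_powers_dvd_def)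
  next
    case (3 x)
    then obtain A Q e where x: "x = (A, Q, e)" "A \<in> monics k" "Q \<in> monic_irr" "e \<ge> 1" "Q ^ e dvd A"
      by (auto simp: prime_powers_dvd_def)
    have dQ: "degree Q > 0" using x by (intro monic_irr_degree_pos)
    thus ?case using x by simp
  next
    case (4 x)
    then obtain A Q e where x: "x = (A, Q, e)" "A \<in> monics k" "Q \<in> monic_irr" "e \<ge> 1" "Q ^ e dvd A"
      by (auto simp: prime_powers_dvd_def)
    have dQ: "degree Q > 0" using x by (intro monic_irr_degree_pos)
    obtain B where B: "A = Q ^ e * B" using x(5) by (elim dvdE)
    have A0: "A \<noteq> 0" using x(2) by (auto simp: monics_def)
    hence B0: "B \<noteq> 0" using B by auto
    have AB: "A div Q ^ e = B" using B nz[OF x(3)] by simp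
    have k: "k = e * degree Q + degree B"
      using x(2) B B0 nz[OF x(3)] by (auto simp: monics_def degree_mult_eq degree_power_eq)
    have "lead_coeff B = 1" using x(2,3) unfolding B by (simp add: monics_def monic_irr_def lead_coeff_mult lead_coeff_power)
    hence "B \<in> monics (k - e * degree Q)" using k by (simp add: monics_def)
    thus ?case using x dQ k by (auto simp: D_def AB)
  next
    case (5 x)
    then obtain j Q B where x: "x = (j, Q, B)" by (cases x) auto
    show ?case by (simp add: x h_mult h_power)
  qed
  also have "\<dots> = (\<Sum>A\<in>monics k. \<Sum>(Q,e)\<in>prime_powers_dvd A. of_nat (degree Q) * h A)"
    by (subst sum.Sigma) (auto simp: sum_degree_prime_powers_dvd mon)
  also have "\<dots> = (\<Sum>A\<in>monics k. of_nat k * h A)"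
  proof (intro sum.cong refl)
    fix A :: "'a poly" assume A: "A \<in> monics k"
    have "(\<Sum>(Q,e)\<in>prime_powers_dvd A. of_nat (degree Q) * h A)
        = of_nat (\<Sum>(Q,e)\<in>prime_powers_dvd A. degree Q) * h A"
      by (simp add: sum_distrib_right case_prod_unfold)
    also have "\<dots> = of_nat k * h A" using sum_degree_prime_powers_dvd[OF mon[OF A]] A by (simp add: monics_def)
    finally show "(\<Sum>(Q,e)\<in>prime_powers_dvd A. of_nat (degree Q) * h A) = of_nat k * h A" .
  qed
  also have "\<dots> = of_nat k * coeff_sum h k" by (simp add: coeff_sum_def sum_distrib_left)
  finally show ?thesis ..
qed

end

text \<open>For h = 1 the coefficient sums are q^k, and the recursion then determines the Mangoldt
  sums one after the other.\<close>

lemma sum_degree_monic_irr: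
  assumes "m > 0"
  shows "(\<Sum>Q :: 'a::{finite,field} poly | Q \<in> monic_irr \<and> degree Q dvd m. degree Q) = CARD('a) ^ m"
proof -
  interpret one: mult_function "\<lambda>_::'a poly. 1" by unfold_locales auto
  let ?S = "mangoldt_sum (\<lambda>_::'a poly. 1)" and ?q = "of_nat CARD('a) :: complex"
  have a: "coeff_sum (\<lambda>_::'a poly. 1) k = ?q ^ k" for k by (simp add: coeff_sum_def card_monics)
  have "m > 0 \<longrightarrow> ?S m = ?q ^ m" for m
  proof (induction m rule: less_induct)
    case (less m)
    show ?case
    proof
      assume m: "m > 0"
      have "of_nat m * ?q ^ m = (\<Sum>j=1..m. ?S j * ?q ^ (m - j))"
        using one.coeff_sum_recursion[of m] by (simp add: a)
      also have "\<dots> = (\<Sum>j\<in>{1..<m}. ?S j * ?q ^ (m - j)) + ?S m"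
      proof -
        have "{1..m} = insert m {1..<m}" using m by auto
        thus ?thesis by (simp add: add.commute)
      qed
      also have "(\<Sum>j\<in>{1..<m}. ?S j * ?q ^ (m - j)) = (\<Sum>j\<in>{1..<m}. ?q ^ m)"
        using less.IH by (intro sum.cong refl) (auto simp flip: power_add)
      finally show "?S m = ?q ^ m" using m by (simp add: of_nat_diff algebra_simps)
    qed
  qed
  with assms have "(of_nat (\<Sum>Q :: 'a poly | Q \<in> monic_irr \<and> degree Q dvd m. degree Q) :: complex) = of_nat (CARD('a) ^ m)"
    by (simp add: mangoldt_sum_def)
  thus ?thesis by (simp only: of_nat_eq_iff)
qed

section \<open>Inverse roots and mean values\<close>

text \<open>Newton's identities: each factor 1 - w X has a geometric series as logarithmic
  derivative, and the product rule adds them up.\<close>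

lemma fps_log_deriv_prod:
  fixes ws :: "complex list"
  shows "fps_X * fps_deriv (\<Prod>w\<leftarrow>ws. 1 - fps_const w * fps_X)
    = (\<Prod>w\<leftarrow>ws. 1 - fps_const w * fps_X) * Abs_fps (\<lambda>m. if m = 0 then 0 else - (\<Sum>w\<leftarrow>ws. w ^ m))"
proof (induction ws)
  case Nil
  have "Abs_fps (\<lambda>m. if m = 0 then 0 else - (\<Sum>w\<leftarrow>[]. w ^ m)) = (0 :: complex fps)"
    by (rule fps_ext) simp
  thus ?case by simp
next
  case (Cons w ws)
  let ?G = "1 - fps_const w * fps_X" and ?F = "\<Prod>w\<leftarrow>ws. 1 - fps_const w * fps_X"
  let ?T = "\<lambda>ws::complex list. Abs_fps (\<lambda>m. if m = 0 then 0 else - (\<Sum>w\<leftarrow>ws. w ^ m))"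
  have G: "fps_X * fps_deriv ?G = ?G * Abs_fps (\<lambda>m. if m = 0 then 0 else - (w ^ m))"
  proof (rule fps_ext)
    fix n
    show "(fps_X * fps_deriv ?G) $ n = (?G * Abs_fps (\<lambda>m. if m = 0 then 0 else - (w ^ m))) $ n"
    proof (cases n)
      case (Suc k)
      thus ?thesis by (cases k) (simp_all add: algebra_simps)
    qed (simp add: algebra_simps)
  qed
  have T: "?T (w # ws) = Abs_fps (\<lambda>m. if m = 0 then 0 else - (w ^ m)) + ?T ws"
    by (rule fps_ext) simp
  have deriv_mult: "fps_X * fps_deriv (G * F) = (fps_X * fps_deriv G) * F + G * (fps_X * fps_deriv F)" for F G :: "complex fps"
    by (simp add: algebra_simps)
  have "fps_X * fps_deriv (?G * ?F) = (fps_X * fps_deriv ?G) * ?F + ?G * (fps_X * fps_deriv ?F)"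
    using deriv_mult[of ?G ?F] .
  also have "\<dots> = ?G * ?F * ?T (w # ws)" unfolding G Cons.IH T by (simp add: algebra_simps)
  finally show ?case by simp
qed

lemma complex_poly_factor_at_0:
  fixes p :: "complex poly"
  assumes "coeff p 0 = 1"
  obtains ws where "p = (\<Prod>w\<leftarrow>ws. [:1, - w:])"
proof -
  obtain as where as: "smult (lead_coeff p) (\<Prod>a\<leftarrow>as. [:- a, 1:]) = p"
    using fundamental_theorem_algebra_factorized[of p] by auto
  have nz: "a \<noteq> 0" if "a \<in> set as" for a
  proof
    assume "a = 0"
    hence "poly (\<Prod>a\<leftarrow>as. [:- a, 1:]) 0 = 0" using that by (auto simp: poly_prod_list prod_list_zero_iff)
    hence "poly p 0 = 0" using as by (metis poly_smult mult_zero_right)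
    thus False using assms by (simp add: poly_0_coeff_0)
  qed
  have eq: "(\<Prod>a\<leftarrow>as. [:- a, 1:]) = smult (\<Prod>a\<leftarrow>as. - a) (\<Prod>a\<leftarrow>as. [:1, - inverse a:])"
    using nz
  proof (induction as)
    case (Cons a as)
    have "[:- a, 1:] = smult (- a) [:1, - inverse a:]" using Cons.prems by simp
    moreover have "(\<Prod>a\<leftarrow>as. [:- a, 1:]) = smult (\<Prod>a\<leftarrow>as. - a) (\<Prod>a\<leftarrow>as. [:1, - inverse a:])"
      using Cons by simp
    ultimately show ?case by (simp only: list.map prod_list.Cons mult_smult_left mult_smult_right smult_smult mult.commute)
  qed simp
  have "p = smult (lead_coeff p * (\<Prod>a\<leftarrow>as. - a)) (\<Prod>a\<leftarrow>as. [:1, - inverse a:])"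
    using as eq by simp
  moreover have "lead_coeff p * (\<Prod>a\<leftarrow>as. - a) = 1"
  proof -
    have "coeff (\<Prod>a\<leftarrow>as. [:1, - inverse a:]) 0 = 1" by (induction as) (simp_all add: coeff_mult)
    hence "coeff (smult (lead_coeff p * (\<Prod>a\<leftarrow>as. - a)) (\<Prod>a\<leftarrow>as. [:1, - inverse a:])) 0 = lead_coeff p * (\<Prod>a\<leftarrow>as. - a)"
      by simp
    thus ?thesis using assms calculation by metis
  qed
  ultimately have "p = (\<Prod>w\<leftarrow>map inverse as. [:1, - w:])" by (simp add: o_def)
  thus ?thesis by (rule that)
qed

lemma geometric_unbounded:
  fixes x y C :: real
  assumes "0 < y" "y < x" "\<And>k. k \<ge> N \<Longrightarrow> x ^ k \<le> C * y ^ k"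
  shows False
proof -
  have "1 < x / y" using assms by simp
  then obtain n where n: "C < (x / y) ^ n" using real_arch_pow by blast
  define k where "k = max n N"
  have "(x / y) ^ n \<le> (x / y) ^ k" using \<open>1 < x / y\<close> by (intro power_increasing) (auto simp: k_def)
  also have "\<dots> \<le> C" using assms(1) assms(3)[of k] by (simp add: k_def power_divide field_simps)
  finally show False using n by simp
qed

text \<open>The relation \<open>k a\<^sub>k = \<Sum> S\<^sub>j a\<^sub>k\<^sub>-\<^sub>j\<close> says that \<open>\<Sum> S\<^sub>j u\<^sup>j\<close> is the logarithmic derivative of the polynomial
  \<open>\<Sum> a\<^sub>k u\<^sup>k\<close>. The bound on the inverse roots holds because the coefficients of the inverse power
  series satisfy the same kind of recursion and hence are bounded by \<open>q\<^sup>k\<close>.\<close>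

lemma inverse_roots_exist:
  fixes a S :: "nat \<Rightarrow> complex" and q :: real
  assumes a0: "a 0 = 1" and avan: "\<And>k. k \<ge> d \<Longrightarrow> a k = 0"
    and rec: "\<And>k. of_nat k * a k = (\<Sum>j=1..k. S j * a (k - j))"
    and Sb: "\<And>j. j \<ge> 1 \<Longrightarrow> norm (S j) \<le> q ^ j" and q: "q \<ge> 1"
  obtains ws where "\<And>w. w \<in> set ws \<Longrightarrow> norm w \<le> q" "\<And>m. m \<ge> 1 \<Longrightarrow> S m = - (\<Sum>w\<leftarrow>ws. w ^ m)"
    "Abs_fps a = (\<Prod>w\<leftarrow>ws. 1 - fps_const w * fps_X)"
proof -
  define p where "p = Abs_poly a"
  have "\<forall>\<^sub>\<infinity>n. a n = 0" unfolding MOST_nat_le using avan by blast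
  hence cp: "coeff p = a" unfolding p_def by (rule Abs_poly_inverse[simplified])
  have "coeff p 0 = 1" by (simp add: cp a0)
  then obtain ws where ws: "p = (\<Prod>w\<leftarrow>ws. [:1, - w:])" by (rule complex_poly_factor_at_0)
  have fpl: "fps_of_poly (\<Prod>w\<leftarrow>vs. [:1, - w:]) = (\<Prod>w\<leftarrow>vs. 1 - fps_const w * fps_X)" for vs :: "complex list"
  proof (induction vs)
    case (Cons w vs)
    have "fps_of_poly [:1, - w:] = 1 - fps_const w * fps_X"
      by (rule fps_ext) (simp add: fps_of_poly_nth coeff_pCons split: nat.splits)
    thus ?case using Cons by (simp only: list.map prod_list.Cons fps_of_poly_mult)
  qed simp
  define F where "F = Abs_fps a"
  have F: "F = (\<Prod>w\<leftarrow>ws. 1 - fps_const w * fps_X)"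
  proof -
    have "F = fps_of_poly p" by (rule fps_ext) (simp add: F_def cp)
    thus ?thesis using ws fpl by simp
  qed
  have Fn: "F $ k = a k" for k by (simp add: F_def)
  have F0: "F \<noteq> 0" using a0 by (metis Fn fps_zero_nth zero_neq_one)
  define T where "T = Abs_fps (\<lambda>m. if m = 0 then 0 else S m)"
  have XF: "fps_X * fps_deriv F = F * T"
  proof (rule fps_ext)
    fix k
    have "(F * T) $ k = (T * F) $ k" by (simp add: mult.commute)
    also have "\<dots> = (\<Sum>j=0..k. T $ j * a (k - j))" by (simp add: fps_mult_nth Fn)
    also have "{0..k} = insert 0 {1..k}" by auto
    also have "(\<Sum>j\<in>insert 0 {1..k}. T $ j * a (k - j)) = (\<Sum>j=1..k. S j * a (k - j))"
      by (subst sum.insert) (auto simp: T_def)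
    also have "\<dots> = of_nat k * a k" by (simp add: rec)
    also have "\<dots> = (fps_X * fps_deriv F) $ k" by (cases k) (simp_all add: Fn)
    finally show "(fps_X * fps_deriv F) $ k = (F * T) $ k" ..
  qed
  also have XF': "fps_X * fps_deriv F = F * Abs_fps (\<lambda>m. if m = 0 then 0 else - (\<Sum>w\<leftarrow>ws. w ^ m))"
    unfolding F by (rule fps_log_deriv_prod)
  finally have Teq: "T = Abs_fps (\<lambda>m. if m = 0 then 0 else - (\<Sum>w\<leftarrow>ws. w ^ m))" using F0 by simp
  have Sm: "S m = - (\<Sum>w\<leftarrow>ws. w ^ m)" if "m \<ge> 1" for m
  proof -
    have "S m = T $ m" using that by (simp add: T_def)
    also have "\<dots> = - (\<Sum>w\<leftarrow>ws. w ^ m)" unfolding Teq using that by simp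
    finally show ?thesis .
  qed
  \<comment> \<open>The logarithmic derivative of the inverse series is \<open>- T\<close>, so its
    coefficients obey a recursion from which the bound q^k follows by induction.\<close>
  define c where "c = inverse F"
  have Fc: "F * c = 1" using a0 by (simp add: c_def inverse_mult_eq_1' Fn)
  have "fps_X * fps_deriv (F * c) = 0" using Fc by simp
  hence "(fps_X * fps_deriv F) * c + F * (fps_X * fps_deriv c) = 0" by (simp add: algebra_simps)
  hence "F * (T * c + fps_X * fps_deriv c) = 0" unfolding XF by (simp add: algebra_simps)
  hence Xc: "fps_X * fps_deriv c = - (T * c)" using F0 by (simp add: add_eq_0_iff)
  have c0: "c $ 0 = 1" using a0 by (simp add: c_def Fn)
  have cb: "norm (c $ k) \<le> q ^ k" for k
  proof (induction k rule: less_induct)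
    case (less k)
    show ?case
    proof (cases "k = 0")
      case False
      have "of_nat k * c $ k = (fps_X * fps_deriv c) $ k" using False by (cases k) simp_all
      also have "\<dots> = - (\<Sum>j=0..k. T $ j * c $ (k - j))" unfolding Xc by (simp add: fps_mult_nth)
      also have "{0..k} = insert 0 {1..k}" by auto
      also have "(\<Sum>j\<in>insert 0 {1..k}. T $ j * c $ (k - j)) = (\<Sum>j=1..k. S j * c $ (k - j))"
        by (subst sum.insert) (auto simp: T_def)
      finally have "real k * norm (c $ k) = norm (\<Sum>j=1..k. S j * c $ (k - j))"
        by (metis norm_minus_cancel norm_mult norm_of_nat)
      also have "\<dots> \<le> (\<Sum>j=1..k. q ^ j * q ^ (k - j))"
        by (intro sum_norm_le) (auto simp: norm_mult intro!: mult_mono Sb less.IH zero_le_power q order.trans[OF _ q])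
      also have "\<dots> = (\<Sum>j=1..k. q ^ k)" by (intro sum.cong) (auto simp flip: power_add)
      finally show ?thesis using False by simp
    qed (simp add: c0)
  qed
  have wb: "norm w \<le> q" if w: "w \<in> set ws" for w
  proof (rule ccontr)
    assume nw: "\<not> norm w \<le> q"
    obtain us vs where uv: "ws = us @ w # vs" using split_list[OF w] by blast
    \<comment> \<open>With the factor 1 - w X removed from F, the series r / F is the geometric
      series of w; hence w^k is bounded by a constant times q^k.\<close>
    define r where "r = (\<Prod>w\<leftarrow>us @ vs. [:1, - w:])"
    have "F = (1 - fps_const w * fps_X) * fps_of_poly r"
      unfolding F r_def fpl uv by (simp add: algebra_simps)
    hence one: "(1 - fps_const w * fps_X) * (fps_of_poly r * c) = 1" using Fc by (simp add: mult.assoc)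
    define H where "H = fps_of_poly r * c"
    have H: "H $ k = w ^ k" for k
    proof (induction k)
      case 0
      have "((1 - fps_const w * fps_X) * H) $ 0 = 1" using one by (simp add: H_def)
      thus ?case by (simp add: algebra_simps)
    next
      case (Suc k)
      have "((1 - fps_const w * fps_X) * H) $ (Suc k) = 0" using one by (simp add: H_def)
      thus ?case using Suc by (simp add: algebra_simps)
    qed
    define C where "C = (\<Sum>i\<le>degree r. norm (coeff r i))"
    have "norm w ^ k \<le> C * q ^ k" for k
    proof -
      have "norm w ^ k = norm (\<Sum>i=0..k. coeff r i * c $ (k - i))"
        using H[of k] by (simp add: H_def fps_mult_nth flip: norm_power)
      also have "\<dots> \<le> (\<Sum>i=0..k. norm (coeff r i) * q ^ k)"
      proof (intro sum_norm_le)
        fix i assume "i \<in> {0..k}"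
        have "norm (c $ (k - i)) \<le> q ^ k" using cb[of "k - i"] power_increasing[of "k - i" k q] q by simp
        thus "norm (coeff r i * c $ (k - i)) \<le> norm (coeff r i) * q ^ k"
          unfolding norm_mult by (intro mult_left_mono) auto
      qed
      also have "\<dots> = (\<Sum>i=0..k. norm (coeff r i)) * q ^ k" by (simp add: sum_distrib_right)
      also have "(\<Sum>i=0..k. norm (coeff r i)) \<le> C"
      proof -
        have "(\<Sum>i=0..k. norm (coeff r i)) = (\<Sum>i\<in>{0..k} \<inter> {..degree r}. norm (coeff r i))"
          by (rule sum.mono_neutral_right) (auto simp: coeff_eq_0)
        also have "\<dots> \<le> C" unfolding C_def by (rule sum_mono2) auto
        finally show ?thesis .
      qed
      finally show ?thesis using q by (simp add: mult_right_mono)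
    qed
    thus False using geometric_unbounded[of q "norm w" 0 C] nw q by auto
  qed
  show ?thesis by (rule that[OF wb Sm]) (use F F_def in auto)
qed

section \<open>Mean values of sequences\<close>

lemma geometric_sum_from_1: "(1 - z) * (\<Sum>m=1..N. z ^ m) = z - z ^ Suc N" for z :: "'b::comm_ring_1"
proof (induction N)
  case (Suc N)
  have "(1 - z) * (\<Sum>m=1..Suc N. z ^ m) = (1 - z) * (\<Sum>m=1..N. z ^ m) + (1 - z) * z ^ Suc N"
    by (simp add: distrib_left)
  also have "\<dots> = z - z ^ Suc (Suc N)" unfolding Suc by (simp add: algebra_simps)
  finally show ?case .
qed simp

definition cesaro_limit :: "(nat \<Rightarrow> complex) \<Rightarrow> complex \<Rightarrow> bool" where
  "cesaro_limit f l \<longleftrightarrow> (\<lambda>N. (\<Sum>m=1..N. f m) / of_nat N) \<longlonglongrightarrow> l"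

lemma cesaro_limit_power:
  fixes z :: complex
  assumes "norm z \<le> 1"
  shows "cesaro_limit (\<lambda>m. z ^ m) (if z = 1 then 1 else 0)"
proof (cases "z = 1")
  case True
  have "(\<lambda>N. (\<Sum>m=1..N. z ^ m) / of_nat N) \<longlonglongrightarrow> 1"
  proof (rule Lim_transform_eventually[OF tendsto_const])
    show "eventually (\<lambda>N. 1 = (\<Sum>m=1..N. z ^ m) / of_nat N) sequentially"
      using eventually_gt_at_top[of 0] by eventually_elim (simp add: True)
  qed
  thus ?thesis using True by (simp add: cesaro_limit_def)
next
  case False
  define C where "C = 2 / norm (1 - z)"
  have b: "norm (\<Sum>m=1..N. z ^ m) \<le> C" for N
  proof -
    have "norm (1 - z) * norm (\<Sum>m=1..N. z ^ m) = norm (z - z ^ Suc N)"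
      by (metis norm_mult geometric_sum_from_1)
    also have "\<dots> \<le> norm z + norm (z ^ Suc N)" by (rule norm_triangle_ineq4)
    also have "\<dots> \<le> 1 + 1" using assms by (intro add_mono) (simp_all add: norm_power norm_mult power_le_one mult_le_one)
    finally show ?thesis using False by (simp add: C_def field_simps)
  qed
  have "(\<lambda>N. (\<Sum>m=1..N. z ^ m) / of_nat N) \<longlonglongrightarrow> 0"
  proof (rule tendsto_0_le)
    show "(\<lambda>N. inverse (of_nat N :: real)) \<longlonglongrightarrow> 0" by (rule lim_inverse_n)
    show "eventually (\<lambda>N. norm ((\<Sum>m=1..N. z ^ m) / of_nat N) \<le> norm (inverse (of_nat N :: real)) * C) sequentially"
    proof (intro always_eventually allI)
      fix N
      have "norm (\<Sum>m=1..N. z ^ m) * inverse (real N) \<le> C * inverse (real N)"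
        by (intro mult_right_mono b) simp
      thus "norm ((\<Sum>m=1..N. z ^ m) / of_nat N) \<le> norm (inverse (of_nat N :: real)) * C"
        by (simp add: norm_divide divide_inverse[of _ "real N"] mult.commute[of _ C])
    qed
  qed
  thus ?thesis using False by (simp add: cesaro_limit_def)
qed

lemma cesaro_limit_add: "cesaro_limit f l \<Longrightarrow> cesaro_limit g k \<Longrightarrow> cesaro_limit (\<lambda>m. f m + g m) (l + k)"
  unfolding cesaro_limit_def by (drule (1) tendsto_add) (simp add: sum.distrib add_divide_distrib)

lemma cesaro_limit_cmult: "cesaro_limit f l \<Longrightarrow> cesaro_limit (\<lambda>m. c * f m) (c * l)"
  unfolding cesaro_limit_def by (drule tendsto_mult_left[of _ _ _ c]) (simp add: sum_distrib_left)

lemma cesaro_limit_cong: "cesaro_limit f l \<Longrightarrow> (\<And>m. m \<ge> 1 \<Longrightarrow> f m = g m) \<Longrightarrow> cesaro_limit g l"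
proof -
  assume l: "cesaro_limit f l" and eq: "\<And>m. m \<ge> 1 \<Longrightarrow> f m = g m"
  have "(\<Sum>m=1..N. f m) = (\<Sum>m=1..N. g m)" for N using eq by (intro sum.cong) auto
  thus ?thesis using l by (simp add: cesaro_limit_def)
qed

lemma cesaro_limit_Re_nonneg:
  assumes "cesaro_limit f l" "\<And>m. m \<ge> 1 \<Longrightarrow> Re (f m) \<ge> 0"
  shows "Re l \<ge> 0"
proof -
  have "(\<lambda>N. Re ((\<Sum>m=1..N. f m) / of_nat N)) \<longlonglongrightarrow> Re l"
    using assms(1) unfolding cesaro_limit_def by (rule tendsto_Re)
  thus ?thesis
    by (rule LIMSEQ_le_const) (auto intro!: exI[of _ 0] divide_nonneg_nonneg sum_nonneg assms(2))
qed

text \<open>After the twist by the conjugate of w, the powers of z have mean value 1 for z = w and 0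
  otherwise; the mean value thus reads off a multiplicity.\<close>

lemma cesaro_limit_power_sum:
  fixes zs :: "complex list"
  assumes "\<And>z. z \<in> set zs \<Longrightarrow> norm z \<le> 1" "norm w = 1"
  shows "cesaro_limit (\<lambda>m. cnj w ^ m * (\<Sum>z\<leftarrow>zs. z ^ m)) (of_nat (count_list zs w))"
  using assms(1)
proof (induction zs)
  case Nil
  show ?case by (simp add: cesaro_limit_def)
next
  case (Cons z zs)
  have ww: "cnj w * w = 1" using assms(2) by (metis complex_norm_square mult.commute of_real_1 power_one)
  have "(cnj w * z = 1) \<longleftrightarrow> z = w" using ww by (metis mult.left_commute mult.right_neutral)
  moreover have "norm (cnj w * z) \<le> 1" using Cons.prems assms(2) by (simp add: norm_mult)
  ultimately have "cesaro_limit (\<lambda>m. (cnj w * z) ^ m) (if z = w then 1 else 0)"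
    using cesaro_limit_power[of "cnj w * z"] by simp
  moreover have "cesaro_limit (\<lambda>m. cnj w ^ m * (\<Sum>z\<leftarrow>zs. z ^ m)) (of_nat (count_list zs w))"
    using Cons by simp
  ultimately have "cesaro_limit (\<lambda>m. (cnj w * z) ^ m + cnj w ^ m * (\<Sum>z\<leftarrow>zs. z ^ m)) ((if z = w then 1 else 0) + of_nat (count_list zs w))"
    by (rule cesaro_limit_add)
  hence "cesaro_limit (\<lambda>m. cnj w ^ m * (\<Sum>z\<leftarrow>z # zs. z ^ m)) ((if z = w then 1 else 0) + of_nat (count_list zs w))"
    by (rule cesaro_limit_cong) (simp add: algebra_simps power_mult_distrib)
  thus ?case by (simp add: add.commute split: if_splits)
qed

lemma three_four_one:
  fixes v :: complex
  assumes "norm v = 1" shows "3 + 4 * Re v + Re (v\<^sup>2) \<ge> 0"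
proof -
  have "(Re v)\<^sup>2 + (Im v)\<^sup>2 = 1" using assms by (simp add: cmod_def)
  hence "3 + 4 * Re v + Re (v\<^sup>2) = 2 * (1 + Re v)\<^sup>2" by (simp add: power2_eq_square algebra_simps)
  thus ?thesis by simp
qed

section \<open>Nonvanishing\<close>

context mult_function
begin

lemma mangoldt_sum_norm_le:
  assumes "j \<ge> 1" shows "norm (mangoldt_sum h j) \<le> real CARD('a) ^ j"
proof -
  have "norm (mangoldt_sum h j) \<le> (\<Sum>Q::'a poly | Q \<in> monic_irr \<and> degree Q dvd j. real (degree Q))"
    unfolding mangoldt_sum_def
  proof (intro sum_norm_le)
    fix Q :: "'a poly"
    have "norm (h Q) \<le> 1" using h_norm[of Q] by auto
    hence "norm (h Q ^ (j div degree Q)) \<le> 1" by (simp add: norm_power power_le_one)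
    thus "norm (of_nat (degree Q) * h Q ^ (j div degree Q)) \<le> real (degree Q)"
      by (simp add: norm_mult mult_left_le)
  qed
  also have "\<dots> = real CARD('a) ^ j"
    using sum_degree_monic_irr[where 'a='a, of j] assms by (simp flip: of_nat_sum of_nat_power)
  finally show ?thesis .
qed

end

text \<open>The L-series of h is then a polynomial of degree below d.\<close>

locale vanishing_function = mult_function +
  fixes d :: nat
  assumes vanish: "k \<ge> d \<Longrightarrow> coeff_sum h k = 0"
begin

text \<open>Division of the inverse roots by q moves the circle of radius q to the unit circle,
  where mean values of powers are available.\<close>

lemma normalized_roots_exist:
  obtains zs where "\<And>z. z \<in> set zs \<Longrightarrow> norm z \<le> 1"
    and "\<And>m. m \<ge> 1 \<Longrightarrow> mangoldt_sum h m / of_nat CARD('a) ^ m = - (\<Sum>z\<leftarrow>zs. z ^ m)"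
    and "Abs_fps (coeff_sum h) = (\<Prod>z\<leftarrow>zs. 1 - fps_const (of_nat CARD('a) * z) * fps_X)"
proof -
  let ?q = "of_nat CARD('a) :: complex"
  have q1: "real CARD('a) \<ge> 1" using card_field_ge_2[where 'a='a] by simp
  obtain ws where ws: "\<And>w. w \<in> set ws \<Longrightarrow> norm w \<le> real CARD('a)" 
    "\<And>m. m \<ge> 1 \<Longrightarrow> mangoldt_sum h m = - (\<Sum>w\<leftarrow>ws. w ^ m)"
    "Abs_fps (coeff_sum h) = (\<Prod>w\<leftarrow>ws. 1 - fps_const w * fps_X)"
    using inverse_roots_exist[OF coeff_sum_0 vanish coeff_sum_recursion mangoldt_sum_norm_le q1] by blast
  have q0: "?q \<noteq> 0" by simp
  show ?thesis
  proof (rule that[of "map (\<lambda>w. w / ?q) ws"])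
    fix z assume "z \<in> set (map (\<lambda>w. w / ?q) ws)"
    thus "norm z \<le> 1" using ws(1) by (auto simp: norm_divide)
  next
    fix m :: nat assume "m \<ge> 1"
    have "(\<Sum>w\<leftarrow>ws. w ^ m) / ?q ^ m = (\<Sum>w\<leftarrow>ws. w ^ m / ?q ^ m)"
      by (induction ws) (simp_all add: add_divide_distrib)
    thus "mangoldt_sum h m / ?q ^ m = - (\<Sum>z\<leftarrow>map (\<lambda>w. w / ?q) ws. z ^ m)"
      using ws(2)[OF \<open>m \<ge> 1\<close>] by (simp add: o_def power_divide)
  next
    show "Abs_fps (coeff_sum h) = (\<Prod>z\<leftarrow>map (\<lambda>w. w / ?q) ws. 1 - fps_const (?q * z) * fps_X)"
      using ws(3) by (simp add: o_def)
  qed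
qed

end

text \<open>If \<open>w q\<close> were an inverse root of the \<open>L\<close>-polynomial of a real function, the quotient by the
  corresponding linear factor would be a polynomial with nonnegative coefficients (up to \<open>w\<^sup>k\<close>) whose
  logarithmic derivative has eventually vanishing coefficients \<open>q\<^sup>k + w\<^sup>k S\<^sub>k\<close>; but these are
  positive for suitable even \<open>k\<close>.\<close>

lemma (in vanishing_function) real_no_root:
  assumes real: "\<And>A. h A = 0 \<or> h A = 1 \<or> h A = -1"
    and Q0: "Q0 \<in> monic_irr" "h Q0 \<noteq> 0"
    and fps: "Abs_fps (coeff_sum h) = (\<Prod>z\<leftarrow>zs. 1 - fps_const (of_nat CARD('a) * z) * fps_X)"
    and sums: "\<And>m. m \<ge> 1 \<Longrightarrow> mangoldt_sum h m / of_nat CARD('a) ^ m = - (\<Sum>z\<leftarrow>zs. z ^ m)"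
    and w: "w \<in> set zs" "w = 1 \<or> w = -1"
  shows False
proof -
  let ?q = "of_nat CARD('a) :: complex"
  define nn where "nn = (\<lambda>z::complex. Im z = 0 \<and> Re z \<ge> 0)"
  have nn_sum: "nn (\<Sum>i\<in>I. f i)" if "\<And>i. i \<in> I \<Longrightarrow> nn (f i)" for I and f :: "'b \<Rightarrow> complex"
    using that by (auto simp: nn_def intro!: sum_nonneg)
  have nn_mult: "nn (x * y)" if "nn x" "nn y" for x y using that by (auto simp: nn_def)
  obtain us vs where uv: "zs = us @ w # vs" using split_list[OF w(1)] by blast
  define vs' where "vs' = map (\<lambda>z. ?q * z) (us @ vs)"
  define E where "E = (\<Prod>v\<leftarrow>vs'. 1 - fps_const v * fps_X)"
  define r where "r = (\<Prod>v\<leftarrow>vs'. [:1, - v:])"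
  have Er: "E = fps_of_poly r"
    unfolding E_def r_def
  proof (induction vs')
    case (Cons v vs)
    have "fps_of_poly [:1, - v:] = 1 - fps_const v * fps_X"
      by (rule fps_ext) (simp add: fps_of_poly_nth coeff_pCons split: nat.splits)
    thus ?case using Cons by (simp only: list.map prod_list.Cons fps_of_poly_mult)
  qed simp
  \<comment> \<open>The coefficients of the logarithmic derivative of the cofactor E: omitting the
    inverse root w q adds (w q)^j to the Mangoldt sum.\<close>
  define \<sigma> where "\<sigma> = (\<lambda>j. mangoldt_sum h j + (w * ?q) ^ j)"
  have \<sigma>: "- (\<Sum>v\<leftarrow>vs'. v ^ j) = \<sigma> j" if "j \<ge> 1" for j
  proof -
    define U where "U = (\<Sum>z\<leftarrow>us @ vs. z ^ j)"
    have 1: "(\<Sum>v\<leftarrow>vs'. v ^ j) = ?q ^ j * U" unfolding vs'_def U_def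
      by (simp add: o_def power_mult_distrib sum_list_const_mult distrib_left)
    have 2: "(\<Sum>z\<leftarrow>zs. z ^ j) = U + w ^ j" by (simp add: uv U_def)
    have 3: "mangoldt_sum h j = - (\<Sum>z\<leftarrow>zs. z ^ j) * ?q ^ j"
      using sums[OF that] by (simp add: divide_eq_eq)
    show ?thesis unfolding \<sigma>_def 1 3 2 by (simp add: algebra_simps power_mult_distrib)
  qed
  have rec: "of_nat k * E $ k = (\<Sum>j=1..k. \<sigma> j * E $ (k - j))" for k
  proof -
    have "of_nat k * E $ k = (fps_X * fps_deriv E) $ k" by (cases k) simp_all
    also have "\<dots> = (Abs_fps (\<lambda>m. if m = 0 then 0 else - (\<Sum>w\<leftarrow>vs'. w ^ m)) * E) $ k"
      unfolding E_def fps_log_deriv_prod by (simp add: mult.commute)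
    also have "\<dots> = (\<Sum>j=0..k. (if j = 0 then 0 else - (\<Sum>w\<leftarrow>vs'. w ^ j)) * E $ (k - j))"
      by (simp add: fps_mult_nth)
    also have "{0..k} = insert 0 {1..k}" by auto
    also have "(\<Sum>j\<in>insert 0 {1..k}. (if j = 0 then 0 else - (\<Sum>w\<leftarrow>vs'. w ^ j)) * E $ (k - j)) = (\<Sum>j=1..k. \<sigma> j * E $ (k - j))"
      by (subst sum.insert) (auto intro!: sum.cong simp: \<sigma>)
    finally show ?thesis .
  qed
  have E0: "E $ 0 = 1" unfolding E_def by (induction vs') auto
  have ww: "w * w = 1" using w by auto
  have wj: "w ^ j * w ^ j = 1" for j using ww by (metis power_mult_distrib power_one)
  \<comment> \<open>Since q^j is the sum of deg Q over the same Q, every summand is deg Q times 1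
    plus a number among 0, 1, -1, hence nonnegative.\<close>
  have expand: "w ^ j * \<sigma> j = (\<Sum>Q | Q \<in> monic_irr \<and> degree Q dvd j. of_nat (degree Q) * (w ^ j * h Q ^ (j div degree Q) + 1))"
    if "j \<ge> 1" for j
  proof -
    have "w ^ j * \<sigma> j = w ^ j * mangoldt_sum h j + ?q ^ j"
      using wj[of j] by (simp add: \<sigma>_def distrib_left power_mult_distrib mult.assoc[symmetric])
    also have "?q ^ j = of_nat (\<Sum>Q :: 'a poly | Q \<in> monic_irr \<and> degree Q dvd j. degree Q)"
      using that by (simp add: sum_degree_monic_irr)
    finally show ?thesis by (simp add: mangoldt_sum_def sum_distrib_left sum.distrib algebra_simps)
  qed
  have v: "w ^ j * h Q ^ n = 0 \<or> w ^ j * h Q ^ n = 1 \<or> w ^ j * h Q ^ n = -1" for j n Q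
  proof -
    have "w ^ j = 1 \<or> w ^ j = -1" using w by (cases "even j") auto
    moreover have "h Q ^ n = 0 \<or> h Q ^ n = 1 \<or> h Q ^ n = -1"
      using real[of Q] by (cases "even n"; cases "n = 0") auto
    ultimately show ?thesis by auto
  qed
  have nn_term: "nn (of_nat (degree Q) * (w ^ j * h Q ^ n + 1))" for j n Q
  proof -
    have "nn (x + 1)" if "x = 0 \<or> x = 1 \<or> x = -1" for x using that by (auto simp: nn_def)
    from this[OF v[of j Q n]] show ?thesis by (rule nn_mult[rotated]) (simp add: nn_def)
  qed
  have nn\<sigma>: "nn (w ^ j * \<sigma> j)" if "j \<ge> 1" for j
    unfolding expand[OF that] by (intro nn_sum nn_term)
  have nnD: "nn (w ^ k * E $ k)" for k
  proof (induction k rule: less_induct)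
    case (less k)
    show ?case
    proof (cases "k = 0")
      case False
      have "of_nat k * (w ^ k * E $ k) = (\<Sum>j=1..k. (w ^ j * \<sigma> j) * (w ^ (k - j) * E $ (k - j)))"
      proof -
        have "of_nat k * (w ^ k * E $ k) = w ^ k * (of_nat k * E $ k)" by (simp add: algebra_simps)
        also have "\<dots> = (\<Sum>j=1..k. w ^ k * (\<sigma> j * E $ (k - j)))" unfolding rec by (simp add: sum_distrib_left)
        also have "\<dots> = (\<Sum>j=1..k. (w ^ j * \<sigma> j) * (w ^ (k - j) * E $ (k - j)))"
        proof (intro sum.cong refl)
          fix j assume "j \<in> {1..k}"
          hence "w ^ k = w ^ j * w ^ (k - j)" by (simp flip: power_add)
          thus "w ^ k * (\<sigma> j * E $ (k - j)) = (w ^ j * \<sigma> j) * (w ^ (k - j) * E $ (k - j))" by (simp add: mult_ac)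
        qed
        finally show ?thesis .
      qed
      also have "nn \<dots>" by (intro nn_sum nn_mult nn\<sigma> less.IH) auto
      finally have "nn (of_nat k * (w ^ k * E $ k))" .
      thus ?thesis using False by (simp add: nn_def zero_le_mult_iff)
    qed (simp add: E0 nn_def)
  qed
  \<comment> \<open>A multiple of 2 deg Q0, so that both w^k and h(Q0)^(k / deg Q0) equal 1, and
    larger than the degree of E, so that the k-th coefficient of E vanishes.\<close>
  define k where "k = 2 * degree Q0 * Suc (degree r)"
  have dQ0: "degree Q0 > 0" using Q0(1) by (rule monic_irr_degree_pos)
  have k1: "k \<ge> 1" and kr: "k > degree r"
  proof -
    show "k \<ge> 1" using dQ0 by (simp add: k_def)
    have "degree r < Suc (degree r)" by simp
    also have "\<dots> \<le> 2 * degree Q0 * Suc (degree r)" using dQ0 by (metis One_nat_def Suc_leI mult_le_mono1 nat_0_less_mult_iff nat_mult_1 zero_less_numeral)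
    finally show "k > degree r" by (simp add: k_def)
  qed
  have "E $ k = 0" using kr by (simp add: Er coeff_eq_0)
  hence "0 = (\<Sum>j=1..k. \<sigma> j * E $ (k - j))" using rec[of k] by simp
  hence "0 = w ^ k * (\<Sum>j=1..k. \<sigma> j * E $ (k - j))" by simp
  also have "\<dots> = (\<Sum>j=1..k. (w ^ j * \<sigma> j) * (w ^ (k - j) * E $ (k - j)))"
    unfolding sum_distrib_left
  proof (intro sum.cong refl)
    fix j assume "j \<in> {1..k}"
    hence "w ^ k = w ^ j * w ^ (k - j)" by (simp flip: power_add)
    thus "w ^ k * (\<sigma> j * E $ (k - j)) = (w ^ j * \<sigma> j) * (w ^ (k - j) * E $ (k - j))" by (simp add: mult_ac)
  qed
  also have "\<dots> = w ^ k * \<sigma> k + (\<Sum>j\<in>{1..k} - {k}. (w ^ j * \<sigma> j) * (w ^ (k - j) * E $ (k - j)))"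
    by (subst sum.remove[of _ k]) (use k1 E0 in auto)
  \<comment> \<open>A sum of nonnegative terms that vanishes; the contradiction lies in the term j =
    k, where Q0 alone contributes 2 deg Q0.\<close>
  finally have eq0: "0 = w ^ k * \<sigma> k + (\<Sum>j\<in>{1..k} - {k}. (w ^ j * \<sigma> j) * (w ^ (k - j) * E $ (k - j)))" .
  have "nn (\<Sum>j\<in>{1..k} - {k}. (w ^ j * \<sigma> j) * (w ^ (k - j) * E $ (k - j)))"
    by (intro nn_sum nn_mult nn\<sigma> nnD) auto
  hence "Re (w ^ k * \<sigma> k) \<le> 0" using arg_cong[OF eq0, of Re] by (simp add: nn_def)
  moreover have "Re (w ^ k * \<sigma> k) > 0"
  proof -
    let ?I = "{Q :: 'a poly. Q \<in> monic_irr \<and> degree Q dvd k}"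
    let ?t = "\<lambda>Q. of_nat (degree Q) * (w ^ k * h Q ^ (k div degree Q) + 1)"
    have fin: "finite ?I" using k1 by (intro finite_monic_irr_dvd) auto
    have Q0I: "Q0 \<in> ?I" using Q0 by (simp add: k_def)
    have "k div degree Q0 = 2 * Suc (degree r)" using dQ0 by (simp add: k_def)
    moreover have "w ^ k = 1" unfolding k_def by (simp only: power_mult power2_eq_square ww power_one)
    moreover have "h Q0 ^ (2 * Suc (degree r)) = 1" using real[of Q0] Q0(2) by (auto simp: power_mult)
    ultimately have t0: "Re (?t Q0) = 2 * degree Q0" by simp
    have "w ^ k * \<sigma> k = ?t Q0 + (\<Sum>Q\<in>?I - {Q0}. ?t Q)" unfolding expand[OF k1]
      by (rule sum.remove[OF fin Q0I])
    moreover have "nn (\<Sum>Q\<in>?I - {Q0}. ?t Q)" by (intro nn_sum nn_term)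
    ultimately have "Re (w ^ k * \<sigma> k) \<ge> Re (?t Q0)" by (simp add: nn_def)
    thus ?thesis using t0 dQ0 by simp
  qed
  ultimately show False by simp
qed

text \<open>The weights deg Q add up to q^m, so this is a weighted average of the pointwise
  inequality. The third term stays free because it is the square of the second one for general h but
  a constant for real h.\<close>

lemma (in mult_function) three_four_one_sum:
  fixes g :: "'a poly \<Rightarrow> complex"
  assumes m: "m \<ge> 1"
    and g: "\<And>Q. Q \<in> monic_irr \<Longrightarrow> degree Q dvd m \<Longrightarrow> Re (3 + 4 * (c * h Q ^ (m div degree Q)) + g Q) \<ge> 0"
  shows "Re (3 + 4 * (c * (mangoldt_sum h m / of_nat CARD('a) ^ m))
     + (\<Sum>Q | Q \<in> monic_irr \<and> degree Q dvd m. of_nat (degree Q) * g Q) / of_nat CARD('a) ^ m) \<ge> 0"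
proof -
  let ?I = "{Q :: 'a poly. Q \<in> monic_irr \<and> degree Q dvd m}" and ?q = "of_nat CARD('a) :: complex"
  have qm: "?q ^ m = of_nat (\<Sum>Q\<in>?I. degree Q)" using m by (simp add: sum_degree_monic_irr)
  have "(\<Sum>Q\<in>?I. of_nat (degree Q) * (3 + 4 * (c * h Q ^ (m div degree Q)) + g Q))
     = 3 * ?q ^ m + 4 * (c * mangoldt_sum h m) + (\<Sum>Q\<in>?I. of_nat (degree Q) * g Q)"
    unfolding qm mangoldt_sum_def
    by (simp add: sum_distrib_left sum.distrib distrib_left mult_ac)
  hence "3 + 4 * (c * (mangoldt_sum h m / ?q ^ m)) + (\<Sum>Q\<in>?I. of_nat (degree Q) * g Q) / ?q ^ m
    = (\<Sum>Q\<in>?I. of_nat (degree Q) * (3 + 4 * (c * h Q ^ (m div degree Q)) + g Q)) / of_real (real CARD('a) ^ m)"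
    by (simp add: add_divide_distrib)
  moreover have "Re (of_nat (degree Q) * (3 + 4 * (c * h Q ^ (m div degree Q)) + g Q)) \<ge> 0" if "Q \<in> ?I" for Q
  proof -
    have "Re (of_nat (degree Q) * (3 + 4 * (c * h Q ^ (m div degree Q)) + g Q)) = real (degree Q) * Re (3 + 4 * (c * h Q ^ (m div degree Q)) + g Q)"
      by simp
    thus ?thesis using g[of Q] that by (simp only: mem_Collect_eq) (intro mult_nonneg_nonneg; simp)
  qed
  ultimately show ?thesis by (simp only: Re_divide_of_real Re_sum) (intro divide_nonneg_nonneg sum_nonneg, auto)
qed

text \<open>It suffices that no normalized root has modulus 1. For such a root w, averaging 3 + 4 Re
  v + Re v^2 with v = conj(w)^m h(Q)^(m / deg Q) yields 3 - 4a - b >= 0, where a >= 1 is the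
  multiplicity of w and b that of w^2 for h^2. The second alternative is for real h, whose square
  takes only the values 0 and 1 and need not have a polynomial as L-series.\<close>

theorem (in vanishing_function) mangoldt_sum_tendsto_0:
  assumes "(\<exists>d'. vanishing_function (\<lambda>A. h A ^ 2) d') \<or>
     ((\<forall>A. h A = 0 \<or> h A = 1 \<or> h A = -1) \<and> (\<exists>Q\<in>monic_irr. h Q \<noteq> 0))"
  shows "(\<lambda>m. mangoldt_sum h m / of_nat CARD('a) ^ m) \<longlonglongrightarrow> 0"
proof -
  let ?q = "of_nat CARD('a) :: complex"
  obtain zs where zs: "\<And>z. z \<in> set zs \<Longrightarrow> norm z \<le> 1"
    and sums: "\<And>m. m \<ge> 1 \<Longrightarrow> mangoldt_sum h m / ?q ^ m = - (\<Sum>z\<leftarrow>zs. z ^ m)"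
    and fps: "Abs_fps (coeff_sum h) = (\<Prod>z\<leftarrow>zs. 1 - fps_const (?q * z) * fps_X)"
    using normalized_roots_exist by blast
  have lt: "norm w < 1" if w: "w \<in> set zs" for w
  proof (rule ccontr)
    assume "\<not> norm w < 1"
    with zs[OF w] have nw: "norm w = 1" by simp
    have n1: "count_list zs w \<ge> 1" using w by (metis One_nat_def Suc_leI count_list_0_iff gr0I)
    have lim0: "cesaro_limit (\<lambda>m. 3) 3"
      using cesaro_limit_cmult[OF cesaro_limit_power[of 1], of 3] by simp
    have lim1: "cesaro_limit (\<lambda>m. 4 * (cnj w ^ m * (mangoldt_sum h m / ?q ^ m))) (- 4 * of_nat (count_list zs w))"
    proof (rule cesaro_limit_cong)
      show "cesaro_limit (\<lambda>m. (-4) * (cnj w ^ m * (\<Sum>z\<leftarrow>zs. z ^ m))) (- 4 * of_nat (count_list zs w))"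
        by (intro cesaro_limit_cmult cesaro_limit_power_sum zs nw)
    qed (simp add: sums)
    from assms show False
    proof
      assume "\<exists>d'. vanishing_function (\<lambda>A. h A ^ 2) d'"
      then obtain d' where "vanishing_function (\<lambda>A. h A ^ 2) d'" by blast
      then interpret h2: vanishing_function "\<lambda>A. h A ^ 2" d' .
      obtain zs2 where zs2: "\<And>z. z \<in> set zs2 \<Longrightarrow> norm z \<le> 1"
        and sums2: "\<And>m. m \<ge> 1 \<Longrightarrow> mangoldt_sum (\<lambda>A. h A ^ 2) m / ?q ^ m = - (\<Sum>z\<leftarrow>zs2. z ^ m)"
        and "Abs_fps (coeff_sum (\<lambda>A. h A ^ 2)) = (\<Prod>z\<leftarrow>zs2. 1 - fps_const (?q * z) * fps_X)"
        using h2.normalized_roots_exist by blast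
      have lim2: "cesaro_limit (\<lambda>m. (cnj w ^ 2) ^ m * (mangoldt_sum (\<lambda>A. h A ^ 2) m / ?q ^ m)) (- 1 * of_nat (count_list zs2 (w ^ 2)))"
      proof (rule cesaro_limit_cong)
        show "cesaro_limit (\<lambda>m. (-1) * (cnj (w ^ 2) ^ m * (\<Sum>z\<leftarrow>zs2. z ^ m))) (- 1 * of_nat (count_list zs2 (w ^ 2)))"
          by (intro cesaro_limit_cmult cesaro_limit_power_sum zs2) (simp_all add: nw norm_power)
      qed (simp add: sums2)
      have "0 \<le> Re (3 + - 4 * of_nat (count_list zs w) + - 1 * of_nat (count_list zs2 (w ^ 2)))"
      proof (rule cesaro_limit_Re_nonneg[OF cesaro_limit_add[OF cesaro_limit_add[OF lim0 lim1] lim2]])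
        fix m :: nat assume m: "m \<ge> 1"
        have "Re (3 + 4 * (cnj w ^ m * (mangoldt_sum h m / ?q ^ m))
          + (\<Sum>Q | Q \<in> monic_irr \<and> degree Q dvd m. of_nat (degree Q) * (cnj w ^ m * h Q ^ (m div degree Q))\<^sup>2) / ?q ^ m) \<ge> 0"
        proof (rule three_four_one_sum[OF m])
          fix Q :: "'a poly" assume Q: "Q \<in> monic_irr" "degree Q dvd m"
          have e: "m div degree Q > 0" using Q m monic_irr_degree_pos[of Q] by (metis dvd_div_eq_0_iff gr0I not_one_le_zero)
          show "0 \<le> Re (3 + 4 * (cnj w ^ m * h Q ^ (m div degree Q)) + (cnj w ^ m * h Q ^ (m div degree Q))\<^sup>2)"
          proof (cases "h Q = 0")
            case False
            hence "norm (cnj w ^ m * h Q ^ (m div degree Q)) = 1" using h_norm[of Q] nw by (simp add: norm_mult norm_power)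
            from three_four_one[OF this] show ?thesis by simp
          qed (use e in \<open>simp add: zero_power\<close>)
        qed
        also have "(\<Sum>Q | Q \<in> monic_irr \<and> degree Q dvd m. of_nat (degree Q) * (cnj w ^ m * h Q ^ (m div degree Q))\<^sup>2)
           = (cnj w ^ 2) ^ m * mangoldt_sum (\<lambda>A. h A ^ 2) m"
          unfolding mangoldt_sum_def sum_distrib_left
          by (intro sum.cong refl) (simp add: power_mult_distrib mult_ac flip: power_mult)
        finally show "0 \<le> Re (3 + 4 * (cnj w ^ m * (mangoldt_sum h m / ?q ^ m)) + (cnj w ^ 2) ^ m * (mangoldt_sum (\<lambda>A. h A ^ 2) m / ?q ^ m))"
          by simp
      qed
      thus False using n1 by simp
    next
      assume real: "(\<forall>A. h A = 0 \<or> h A = 1 \<or> h A = -1) \<and> (\<exists>Q\<in>monic_irr. h Q \<noteq> 0)"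
      \<comment> \<open>For real h the square of h(Q)^e is replaced by 1 at every Q, also where h
        vanishes; the weights then total q^m and only the twist remains.\<close>
      have lim2: "cesaro_limit (\<lambda>m. (cnj w ^ 2) ^ m) (if cnj w ^ 2 = 1 then 1 else 0)"
        by (rule cesaro_limit_power) (simp add: norm_power nw)
      have "0 \<le> Re (3 + - 4 * of_nat (count_list zs w) + (if cnj w ^ 2 = 1 then 1 else 0))"
      proof (rule cesaro_limit_Re_nonneg[OF cesaro_limit_add[OF cesaro_limit_add[OF lim0 lim1] lim2]])
        fix m :: nat assume m: "m \<ge> 1"
        have "Re (3 + 4 * (cnj w ^ m * (mangoldt_sum h m / ?q ^ m))
          + (\<Sum>Q::'a poly | Q \<in> monic_irr \<and> degree Q dvd m. of_nat (degree Q) * (cnj w ^ 2) ^ m) / ?q ^ m) \<ge> 0"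
        proof (rule three_four_one_sum[OF m])
          fix Q :: "'a poly" assume Q: "Q \<in> monic_irr" "degree Q dvd m"
          have e: "m div degree Q > 0" using Q m monic_irr_degree_pos[of Q] by (metis dvd_div_eq_0_iff gr0I not_one_le_zero)
          show "0 \<le> Re (3 + 4 * (cnj w ^ m * h Q ^ (m div degree Q)) + (cnj w ^ 2) ^ m)"
          proof (cases "h Q = 0")
            case False
            let ?v = "cnj w ^ m * h Q ^ (m div degree Q)"
            have "norm ?v = 1" using False h_norm[of Q] nw by (simp add: norm_mult norm_power)
            moreover have "?v\<^sup>2 = (cnj w ^ 2) ^ m"
            proof -
              have "h Q ^ 2 = 1" using real False by (metis power2_minus power_one)
              hence "(h Q ^ (m div degree Q))\<^sup>2 = 1" by (metis power_mult mult.commute power_one)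
              thus ?thesis by (simp add: power_mult_distrib) (metis power_mult mult.commute)
            qed
            ultimately show ?thesis using three_four_one[of ?v] by simp
          next
            case True
            have "norm ((cnj w ^ 2) ^ m) = 1" by (simp add: norm_power nw)
            hence "\<bar>Re ((cnj w ^ 2) ^ m)\<bar> \<le> 1" by (metis abs_Re_le_cmod)
            thus ?thesis using True e by (simp add: zero_power)
          qed
        qed
        also have "(\<Sum>Q::'a poly | Q \<in> monic_irr \<and> degree Q dvd m. of_nat (degree Q) * (cnj w ^ 2) ^ m) = (cnj w ^ 2) ^ m * ?q ^ m"
          using sum_degree_monic_irr[where 'a='a, of m] m by (simp add: mult.commute flip: sum_distrib_right of_nat_sum of_nat_power)
        finally show "0 \<le> Re (3 + 4 * (cnj w ^ m * (mangoldt_sum h m / ?q ^ m)) + (cnj w ^ 2) ^ m)"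
          by simp
      qed
      \<comment> \<open>Here 3 - 4 + 1 = 0 is no contradiction, so w = 1 and w = -1 survive and are
        left to \<open>real_no_root\<close>.\<close>
      hence "cnj w ^ 2 = 1" using n1 by (auto split: if_splits)
      hence "w ^ 2 = 1" by (metis complex_cnj_cnj complex_cnj_one complex_cnj_power)
      hence "w = 1 \<or> w = -1" by (simp add: power2_eq_1_iff)
      thus False using real real_no_root[OF _ _ _ fps sums w] by metis
    qed
  qed
  have "(\<lambda>m. - (\<Sum>z\<leftarrow>zs. z ^ m)) \<longlonglongrightarrow> 0"
  proof -
    have "(\<lambda>m. (\<Sum>z\<leftarrow>zs. z ^ m)) \<longlonglongrightarrow> 0" using lt
    proof (induction zs)
      case (Cons z zs)
      have "(\<lambda>m. z ^ m + (\<Sum>z\<leftarrow>zs. z ^ m)) \<longlonglongrightarrow> 0 + 0"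
        using Cons by (intro tendsto_add LIMSEQ_power_zero) auto
      thus ?case by simp
    qed simp
    from tendsto_minus[OF this] show ?thesis by simp
  qed
  moreover have "\<forall>\<^sub>F m in sequentially. - (\<Sum>z\<leftarrow>zs. z ^ m) = mangoldt_sum h m / ?q ^ m"
    using eventually_ge_at_top[of 1] by eventually_elim (simp add: sums)
  ultimately show ?thesis by (rule Lim_transform_eventually)
qed

section \<open>Characters and reciprocity\<close>

lemma finite_field_generator:
  obtains \<gamma> :: "'a::{finite,field}" where "\<gamma> \<noteq> 0" "\<And>x. x \<noteq> 0 \<Longrightarrow> \<exists>i::nat. x = \<gamma> ^ i"
proof -
  let ?R = "ring_of_type_algebra :: 'a ring"
  interpret R: Ring.field ?R by (rule field_from_type_algebra)
  have c: "carrier ?R = UNIV" "\<zero>\<^bsub>?R\<^esub> = 0" "\<one>\<^bsub>?R\<^esub> = 1" "monoid.mult ?R = (*)"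
    by (simp_all add: ring_of_type_algebra_def)
  have pow: "a [^]\<^bsub>?R\<^esub> (n::nat) = a ^ n" for a n
    by (induction n) (simp_all add: c mult.commute)
  obtain a where a: "a \<in> carrier (Multiplicative_Group.mult_of ?R)"
    "carrier (Multiplicative_Group.mult_of ?R) = {a [^]\<^bsub>?R\<^esub> (i::nat) |i. i \<in> UNIV}"
    using R.finite_field_mult_group_has_gen by (auto simp: c)
  show ?thesis
  proof (rule that[of a])
    show "a \<noteq> 0" using a(1) by (simp add: c)
    fix x :: 'a assume "x \<noteq> 0"
    hence "x \<in> carrier (Multiplicative_Group.mult_of ?R)" by (simp add: c)
    thus "\<exists>i::nat. x = a ^ i" unfolding a(2) by (auto simp: pow)
  qed
qed

lemma power_mod_period: 
  fixes y :: "'b::monoid_mult"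
  assumes "y ^ n = 1" shows "y ^ (i mod n) = y ^ i"
proof -
  have "y ^ i = y ^ (n * (i div n) + i mod n)" by simp
  also have "\<dots> = y ^ (i mod n)" using assms by (simp only: power_add power_mult power_one mult_1)
  finally show ?thesis ..
qed

lemma generator_power_eq_1_iff:
  fixes \<gamma> :: "'a::{finite,field}"
  assumes "\<gamma> \<noteq> 0" "\<And>x. x \<noteq> 0 \<Longrightarrow> \<exists>i::nat. x = \<gamma> ^ i"
  shows "\<gamma> ^ i = 1 \<longleftrightarrow> (CARD('a) - 1) dvd i"
proof
  let ?n = "CARD('a) - 1"
  have n0: "?n > 0" using card_field_ge_2[where 'a='a] by simp
  have g1: "\<gamma> ^ ?n = 1" by (rule field_power_card_minus_1[OF assms(1)])
  { assume "?n dvd i" thus "\<gamma> ^ i = 1" using g1 by (auto simp: power_mult elim!: dvdE) }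
  assume i: "\<gamma> ^ i = 1"
  define r where "r = i mod ?n"
  have r1: "\<gamma> ^ r = 1" unfolding r_def using power_mod_period[OF g1] i by simp
  have rn: "r < ?n" using n0 by (simp add: r_def)
  show "?n dvd i"
  proof (rule ccontr)
    assume "\<not> ?n dvd i"
    hence r0: "r > 0" by (simp add: r_def mod_greater_zero_iff_not_dvd)
    have "UNIV - {0} \<subseteq> (\<lambda>i. \<gamma> ^ i) ` {..<r}"
    proof
      fix x :: 'a assume "x \<in> UNIV - {0}"
      then obtain j :: nat where j: "x = \<gamma> ^ j" using assms(2) by auto
      have "\<gamma> ^ j = \<gamma> ^ (j mod r)" by (rule power_mod_period[OF r1, symmetric])
      thus "x \<in> (\<lambda>i. \<gamma> ^ i) ` {..<r}" using r0 j by auto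
    qed
    hence "card (UNIV - {0::'a}) \<le> card ((\<lambda>i. \<gamma> ^ i) ` {..<r})" by (intro card_mono) auto
    also have "\<dots> \<le> r" using card_image_le[of "{..<r}" "\<lambda>i. \<gamma> ^ i"] by simp
    finally show False using rn by (simp add: card_Diff_singleton)
  qed
qed

text \<open>The i-th power of a generator is sent to the i-th power of a primitive (q-1)-th root of
  unity. Both have order q - 1, so the choice of the exponent \<open>dl\<close> does not
  matter.\<close>

lemma faithful_character_exists:
  obtains \<chi> :: "'a::{finite,field} \<Rightarrow> complex" where
    "\<And>x y. \<chi> (x * y) = \<chi> x * \<chi> y" "\<chi> 1 = 1" "\<chi> 0 = 0" "\<And>x. x \<noteq> 0 \<Longrightarrow> norm (\<chi> x) = 1"
    "\<And>x. \<chi> x = 1 \<Longrightarrow> x = 1"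
proof -
  obtain \<gamma> :: 'a where \<gamma>: "\<gamma> \<noteq> 0" "\<And>x. x \<noteq> 0 \<Longrightarrow> \<exists>i::nat. x = \<gamma> ^ i"
    by (rule finite_field_generator) blast
  define n where "n = CARD('a) - 1"
  have n0: "n > 0" using card_field_ge_2[where 'a='a] by (simp add: n_def)
  define \<zeta> where "\<zeta> = cis (2 * pi / real n)"
  have \<zeta>n: "\<zeta> ^ n = 1" unfolding \<zeta>_def using n0 by (simp add: Complex.DeMoivre cis_2pi)
  have \<zeta>1: "n dvd i" if "\<zeta> ^ i = 1" for i
  proof -
    define r where "r = i mod n"
    have "\<zeta> ^ r = 1" unfolding r_def using power_mod_period[OF \<zeta>n] that by simp
    hence "cis (real r * (2 * pi / real n)) = 1" by (simp add: \<zeta>_def Complex.DeMoivre)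
    hence "cos (real r * (2 * pi / real n)) = 1" by (metis cis.simps(1) one_complex.simps(1))
    then obtain k :: int where "real r * (2 * pi / real n) = of_int k * 2 * pi"
      using cos_one_2pi_int by blast
    hence "real r = of_int k * real n" using n0 by (simp add: field_simps)
    hence rk: "int r = k * int n" by (metis of_int_eq_iff of_int_mult of_int_of_nat_eq)
    have "r < n" using n0 by (simp add: r_def)
    hence "int r div int n = 0" by simp
    hence "r = 0" using rk n0 by simp
    thus ?thesis by (simp add: r_def mod_eq_0_iff_dvd)
  qed
  have key: "\<gamma> ^ i = \<gamma> ^ j \<longleftrightarrow> \<zeta> ^ i = \<zeta> ^ j" for i j
  proof -
    have *: "\<gamma> ^ i = \<gamma> ^ j \<longleftrightarrow> \<zeta> ^ i = \<zeta> ^ j" if "i \<le> j" for i j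
    proof -
      have "\<gamma> ^ i = \<gamma> ^ j \<longleftrightarrow> \<gamma> ^ (j - i) = 1" using that \<gamma>(1) by (auto simp: power_diff)
      also have "\<dots> \<longleftrightarrow> n dvd j - i" unfolding n_def by (rule generator_power_eq_1_iff[OF \<gamma>])
      also have "\<dots> \<longleftrightarrow> \<zeta> ^ (j - i) = 1" using \<zeta>1 \<zeta>n by (auto simp: power_mult elim!: dvdE)
      also have "\<dots> \<longleftrightarrow> \<zeta> ^ i = \<zeta> ^ j" using that by (auto simp: power_diff \<zeta>_def)
      finally show ?thesis .
    qed
    show ?thesis using *[of i j] *[of j i] by (cases "i \<le> j") auto
  qed
  define dl where "dl = (\<lambda>x. SOME i::nat. x = \<gamma> ^ i)"
  have dl: "x = \<gamma> ^ dl x" if "x \<noteq> 0" for x unfolding dl_def using \<gamma>(2)[OF that] by (rule someI_ex)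
  define \<chi> where "\<chi> = (\<lambda>x. if x = 0 then 0 else \<zeta> ^ dl x)"
  show ?thesis
  proof (rule that[of \<chi>])
    show "\<chi> (x * y) = \<chi> x * \<chi> y" for x y
    proof (cases "x = 0 \<or> y = 0")
      case False
      have "\<gamma> ^ dl (x * y) = \<gamma> ^ (dl x + dl y)" using dl[of "x * y"] dl[of x] dl[of y] False
        by (simp add: power_add)
      hence "\<zeta> ^ dl (x * y) = \<zeta> ^ (dl x + dl y)" using key by blast
      thus ?thesis using False by (simp add: \<chi>_def power_add)
    qed (auto simp: \<chi>_def)
    have "\<gamma> ^ dl 1 = \<gamma> ^ 0" using dl[of 1] by simp
    hence "\<zeta> ^ dl 1 = \<zeta> ^ 0" using key by blast
    thus "\<chi> 1 = 1" by (simp add: \<chi>_def)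
    show "\<chi> 0 = 0" by (simp add: \<chi>_def)
    show "norm (\<chi> x) = 1" if "x \<noteq> 0" for x using that by (simp add: \<chi>_def norm_power \<zeta>_def)
    show "x = 1" if "\<chi> x = 1" for x
    proof -
      have x: "x \<noteq> 0" using that by (auto simp: \<chi>_def)
      hence "\<zeta> ^ dl x = \<zeta> ^ 0" using that by (simp add: \<chi>_def)
      hence "\<gamma> ^ dl x = \<gamma> ^ 0" using key by blast
      thus ?thesis using dl[OF x] by simp
    qed
  qed
qed

text \<open>The number (q^d - 1)/(q - 1), which is the exponent of the norm from the field with q^d
  elements to F_q.\<close>

definition rep_exp :: "nat \<Rightarrow> nat \<Rightarrow> nat" where "rep_exp q d = (\<Sum>i<d. q ^ i)"

lemma rep_exp_mult: "q \<ge> 1 \<Longrightarrow> rep_exp q d * (q - 1) = q ^ d - 1"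
proof (induction d)
  case (Suc d)
  have "rep_exp q (Suc d) * (q - 1) = (q ^ d - 1) + q ^ d * (q - 1)"
    using Suc by (simp add: rep_exp_def distrib_right)
  also have "\<dots> = q ^ Suc d - 1" using Suc.prems
    by (simp add: algebra_simps diff_mult_distrib2)
  finally show ?case .
qed (simp add: rep_exp_def)

lemma rep_exp_pos: "d > 0 \<Longrightarrow> rep_exp q d > 0"
  by (cases d) (simp_all only: rep_exp_def sum.lessThan_Suc_shift, simp_all)

lemma power_rep_exp: "x ^ rep_exp q d = (\<Prod>i<d. x ^ (q ^ i))" for x :: "'b::comm_monoid_mult"
  by (simp add: rep_exp_def power_sum)

context fq_algebra
begin

lemma ev_rep_exp:
  "ev \<beta> A ^ rep_exp q d = (\<Prod>i<d. ev (\<beta> ^ (q ^ i)) A)"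
  by (simp add: power_rep_exp ev_frobi)

lemma norm_in_range:
  assumes "irreducible P" "ev \<beta> P = 0"
  shows "ev \<beta> A ^ rep_exp q (degree P) \<in> range \<iota>"
proof -
  let ?d = "degree P" and ?y = "ev \<beta> A"
  have d: "?d > 0" using assms(1) by (rule irreducible_poly_degree_pos)
  obtain d' where d': "?d = Suc d'" using d by (cases ?d) auto
  have "(?y ^ rep_exp q ?d) ^ q = (\<Prod>i<?d. ?y ^ (q ^ Suc i))"
    by (simp add: power_rep_exp prod_power_distrib mult.commute[of q] power_mult)
  also have "\<dots> = (\<Prod>i<d'. ?y ^ (q ^ Suc i)) * ?y ^ (q ^ ?d)" by (simp only: d' prod.lessThan_Suc)
  also have "?y ^ (q ^ ?d) = ?y ^ (q ^ 0)" by (simp add: ev_frob_period[OF assms])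
  also have "(\<Prod>i<d'. ?y ^ (q ^ Suc i)) * ?y ^ (q ^ 0) = (\<Prod>i<?d. ?y ^ (q ^ i))"
    unfolding d' prod.lessThan_Suc_shift by (simp add: mult.commute)
  also have "\<dots> = ?y ^ rep_exp q ?d" by (simp add: power_rep_exp)
  finally show ?thesis by (simp add: fixed_iff)
qed

text \<open>For P irreducible with root \<open>\<beta>\<close>, the norm to F_q of the class of A
  modulo P, which is the (q-1)-st power residue symbol.\<close>

definition nrm :: "'a poly \<Rightarrow> 'b \<Rightarrow> 'a poly \<Rightarrow> 'a" where
  "nrm P \<beta> A = (THE c. \<iota> c = ev \<beta> A ^ rep_exp q (degree P))"

lemma iota_nrm:
  assumes "irreducible P" "ev \<beta> P = 0"
  shows "\<iota> (nrm P \<beta> A) = ev \<beta> A ^ rep_exp q (degree P)"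
proof -
  obtain c where c: "\<iota> c = ev \<beta> A ^ rep_exp q (degree P)" using norm_in_range[OF assms, of A] by auto
  hence "nrm P \<beta> A = c" unfolding nrm_def
  proof (intro the_equality)
    fix c' assume "\<iota> c' = ev \<beta> A ^ rep_exp q (degree P)"
    thus "c' = c" using c by (metis eq_iff)
  qed
  thus ?thesis using c by simp
qed

lemma nrm_mult:
  assumes "irreducible P" "ev \<beta> P = 0"
  shows "nrm P \<beta> (A * B) = nrm P \<beta> A * nrm P \<beta> B"
proof -
  have "\<iota> (nrm P \<beta> (A * B)) = \<iota> (nrm P \<beta> A * nrm P \<beta> B)"
    by (simp add: hom_mult iota_nrm[OF assms] power_mult_distrib)
  thus ?thesis by simp
qed

lemma nrm_1:
  assumes "irreducible P" "ev \<beta> P = 0" shows "nrm P \<beta> 1 = 1"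
proof -
  have "\<iota> (nrm P \<beta> 1) = \<iota> 1" by (simp add: iota_nrm[OF assms])
  thus ?thesis by (simp only: eq_iff)
qed

lemma nrm_eq_0_iff:
  assumes "irreducible P" "ev \<beta> P = 0" shows "nrm P \<beta> A = 0 \<longleftrightarrow> P dvd A"
proof -
  have "nrm P \<beta> A = 0 \<longleftrightarrow> \<iota> (nrm P \<beta> A) = 0" by simp
  also have "\<dots> \<longleftrightarrow> P dvd A" unfolding iota_nrm[OF assms]
    using rep_exp_pos[OF irreducible_poly_degree_pos[OF assms(1)], of q] by (simp add: ev_eq_0_iff[OF assms])
  finally show ?thesis .
qed

lemma nrm_cong:
  assumes "irreducible P" "ev \<beta> P = 0" "ev \<beta> A = ev \<beta> B" shows "nrm P \<beta> A = nrm P \<beta> B"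
  using assms(3) by (simp add: nrm_def)

text \<open>The reciprocity law: both sides are, up to sign, the product of all differences of the roots
  of \<open>P\<close> and of \<open>Q\<close>.\<close>

lemma reciprocity:
  assumes P: "irreducible P" "lead_coeff P = 1" "ev \<beta> P = 0"
    and Q: "irreducible Q" "lead_coeff Q = 1" "ev \<alpha> Q = 0"
  shows "nrm Q \<alpha> P = (-1) ^ (degree P * degree Q) * nrm P \<beta> Q"
proof -
  let ?d = "degree P" and ?m = "degree Q"
  have evP: "ev x P = (\<Prod>i<?d. x - \<beta> ^ (q ^ i))" for x using ev_as_prod[OF P(1,3)] P(2) by simp
  have evQ: "ev x Q = (\<Prod>j<?m. x - \<alpha> ^ (q ^ j))" for x using ev_as_prod[OF Q(1,3)] Q(2) by simp
  have "\<iota> (nrm Q \<alpha> P) = (\<Prod>j<?m. \<Prod>i<?d. \<alpha> ^ (q ^ j) - \<beta> ^ (q ^ i))"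
    unfolding iota_nrm[OF Q(1,3)] ev_rep_exp[of \<alpha>] by (simp only: evP)
  also have "\<dots> = (\<Prod>j<?m. \<Prod>i<?d. (-1) * (\<beta> ^ (q ^ i) - \<alpha> ^ (q ^ j)))" by simp
  also have "\<dots> = (\<Prod>j<?m. (-1) ^ ?d * (\<Prod>i<?d. \<beta> ^ (q ^ i) - \<alpha> ^ (q ^ j)))"
    by (simp only: prod.distrib prod_constant card_lessThan)
  also have "\<dots> = (-1) ^ (?d * ?m) * (\<Prod>j<?m. \<Prod>i<?d. \<beta> ^ (q ^ i) - \<alpha> ^ (q ^ j))"
    by (simp only: prod.distrib prod_constant card_lessThan power_mult)
  also have "(\<Prod>j<?m. \<Prod>i<?d. \<beta> ^ (q ^ i) - \<alpha> ^ (q ^ j)) = (\<Prod>i<?d. \<Prod>j<?m. \<beta> ^ (q ^ i) - \<alpha> ^ (q ^ j))"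
    by (rule prod.swap)
  also have "\<dots> = \<iota> (nrm P \<beta> Q)"
    unfolding iota_nrm[OF P(1,3)] ev_rep_exp[of \<beta>] by (simp only: evQ)
  also have "(-1) ^ (?d * ?m) * \<iota> (nrm P \<beta> Q) = \<iota> ((-1) ^ (?d * ?m) * nrm P \<beta> Q)"
    by (simp add: hom_mult hom_power hom_uminus)
  finally show ?thesis by simp
qed

text \<open>Otherwise all q^d - 1 nonzero residues would be roots of X^e - 1 for some positive e <
  q^d - 1.\<close>

lemma nrm_power_nontrivial:
  assumes "irreducible P" "ev \<beta> P = 0" and j: "\<not> (q - 1) dvd j"
  obtains A where "\<not> P dvd A" "nrm P \<beta> A ^ j \<noteq> 1"
proof (rule ccontr)
  note obt = that
  assume "\<not> thesis"
  hence all: "nrm P \<beta> A ^ j = 1" if "\<not> P dvd A" for A using that obt by blast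
  let ?d = "degree P"
  have d: "?d > 0" using assms(1) by (rule irreducible_poly_degree_pos)
  define j' where "j' = j mod (q - 1)"
  have q1: "q - 1 > 0" using q_ge_2 by simp
  have j': "j' > 0" "j' < q - 1" using j q1 by (auto simp: j'_def mod_greater_zero_iff_not_dvd)
  let ?D = "{r :: 'a poly. degree r < ?d}"
  have card: "card ?D = q ^ ?d" "finite ?D" using card_polys_degree_less[OF d, where 'a='a] by (auto simp: q_eq)
  let ?S = "ev \<beta> ` (?D - {0})"
  let ?e = "rep_exp q ?d * j'"
  have "card ?S = card (?D - {0})" by (intro card_image inj_on_subset[OF inj_on_ev[OF assms(1,2)]]) auto
  also have "\<dots> = q ^ ?d - 1" using card d by (simp add: card_Diff_singleton)
  finally have cS: "card ?S = q ^ ?d - 1" .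
  have sub: "?S \<subseteq> {x. x ^ ?e = 1}"
  proof
    fix x assume "x \<in> ?S"
    then obtain r where r: "x = ev \<beta> r" "degree r < ?d" "r \<noteq> 0" by auto
    have nd: "\<not> P dvd r" using r(2,3) by (auto dest: dvd_imp_degree_le)
    have n0: "nrm P \<beta> r \<noteq> 0" using nrm_eq_0_iff[OF assms(1,2)] nd by blast
    have "nrm P \<beta> r ^ (q - 1) = 1" using field_power_card_minus_1[OF n0] by (simp only: q_eq[symmetric])
    hence "nrm P \<beta> r ^ j' = 1" unfolding j'_def using all[OF nd] power_mod_period by metis
    hence "\<iota> (nrm P \<beta> r ^ j') = 1" by simp
    thus "x \<in> {x. x ^ ?e = 1}" by (simp add: hom_power iota_nrm[OF assms(1,2)] r(1) power_mult)
  qed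
  have e0: "?e > 0" using rep_exp_pos[OF d] j' by simp
  have "card {x::'b. x ^ ?e = 1} \<le> ?e" by (rule card_power_eq_le(1)[OF e0])
  moreover have "card ?S \<le> card {x::'b. x ^ ?e = 1}" by (rule card_mono[OF card_power_eq_le(2)[OF e0] sub])
  moreover have "?e < rep_exp q ?d * (q - 1)" using rep_exp_pos[OF d] j' by simp
  ultimately show False using cS rep_exp_mult[of q ?d] q_ge_2 by linarith
qed

end

text \<open>Multiplication by a polynomial \<open>u\<close> modulo \<open>P\<close>, with the quotient by \<open>P\<close> kept fixed, permutes the
  monic polynomials of a given large degree.\<close>

lemma residue_function_vanishes:
  fixes h :: "'a::{finite,field} poly \<Rightarrow> complex"
  assumes P: "irreducible P" and mult: "\<And>A B. h (A * B) = h A * h B"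
    and res: "\<And>A. h (A mod P) = h A" and u: "\<not> P dvd u" "h u \<noteq> 1" and k: "k \<ge> degree P"
  shows "coeff_sum h k = 0"
proof -
  have P0: "P \<noteq> 0" using P by auto
  have d: "degree P > 0" using P by (rule irreducible_poly_degree_pos)
  define \<pi> where "\<pi> = (\<lambda>A. A + ((u * A) mod P - A mod P))"
  have dm: "degree (B mod P) < degree P" for B using degree_mod_less[OF P0, of B] d by auto
  have modpi: "\<pi> A mod P = (u * A) mod P" for A
  proof -
    have "\<pi> A = A div P * P + (u * A) mod P" unfolding \<pi>_def by (simp add: algebra_simps minus_mod_eq_mult_div)
    thus ?thesis by simp
  qed
  have maps: "\<pi> A \<in> monics k" if A: "A \<in> monics k" for A
  proof -
    let ?e = "(u * A) mod P - A mod P"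
    have "degree ?e < degree P" using dm by (intro degree_diff_less) auto
    hence "degree ?e < degree A" using A k by (simp add: monics_def)
    hence "degree (\<pi> A) = degree A" "coeff (\<pi> A) (degree A) = coeff A (degree A)"
      unfolding \<pi>_def using coeff_eq_0[of ?e "degree A"] by (simp_all only: degree_add_eq_left coeff_add add_0_right)
    thus ?thesis using A by (auto simp: monics_def)
  qed
  have inj: "inj_on \<pi> (monics k)"
  proof (rule inj_onI)
    fix A B assume "\<pi> A = \<pi> B"
    hence uu: "(u * A) mod P = (u * B) mod P" using modpi by metis
    hence "P dvd u * (A - B)" by (simp add: mod_eq_dvd_iff right_diff_distrib)
    hence "P dvd A - B" using irreducible_dvd_mult_iff[OF P] u(1) by blast
    hence "A mod P = B mod P" by (simp add: mod_eq_dvd_iff)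
    thus "A = B" using \<open>\<pi> A = \<pi> B\<close> uu by (simp add: \<pi>_def)
  qed
  have img: "\<pi> ` monics k = monics k"
    by (rule card_subset_eq) (use maps inj in \<open>auto simp: card_image\<close>)
  have "coeff_sum h k = (\<Sum>A\<in>\<pi> ` monics k. h A)" by (simp add: coeff_sum_def img)
  also have "\<dots> = (\<Sum>A\<in>monics k. h (\<pi> A))" by (simp add: sum.reindex[OF inj])
  also have "\<dots> = (\<Sum>A\<in>monics k. h u * h A)" 
    by (intro sum.cong refl) (metis modpi mult res)
  also have "\<dots> = h u * coeff_sum h k" by (simp add: coeff_sum_def sum_distrib_left)
  finally show ?thesis using u(2) by simp
qed

text \<open>Any prime factor of P + 1 serves. It provides a prime at which a character modulo P does
  not vanish, as the real case requires.\<close>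

lemma exists_other_monic_irr:
  assumes "P \<in> monic_irr" obtains Q where "Q \<in> monic_irr" "Q \<noteq> P"
proof -
  have "degree (P + 1) > 0" using monic_irr_degree_pos[OF assms] by (simp add: degree_add_eq_left)
  then obtain Q where Q: "irreducible Q" "lead_coeff Q = 1" "Q dvd P + 1"
    by (rule exists_monic_irreducible_factor)
  have "Q \<noteq> P"
  proof
    assume "Q = P"
    hence "Q dvd 1" using Q(3) by (simp add: dvd_add_right_iff)
    thus False using Q(1) by auto
  qed
  thus ?thesis using that Q by (simp add: monic_irr_def)
qed

interpretation ac: fq_algebra "to_ac :: 'a::{finite,field} \<Rightarrow> 'a alg_closure" "CARD('a)"
  by unfold_locales auto

text \<open>The character is faithful, so its power 2j is nontrivial unless q - 1 divides 2j, and
  then its j-th power takes only the values 0, 1, -1. These are the two alternatives of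
  \<open>mangoldt_sum_tendsto_0\<close>.\<close>

lemma (in fq_algebra) character_sum_tendsto_0:
  fixes \<chi> :: "'a \<Rightarrow> complex"
  assumes P: "P \<in> monic_irr" "ev \<beta> P = 0"
    and \<chi>: "\<And>x y. \<chi> (x * y) = \<chi> x * \<chi> y" "\<chi> 1 = 1" "\<chi> 0 = 0" "\<And>x. x \<noteq> 0 \<Longrightarrow> norm (\<chi> x) = 1"
    "\<And>x. \<chi> x = 1 \<Longrightarrow> x = 1" and j: "j \<ge> 1" "\<not> (q - 1) dvd j"
  shows "(\<lambda>m. mangoldt_sum (\<lambda>A. \<chi> (nrm P \<beta> A) ^ j) m / of_nat q ^ m) \<longlonglongrightarrow> 0"
proof -
  have irr: "irreducible P" using P(1) by (simp add: monic_irr_def)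
  have \<chi>pow: "\<chi> (x ^ n) = \<chi> x ^ n" for x n by (induction n) (simp_all add: \<chi>)
  have van: "vanishing_function (\<lambda>A. \<chi> (nrm P \<beta> A) ^ j) (degree P)" if j: "j \<ge> 1" "\<not> (q - 1) dvd j" for j
  proof unfold_locales
    show "\<chi> (nrm P \<beta> (A * B)) ^ j = \<chi> (nrm P \<beta> A) ^ j * \<chi> (nrm P \<beta> B) ^ j" for A B
      by (simp add: nrm_mult[OF irr P(2)] \<chi> power_mult_distrib)
    show "\<chi> (nrm P \<beta> 1) ^ j = 1" by (simp add: nrm_1[OF irr P(2)] \<chi>)
    show "\<chi> (nrm P \<beta> A) ^ j = 0 \<or> norm (\<chi> (nrm P \<beta> A) ^ j) = 1" for A
      using j by (cases "nrm P \<beta> A = 0") (auto simp: \<chi> norm_power)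
    obtain u where u: "\<not> P dvd u" "nrm P \<beta> u ^ j \<noteq> 1" by (rule nrm_power_nontrivial[OF irr P(2) j(2)])
    show "coeff_sum (\<lambda>A. \<chi> (nrm P \<beta> A) ^ j) k = 0" if "k \<ge> degree P" for k
    proof (rule residue_function_vanishes[OF irr _ _ u(1) _ that])
      show "\<chi> (nrm P \<beta> u) ^ j \<noteq> 1" using u(2) \<chi>(5) by (metis \<chi>pow)
      show "\<chi> (nrm P \<beta> (A mod P)) ^ j = \<chi> (nrm P \<beta> A) ^ j" for A
        using nrm_cong[OF irr P(2), of "A mod P" A] ev_mod[OF P(2)] by simp
    qed (simp add: nrm_mult[OF irr P(2)] \<chi> power_mult_distrib)
  qed
  interpret h: vanishing_function "\<lambda>A. \<chi> (nrm P \<beta> A) ^ j" "degree P" by (rule van[OF j])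
  have "(\<lambda>m. mangoldt_sum (\<lambda>A. \<chi> (nrm P \<beta> A) ^ j) m / of_nat CARD('a) ^ m) \<longlonglongrightarrow> 0"
  proof (rule h.mangoldt_sum_tendsto_0)
    show "(\<exists>d'. vanishing_function (\<lambda>A. (\<chi> (nrm P \<beta> A) ^ j)\<^sup>2) d') \<or>
      ((\<forall>A. \<chi> (nrm P \<beta> A) ^ j = 0 \<or> \<chi> (nrm P \<beta> A) ^ j = 1 \<or> \<chi> (nrm P \<beta> A) ^ j = -1) \<and>
      (\<exists>Q\<in>monic_irr. \<chi> (nrm P \<beta> Q) ^ j \<noteq> 0))"
    proof (cases "(q - 1) dvd j * 2")
      case False
      have "vanishing_function (\<lambda>A. \<chi> (nrm P \<beta> A) ^ (j * 2)) (degree P)" using False j by (intro van) auto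
      thus ?thesis by (auto simp: power_mult)
    next
      case True
      have "\<chi> x ^ j = 0 \<or> \<chi> x ^ j = 1 \<or> \<chi> x ^ j = -1" for x
      proof (cases "x = 0")
        case False
        obtain k where k: "j * 2 = (q - 1) * k" using True by (elim dvdE)
        have "x ^ (j * 2) = 1" unfolding k using field_power_card_minus_1[OF False] by (simp only: power_mult power_one q_eq)
        hence "(\<chi> x ^ j)\<^sup>2 = 1" by (metis \<chi>(2) \<chi>pow power_mult)
        thus ?thesis by (simp add: power2_eq_1_iff)
      qed (use j in \<open>simp add: \<chi>\<close>)
      moreover obtain Q where Q: "Q \<in> monic_irr" "Q \<noteq> P" by (rule exists_other_monic_irr[OF P(1)])
      have "\<chi> (nrm P \<beta> Q) ^ j \<noteq> 0"
      proof -
        have "\<not> P dvd Q" using Q P(1) monic_irr_dvd_eq by metis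
        hence "nrm P \<beta> Q \<noteq> 0" using nrm_eq_0_iff[OF irr P(2)] by blast
        hence "norm (\<chi> (nrm P \<beta> Q)) = 1" by (rule \<chi>(4))
        thus ?thesis by auto
      qed
      ultimately show ?thesis using Q(1) by blast
    qed
  qed
  thus ?thesis by (simp only: q_eq[symmetric])
qed

section \<open>Primitive roots\<close>

text \<open>A geometric sum in the (q-1)-th root of unity chi(x/c). The range from 1 places the
  trivial character at j = q - 1.\<close>

lemma character_orthogonality:
  fixes \<chi> :: "'a::{finite,field} \<Rightarrow> complex"
  assumes \<chi>: "\<And>x y. \<chi> (x * y) = \<chi> x * \<chi> y" "\<chi> 1 = 1" "\<And>x. \<chi> x = 1 \<Longrightarrow> x = 1"
    and "x \<noteq> 0" "c \<noteq> 0"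
  shows "(\<Sum>j=1..CARD('a) - 1. \<chi> (inverse c) ^ j * \<chi> x ^ j) = (if x = c then of_nat (CARD('a) - 1) else 0)"
proof -
  let ?n = "CARD('a) - 1"
  let ?y = "\<chi> (inverse c * x)"
  have pow: "\<chi> (z ^ k) = \<chi> z ^ k" for z k by (induction k) (simp_all add: \<chi>)
  have "?y ^ ?n = \<chi> ((inverse c * x) ^ ?n)" by (simp only: pow)
  also have "(inverse c * x) ^ ?n = 1" by (rule field_power_card_minus_1) (use assms in simp)
  finally have yn: "?y ^ ?n = 1" using \<chi>(2) by simp
  have eq: "(\<Sum>j=1..?n. \<chi> (inverse c) ^ j * \<chi> x ^ j) = (\<Sum>j=1..?n. ?y ^ j)"
    by (simp add: \<chi>(1) power_mult_distrib)
  show ?thesis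
  proof (cases "x = c")
    case True
    hence "?y = 1" using \<open>c \<noteq> 0\<close> \<chi>(2) by simp
    thus ?thesis unfolding eq using True by simp
  next
    case False
    hence "inverse c * x \<noteq> 1" using \<open>c \<noteq> 0\<close> by (simp add: field_simps)
    hence "?y \<noteq> 1" using \<chi>(3) by blast
    moreover have "(1 - ?y) * (\<Sum>j=1..?n. ?y ^ j) = 0" unfolding geometric_sum_from_1 power_Suc yn by simp
    ultimately show ?thesis unfolding eq using False by simp
  qed
qed

text \<open>The gain from a prime m in the Mangoldt sums: besides degree m only the linear
  polynomials occur, at most q in number.\<close>

lemma monic_irr_dvd_prime:
  assumes "prime (m::nat)"
  shows "{Q :: 'a::{finite,field} poly. Q \<in> monic_irr \<and> degree Q dvd m} 
     = {Q. Q \<in> monic_irr \<and> degree Q = m} \<union> {Q. Q \<in> monic_irr \<and> degree Q = 1}"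
    "{Q :: 'a poly. Q \<in> monic_irr \<and> degree Q = m} \<inter> {Q. Q \<in> monic_irr \<and> degree Q = 1} = {}"
  using assms by (auto simp: prime_nat_iff)

lemma finite_monic_irr_degree: 
  "finite {Q :: 'a::{finite,field} poly. Q \<in> monic_irr \<and> degree Q = m}"
  by (rule finite_subset[OF _ finite_monics[of m]]) (auto simp: monic_irr_def monics_def)

lemma card_monic_irr_1: "card {Q :: 'a::{finite,field} poly. Q \<in> monic_irr \<and> degree Q = 1} \<le> CARD('a)"
proof -
  have "card {Q :: 'a poly. Q \<in> monic_irr \<and> degree Q = 1} \<le> card (monics 1 :: 'a poly set)"
    by (intro card_mono finite_monics) (auto simp: monic_irr_def monics_def)
  thus ?thesis by (simp add: card_monics)
qed

lemma mangoldt_sum_prime: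
  fixes h :: "'a::{finite,field} poly \<Rightarrow> complex"
  assumes "prime (m::nat)"
  shows "mangoldt_sum h m = of_nat m * (\<Sum>Q | Q \<in> monic_irr \<and> degree Q = m. h Q) + (\<Sum>Q | Q \<in> monic_irr \<and> degree Q = 1. h Q ^ m)"
proof -
  have m0: "m > 0" using assms by (simp add: prime_gt_0_nat)
  let ?I = "\<lambda>m. {Q :: 'a poly. Q \<in> monic_irr \<and> degree Q = m}"
  let ?f = "\<lambda>Q. of_nat (degree Q) * h Q ^ (m div degree Q)"
  have "mangoldt_sum h m = (\<Sum>Q\<in>?I m. ?f Q) + (\<Sum>Q\<in>?I 1. ?f Q)"
    unfolding mangoldt_sum_def monic_irr_dvd_prime(1)[OF assms]
    by (rule sum.union_disjoint[OF finite_monic_irr_degree finite_monic_irr_degree monic_irr_dvd_prime(2)[OF assms]])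
  also have "(\<Sum>Q\<in>?I m. ?f Q) = of_nat m * (\<Sum>Q\<in>?I m. h Q)" using m0 by (simp add: sum_distrib_left)
  also have "(\<Sum>Q\<in>?I 1. ?f Q) = (\<Sum>Q\<in>?I 1. h Q ^ m)" by simp
  finally show ?thesis .
qed

lemma card_monic_irr_prime:
  assumes "prime (m::nat)"
  shows "real CARD('a) ^ m \<le> real m * real (card {Q :: 'a::{finite,field} poly. Q \<in> monic_irr \<and> degree Q = m}) + real CARD('a)"
proof -
  have m0: "m > 0" using assms by (simp add: prime_gt_0_nat)
  let ?I = "\<lambda>m. {Q :: 'a poly. Q \<in> monic_irr \<and> degree Q = m}"
  have "CARD('a) ^ m = (\<Sum>Q\<in>?I m \<union> ?I 1. degree Q)"
    using sum_degree_monic_irr[OF m0, where 'a='a] by (simp only: monic_irr_dvd_prime(1)[OF assms])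
  also have "\<dots> = (\<Sum>Q\<in>?I m. degree Q) + (\<Sum>Q\<in>?I 1. degree Q)"
    by (rule sum.union_disjoint[OF finite_monic_irr_degree finite_monic_irr_degree monic_irr_dvd_prime(2)[OF assms]])
  also have "(\<Sum>Q\<in>?I m. degree Q) = m * card (?I m)" by simp
  also have "(\<Sum>Q\<in>?I 1. degree Q) = card (?I 1)" by simp
  finally have "CARD('a) ^ m \<le> m * card (?I m) + CARD('a)" using card_monic_irr_1[where 'a='a] by linarith
  hence "real (CARD('a) ^ m) \<le> real (m * card (?I m) + CARD('a))" by (simp only: of_nat_le_iff)
  thus ?thesis by simp
qed

text \<open>Orthogonality expresses the count by character sums: the trivial character gives about
  q^m/m, the q - 2 others are of lower order. Half of the expected q^m/((q-1) m) is kept.\<close>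

lemma (in fq_algebra) eventually_many_primes_with_norm:
  assumes P: "P \<in> monic_irr" "ev \<beta> P = 0"
  shows "\<forall>\<^sub>F m in sequentially. prime m \<longrightarrow> (\<forall>c. c \<noteq> 0 \<longrightarrow>
    real q ^ m / 2 \<le> real (q - 1) * (real m * real (card {Q. Q \<in> monic_irr \<and> degree Q = m \<and> nrm P \<beta> Q = c})))"
proof -
  have irr: "irreducible P" using P(1) by (simp add: monic_irr_def)
  obtain \<chi> :: "'a \<Rightarrow> complex" where \<chi>:
    "\<And>x y. \<chi> (x * y) = \<chi> x * \<chi> y" "\<chi> 1 = 1" "\<chi> 0 = 0" "\<And>x. x \<noteq> 0 \<Longrightarrow> norm (\<chi> x) = 1"
    "\<And>x. \<chi> x = 1 \<Longrightarrow> x = 1" by (rule faithful_character_exists) blast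
  have pow: "\<chi> (z ^ k) = \<chi> z ^ k" for z k by (induction k) (simp_all add: \<chi>)
  define H where "H = (\<lambda>j A. \<chi> (nrm P \<beta> A) ^ j)"
  have H1: "norm (H j Q) \<le> 1" for j Q
    using \<chi>(4)[of "nrm P \<beta> Q"] by (cases "nrm P \<beta> Q = 0") (auto simp: H_def \<chi>(3) norm_power power_0_left)
  \<comment> \<open>With 1/(4q) per character, the q - 2 nontrivial ones cost at most q^m/4
    together; the linear polynomials cost at most q^2 more, which is below q^m/4 or equal to it once
    m >= 4.\<close>
  have ev1: "\<forall>\<^sub>F m in sequentially. \<forall>j\<in>{1..<q - 1}. norm (mangoldt_sum (H j) m) \<le> real q ^ m / (4 * real q)"
  proof (intro eventually_ball_finite ballI)
    fix j assume j: "j \<in> {1..<q - 1}"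
    hence nd: "\<not> (q - 1) dvd j" by (auto dest: dvd_imp_le)
    have "(\<lambda>m. mangoldt_sum (H j) m / of_nat q ^ m) \<longlonglongrightarrow> 0" unfolding H_def
      by (rule character_sum_tendsto_0[OF P]) (use \<chi> j nd in auto)
    hence "\<forall>\<^sub>F m in sequentially. norm (mangoldt_sum (H j) m / of_nat q ^ m) < 1 / (4 * real q)"
      using order_tendstoD(2)[OF tendsto_norm_zero, of _ sequentially "1 / (4 * real q)"] by auto
    thus "\<forall>\<^sub>F m in sequentially. norm (mangoldt_sum (H j) m) \<le> real q ^ m / (4 * real q)"
    proof eventually_elim
      case (elim m)
      have "norm (mangoldt_sum (H j) m) = norm (mangoldt_sum (H j) m / of_nat q ^ m) * real q ^ m"
        by (simp add: norm_divide norm_power)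
      also have "\<dots> \<le> (1 / (4 * real q)) * real q ^ m" using elim by (intro mult_right_mono) auto
      finally show ?case by (simp add: field_simps)
    qed
  qed auto
  \<comment> \<open>As m exceeds deg P, no Q of degree m equals P, so all the norms are
    nonzero.\<close>
  show ?thesis using ev1 eventually_ge_at_top[of 4] eventually_gt_at_top[of "degree P"]
  proof eventually_elim
    case (elim m)
    show ?case
    proof (intro impI allI)
      fix c :: 'a assume m: "prime m" and c: "c \<noteq> 0"
      let ?I = "\<lambda>m. {Q :: 'a poly. Q \<in> monic_irr \<and> degree Q = m}"
      let ?T = "{Q. Q \<in> monic_irr \<and> degree Q = m \<and> nrm P \<beta> Q = c}"
      let ?B = "\<lambda>j. \<Sum>Q\<in>?I m. H j Q"
      have nz: "nrm P \<beta> Q \<noteq> 0" if "Q \<in> ?I m" for Q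
      proof -
        have "\<not> P dvd Q" using that P(1) elim(3) monic_irr_dvd_eq[of P Q] by auto
        thus ?thesis using nrm_eq_0_iff[OF irr P(2)] by blast
      qed
      have Bj: "norm (of_nat m * ?B j) \<le> norm (mangoldt_sum (H j) m) + real q" for j
      proof -
        have "of_nat m * ?B j = mangoldt_sum (H j) m - (\<Sum>Q\<in>?I 1. H j Q ^ m)"
          using mangoldt_sum_prime[OF m, of "H j"] by simp
        hence "norm (of_nat m * ?B j) \<le> norm (mangoldt_sum (H j) m) + norm (\<Sum>Q\<in>?I 1. H j Q ^ m)"
          using norm_triangle_ineq4[of "mangoldt_sum (H j) m" "\<Sum>Q\<in>?I 1. H j Q ^ m"] by (simp only:)
        also have "norm (\<Sum>Q\<in>?I 1. H j Q ^ m) \<le> (\<Sum>Q\<in>?I 1. 1)"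
          by (intro sum_norm_le) (simp add: norm_power power_le_one H1)
        also have "\<dots> \<le> real q" using card_monic_irr_1[where 'a='a] by (simp add: q_eq)
        finally show ?thesis by simp
      qed
      have Blast: "?B (q - 1) = of_nat (card (?I m))"
      proof -
        have "H (q - 1) Q = 1" if "Q \<in> ?I m" for Q
        proof -
          have "nrm P \<beta> Q ^ (q - 1) = 1" using field_power_card_minus_1[OF nz[OF that]] by (simp only: q_eq[symmetric])
          thus ?thesis by (metis H_def pow \<chi>(2))
        qed
        thus ?thesis by simp
      qed
      have "of_nat (q - 1) * of_nat (card ?T) = (\<Sum>Q\<in>?I m. if nrm P \<beta> Q = c then of_nat (q - 1) else (0::complex))"
      proof -
        have "(\<Sum>Q\<in>?I m. if nrm P \<beta> Q = c then of_nat (q - 1) else (0::complex)) = (\<Sum>Q\<in>?T. of_nat (q - 1))"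
          using finite_monic_irr_degree[where 'a='a, of m] by (intro sum.mono_neutral_cong_right) auto
        thus ?thesis by (simp add: mult.commute)
      qed
      also have "\<dots> = (\<Sum>Q\<in>?I m. \<Sum>j=1..q - 1. \<chi> (inverse c) ^ j * H j Q)"
        unfolding H_def using character_orthogonality[of \<chi> _ c] \<chi> nz c
        by (intro sum.cong refl) (simp add: q_eq[symmetric])
      also have "\<dots> = (\<Sum>j=1..q - 1. \<chi> (inverse c) ^ j * ?B j)"
        by (subst sum.swap) (simp add: sum_distrib_left)
      also have "{1..q - 1} = insert (q - 1) {1..<q - 1}" using q_ge_2 by auto
      also have "(\<Sum>j\<in>insert (q - 1) {1..<q - 1}. \<chi> (inverse c) ^ j * ?B j) = ?B (q - 1) + (\<Sum>j=1..<q - 1. \<chi> (inverse c) ^ j * ?B j)"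
      proof -
        have "inverse c ^ (q - 1) = 1" using field_power_card_minus_1[of "inverse c"] c by (simp add: q_eq)
        hence "\<chi> (inverse c) ^ (q - 1) = 1" by (metis pow \<chi>(2))
        thus ?thesis by simp
      qed
      finally have main: "of_nat (q - 1) * of_nat (card ?T) = of_nat (card (?I m)) + (\<Sum>j=1..<q - 1. \<chi> (inverse c) ^ j * ?B j)"
        by (simp only: Blast)
      have "real m * card (?I m) - real (q - 1) * (real m * card ?T) 
         \<le> norm (of_real (real m * card (?I m) - real (q - 1) * (real m * card ?T)) :: complex)"
        by (simp only: norm_of_real)
      also have "(of_real (real m * card (?I m) - real (q - 1) * (real m * card ?T)) :: complex)
         = - (of_nat m * (\<Sum>j=1..<q - 1. \<chi> (inverse c) ^ j * ?B j))"
      proof -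
        have "(of_real (real m * card (?I m) - real (q - 1) * (real m * card ?T)) :: complex)
           = of_nat m * (of_nat (card (?I m)) - of_nat (q - 1) * of_nat (card ?T))"
          by (simp add: algebra_simps)
        thus ?thesis unfolding main by (simp add: algebra_simps)
      qed
      also have "norm \<dots> = norm (\<Sum>j=1..<q - 1. \<chi> (inverse c) ^ j * (of_nat m * ?B j))"
        by (simp add: sum_distrib_left mult.left_commute)
      also have "\<dots> \<le> (\<Sum>j=1..<q - 1. real q ^ m / (4 * real q) + real q)"
      proof (intro sum_norm_le)
        fix j assume j: "j \<in> {1..<q - 1}"
        have "norm (\<chi> (inverse c) ^ j * (of_nat m * ?B j)) = norm (of_nat m * ?B j)"
          using \<chi>(4)[of "inverse c"] c by (simp add: norm_mult norm_power)
        also have "\<dots> \<le> norm (mangoldt_sum (H j) m) + real q" by (rule Bj)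
        also have "\<dots> \<le> real q ^ m / (4 * real q) + real q" using elim(1) j by simp
        finally show "norm (\<chi> (inverse c) ^ j * (of_nat m * ?B j)) \<le> real q ^ m / (4 * real q) + real q" .
      qed
      also have "\<dots> = real (q - 2) * (real q ^ m / (4 * real q) + real q)" by (simp add: numeral_2_eq_2)
      also have "\<dots> \<le> (real q - 1) * (real q ^ m / (4 * real q) + real q)"
        using q_ge_2 by (intro mult_right_mono) auto
      also have "\<dots> \<le> real q * (real q ^ m / (4 * real q)) + (real q - 1) * real q"
        unfolding distrib_left by (intro add_mono mult_right_mono) auto
      also have "real q * (real q ^ m / (4 * real q)) = real q ^ m / 4" by simp
      finally have "real m * card (?I m) - real (q - 1) * (real m * card ?T) \<le> real q ^ m / 4 + (real q - 1) * real q" .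
      moreover have "real q ^ m \<le> real m * card (?I m) + real q"
        using card_monic_irr_prime[OF m, where 'a='a] by (simp add: q_eq)
      moreover have "4 * (real q * real q) \<le> real q ^ m"
      proof -
        have "4 * (q * q) \<le> q * q * (q * q)" using mult_le_mono[OF q_ge_2 q_ge_2] by (intro mult_le_mono1) simp
        also have "\<dots> = q ^ 4" by (simp add: power4_eq_xxxx)
        also have "\<dots> \<le> q ^ m" using elim(2) q_ge_2 by (intro power_increasing) auto
        finally have "real (4 * (q * q)) \<le> real (q ^ m)" by (simp only: of_nat_le_iff)
        thus ?thesis by simp
      qed
      ultimately show "real q ^ m / 2 \<le> real (q - 1) * (real m * real (card ?T))"
        by (simp add: algebra_simps)
    qed
  qed
qed

section \<open>Obstructions to being a primitive root\<close>

lemma card_irr_dvd_le: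
  fixes F :: "'a::{finite,field} poly"
  assumes "lead_coeff F = 1"
  shows "m * card {Q. Q \<in> monic_irr \<and> degree Q = m \<and> Q dvd F} \<le> degree F"
proof -
  let ?J = "{Q. Q \<in> monic_irr \<and> degree Q = m \<and> Q dvd F}"
  have "m * card ?J = (\<Sum>Q\<in>?J. degree Q)" by simp
  also have "\<dots> = (\<Sum>(Q,e)\<in>(\<lambda>Q. (Q, 1::nat)) ` ?J. degree Q)" by (subst sum.reindex) (auto simp: inj_on_def)
  also have "\<dots> \<le> (\<Sum>(Q,e)\<in>prime_powers_dvd F. degree Q)"
    using sum_degree_prime_powers_dvd[OF assms] by (intro sum_mono2) (auto simp: prime_powers_dvd_def)
  also have "\<dots> = degree F" using sum_degree_prime_powers_dvd[OF assms] by simp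
  finally show ?thesis .
qed

text \<open>The order of q modulo l divides the prime m and is not 1, so it is m; by Fermat it
  divides l - 1.\<close>

lemma prime_dvd_power_minus_1_gt:
  fixes l m q :: nat
  assumes l: "prime l" "l dvd q ^ m - 1" "\<not> l dvd q - 1" and m: "prime m" and q: "q \<ge> 1"
  shows "l > m"
proof -
  have qm: "[q ^ m = 1] (mod l)" using l(2) q by (metis cong_to_1_nat cong_altdef_nat one_le_power cong_sym)
  have cop: "coprime q l"
  proof -
    have "coprime (q ^ m) l" using qm by (metis cong_imp_coprime cong_sym coprime_1_left)
    thus ?thesis using m by (simp add: prime_gt_0_nat)
  qed
  have "ord l q dvd m" using qm ord_divides[of q m l] by blast
  hence "ord l q = 1 \<or> ord l q = m" using m by (auto simp: prime_nat_iff)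
  moreover have "ord l q \<noteq> 1"
  proof
    assume "ord l q = 1"
    hence "[q ^ 1 = 1] (mod l)" by (metis ord)
    hence "l dvd q - 1" using q by (simp add: cong_altdef_nat)
    thus False using l(3) by simp
  qed
  ultimately have "ord l q = m" by simp
  moreover have "[q ^ (l - 1) = 1] (mod l)" using cop l(1) fermat_theorem[of l q]
    by (metis coprime_absorb_left coprime_commute not_prime_unit)
  ultimately have "m dvd l - 1" using ord_divides[of q "l - 1" l] by simp
  moreover have "l - 1 > 0" using l(1) prime_gt_1_nat by fastforce
  ultimately show ?thesis by (auto dest: dvd_imp_le)
qed

lemma card_large_prime_divisors:
  fixes n m :: nat
  assumes "n > 0" "finite B" "\<And>l. l \<in> B \<Longrightarrow> prime l \<and> l dvd n \<and> l > m"
  shows "m ^ card B \<le> n"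
proof -
  have "m ^ card B = (\<Prod>l\<in>B. m)" by simp
  also have "\<dots> \<le> (\<Prod>l\<in>B. l)" using assms(3) by (intro prod_mono) (auto intro: less_imp_le)
  also have "(\<Prod>l\<in>B. l) \<le> n"
  proof (rule dvd_imp_le[OF _ assms(1)])
    show "(\<Prod>l\<in>B. l) dvd n" using assms(2,3)
    proof (induction B rule: finite_induct)
      case (insert l B)
      have "coprime l (\<Prod>l\<in>B. l)" using insert by (intro prod_coprime_right) (auto intro: primes_coprime)
      thus ?case using insert by (simp add: divides_mult)
    qed simp
  qed
  finally show ?thesis .
qed


lemma order_eq_if_no_prime_quotient:
  fixes y :: "'b::comm_monoid_mult"
  assumes n: "n > 0" "y ^ n = 1" and l: "\<And>l. prime l \<Longrightarrow> l dvd n \<Longrightarrow> y ^ (n div l) \<noteq> 1"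
    and i: "i > 0" "y ^ i = 1"
  shows "n \<le> i"
proof -
  define o' where "o' = (LEAST i. i > 0 \<and> y ^ i = 1)"
  have o: "o' > 0" "y ^ o' = 1" unfolding o'_def using LeastI[of "\<lambda>i. i > 0 \<and> y ^ i = 1" i] i by auto
  have omin: "o' \<le> k" if "k > 0" "y ^ k = 1" for k unfolding o'_def using that by (intro Least_le) auto
  have "y ^ (n mod o') = 1" using power_mod_period[OF o(2), of n] n(2) by simp
  hence "n mod o' = 0" using omin[of "n mod o'"] o(1) by (meson mod_less_divisor not_gr0 not_less)
  then obtain k where k: "n = o' * k" by auto
  have "k = 1"
  proof (rule ccontr)
    assume "k \<noteq> 1"
    then obtain l where lp: "prime l" "l dvd k" using prime_factor_nat by blast
    then obtain k' where k': "k = l * k'" by auto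
    have l0: "l > 0" using lp(1) by (simp add: prime_gt_0_nat)
    have "n div l = o' * k'" using l0 by (simp add: k k' mult.left_commute)
    hence "y ^ (n div l) = 1" by (simp add: power_mult o(2))
    thus False using l[OF lp(1)] lp(2) k by auto
  qed
  thus ?thesis using k omin[OF i] by simp
qed

text \<open>Among the irreducible polynomials \<open>M\<close> of prime degree \<open>m\<close>, reciprocity and the character sum
  estimate give a positive proportion for which the obstructions from primes dividing \<open>q - 1\<close>
  disappear. All other primes dividing \<open>q\<^sup>m - 1\<close> exceed \<open>m\<close>; there are few of them and each excludes
  only a proportion \<open>O(1/m)\<close>.\<close>

theorem exists_modulus_with_primitive_root:
  fixes P :: "'a::{finite,field} poly"
  assumes P: "P \<in> monic_irr"
  obtains M where "M \<in> monic_irr" "degree M > N" "\<And>i. i > 0 \<Longrightarrow> M dvd P ^ i - 1 \<Longrightarrow> CARD('a) ^ degree M - 1 \<le> i"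
proof -
  let ?q = "CARD('a)"
  let ?d = "degree P"
  have irr: "irreducible P" "lead_coeff P = 1" using P by (auto simp: monic_irr_def)
  have d: "?d > 0" using P by (rule monic_irr_degree_pos)
  have q2: "?q \<ge> 2" by (rule card_field_ge_2)
  have root: "\<exists>x :: 'a alg_closure. ac.ev x Q = 0" if "Q \<in> monic_irr" for Q
    using alg_closed_imp_poly_has_root[of "map_poly to_ac Q"] monic_irr_degree_pos[OF that] by (simp add: ac.ev_def)
  obtain \<beta> where \<beta>: "ac.ev \<beta> P = 0" using root[OF P] by blast
  obtain \<gamma> :: 'a where \<gamma>: "\<gamma> \<noteq> 0" "\<And>x. x \<noteq> 0 \<Longrightarrow> \<exists>i::nat. x = \<gamma> ^ i"
    by (rule finite_field_generator) blast
  \<comment> \<open>There are at least q^m/(2 (q-1) m) candidates, and at most |B| d q^m/m^2 of them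
    are excluded; some candidate survives as soon as C |B| < m.\<close>
  define C where "C = 2 * (?q - 1) * ?d"
  have C0: "C > 0" using q2 d by (simp add: C_def)
  obtain N0 where N0: "\<And>m c. m \<ge> N0 \<Longrightarrow> prime m \<Longrightarrow> c \<noteq> 0 \<Longrightarrow>
    real ?q ^ m / 2 \<le> real (?q - 1) * (real m * real (card {Q. Q \<in> monic_irr \<and> degree Q = m \<and> ac.nrm P \<beta> Q = c}))"
    using ac.eventually_many_primes_with_norm[OF P \<beta>] unfolding eventually_sequentially by blast
  \<comment> \<open>The requirement m > q^C will turn m^|B| < q^m into C |B| < m.\<close>
  obtain m where m: "prime m" "m > max (max N N0) (max ?d (?q ^ C))" using bigger_prime by blast
  have m0: "m > 0" using m(1) by (simp add: prime_gt_0_nat)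
  define n where "n = ?q ^ m - 1"
  have "1 < ?q ^ m" using q2 m0 by (intro one_less_power) auto
  hence n0: "n > 0" by (simp add: n_def)
  \<comment> \<open>The sign cancels that of the reciprocity law, so that the norm of P modulo Q
    becomes the generator \<open>\<gamma>\<close>.\<close>
  define c where "c = (-1) ^ (?d * m) * \<gamma>"
  have c0: "c \<noteq> 0" using \<gamma>(1) by (simp add: c_def)
  define T where "T = {Q. Q \<in> monic_irr \<and> degree Q = m \<and> ac.nrm P \<beta> Q = c}"
  define B where "B = {l. prime l \<and> l dvd n \<and> \<not> l dvd ?q - 1}"
  have finB: "finite B" by (rule finite_subset[of _ "{..n}"]) (use n0 in \<open>auto simp: B_def dest: dvd_imp_le\<close>)
  have Bgt: "l > m" if "l \<in> B" for l
    using that prime_dvd_power_minus_1_gt[of l ?q m] m(1) q2 by (simp add: B_def n_def)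
  have "m ^ card B \<le> n" by (rule card_large_prime_divisors[OF n0 finB]) (use Bgt in \<open>auto simp: B_def\<close>)
  hence mB: "m ^ card B < ?q ^ m" using n0 by (simp add: n_def)
  have CB: "C * card B < m"
  proof (rule ccontr)
    assume "\<not> C * card B < m"
    hence "?q ^ m \<le> ?q ^ (C * card B)" using q2 by (intro power_increasing) auto
    also have "\<dots> = (?q ^ C) ^ card B" by (simp add: power_mult)
    also have "\<dots> \<le> m ^ card B" using m(2) by (intro power_mono) auto
    finally show False using mB by simp
  qed
  define bad where "bad = (\<lambda>l. {Q. Q \<in> monic_irr \<and> degree Q = m \<and> Q dvd P ^ (n div l) - 1})"
  have finbad: "finite (bad l)" for l
    by (rule finite_subset[OF _ finite_monic_irr_degree[of m]]) (auto simp: bad_def)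
  \<comment> \<open>A bad Q of degree m divides P^(n/l) - 1, whose degree is d n/l; since l > m
    there are at most d n/m^2 of them.\<close>
  have badc: "m * (m * card (bad l)) \<le> ?d * n" if l: "l \<in> B" for l
  proof -
    have lp: "prime l" "l dvd n" using l by (auto simp: B_def)
    then obtain k where k: "n = l * k" by (elim dvdE)
    have nl: "n div l = k" using lp(1) k by (simp add: prime_gt_0_nat)
    have k0: "k > 0" using n0 k by (auto intro: gr0I)
    have P0: "P \<noteq> 0" using irr by auto
    have dPk: "degree (P ^ k) = ?d * k" using P0 by (simp add: degree_power_eq mult.commute)
    have pos: "degree (P ^ k) > 0" using dPk d k0 by simp
    have deg: "degree (P ^ k - 1) = ?d * k" using pos dPk degree_add_eq_left[of "-1" "P ^ k"] by simp
    have "lead_coeff (P ^ k - 1) = 1"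
    proof -
      have "coeff (1 :: 'a poly) (?d * k) = 0" using pos dPk by (intro coeff_eq_0) simp
      moreover have "coeff (P ^ k) (?d * k) = 1" using irr(2) dPk by (metis lead_coeff_power power_one)
      ultimately show ?thesis unfolding deg coeff_diff by simp
    qed
    hence "m * card (bad l) \<le> ?d * k" using card_irr_dvd_le[of "P ^ k - 1" m] deg by (simp add: bad_def nl)
    hence "l * (m * card (bad l)) \<le> ?d * n" unfolding k by (metis mult_le_mono2 mult.left_commute)
    moreover have "m * (m * card (bad l)) \<le> l * (m * card (bad l))" using Bgt[OF l] by (intro mult_le_mono1) simp
    ultimately show ?thesis by linarith
  qed
  have "\<exists>Q\<in>T. \<forall>l\<in>B. Q \<notin> bad l"
  proof (rule ccontr)
    assume "\<not> ?thesis"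
    hence "T \<subseteq> (\<Union>l\<in>B. bad l)" by blast
    hence "card T \<le> card (\<Union>l\<in>B. bad l)" using finB finbad by (intro card_mono) auto
    also have "\<dots> \<le> (\<Sum>l\<in>B. card (bad l))" by (rule card_UN_le[OF finB])
    finally have "m * (m * card T) \<le> m * (m * (\<Sum>l\<in>B. card (bad l)))" by (intro mult_le_mono2)
    also have "\<dots> = (\<Sum>l\<in>B. m * (m * card (bad l)))" by (simp add: sum_distrib_left)
    also have "\<dots> \<le> (\<Sum>l\<in>B. ?d * n)" by (intro sum_mono badc)
    also have "\<dots> = card B * (?d * n)" by simp
    also have "\<dots> \<le> card B * (?d * ?q ^ m)" by (intro mult_le_mono2) (simp add: n_def)
    finally have 1: "m * (m * card T) \<le> card B * (?d * ?q ^ m)" .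
    have "real (?q ^ m) \<le> real (2 * (?q - 1) * (m * card T))"
      using N0[of m c] m c0 unfolding T_def[symmetric] by (simp add: field_simps)
    hence "?q ^ m \<le> 2 * (?q - 1) * (m * card T)" by (simp only: of_nat_le_iff)
    hence "m * ?q ^ m \<le> m * (2 * (?q - 1) * (m * card T))" by (rule mult_le_mono2)
    also have "\<dots> = 2 * (?q - 1) * (m * (m * card T))" by (simp only: mult_ac)
    also have "\<dots> \<le> 2 * (?q - 1) * (card B * (?d * ?q ^ m))" by (rule mult_le_mono2[OF 1])
    also have "\<dots> = C * card B * ?q ^ m" by (simp only: C_def mult_ac)
    finally show False using CB by simp
  qed
  then obtain Q where Q: "Q \<in> T" and good: "\<And>l. l \<in> B \<Longrightarrow> Q \<notin> bad l" by blast
  have Qm: "Q \<in> monic_irr" "degree Q = m" "ac.nrm P \<beta> Q = c" using Q by (auto simp: T_def)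
  have Qirr: "irreducible Q" "lead_coeff Q = 1" using Qm by (auto simp: monic_irr_def)
  obtain \<alpha> where \<alpha>: "ac.ev \<alpha> Q = 0" using root[OF Qm(1)] by blast
  let ?y = "ac.ev \<alpha> P"
  have dvd1: "Q dvd P ^ i - 1 \<longleftrightarrow> ?y ^ i = 1" for i
    using ac.ev_eq_0_iff[OF Qirr(1) \<alpha>, of "P ^ i - 1"] by simp
  have "ac.nrm Q \<alpha> P = \<gamma>"
  proof -
    have "ac.nrm Q \<alpha> P = (-1) ^ (?d * m) * ((-1) ^ (?d * m) * \<gamma>)"
      using ac.reciprocity[OF irr \<beta> Qirr \<alpha>] by (simp add: Qm c_def)
    thus ?thesis by (simp add: mult.assoc[symmetric] flip: power_add)
  qed
  hence yE: "?y ^ rep_exp ?q m = to_ac \<gamma>" using ac.iota_nrm[OF Qirr(1) \<alpha>, of P] Qm(2) by simp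
  have nE: "n = rep_exp ?q m * (?q - 1)" using rep_exp_mult[of ?q m] q2 by (simp add: n_def)
  have yn: "?y ^ n = 1" unfolding nE power_mult yE
    using field_power_card_minus_1[OF \<gamma>(1)] by (metis to_ac_power to_ac_1)
  show ?thesis
  proof (rule that[OF Qm(1)])
    show "degree Q > N" using Qm(2) m(2) by simp
    fix i :: nat assume i: "i > 0" "Q dvd P ^ i - 1"
    have "n \<le> i"
    proof (rule order_eq_if_no_prime_quotient[OF n0 yn])
      show "i > 0" by fact
      show "?y ^ i = 1" using i(2) dvd1 by blast
      fix l :: nat assume l: "prime l" "l dvd n"
      show "?y ^ (n div l) \<noteq> 1"
      proof (cases "l dvd ?q - 1")
        case False
        hence "l \<in> B" using l by (simp add: B_def)
        hence "\<not> Q dvd P ^ (n div l) - 1" using good[of l] Qm by (simp add: bad_def)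
        thus ?thesis using dvd1 by blast
      next
        case True
        \<comment> \<open>Now n/l is a multiple of the norm exponent, so the power depends only on
          the norm of P: it is \<open>\<gamma>\<close> to the power (q-1)/l.\<close>
        then obtain k where k: "?q - 1 = l * k" by (elim dvdE)
        have l1: "l > 1" by (rule prime_gt_1_nat[OF l(1)])
        have "n div l = rep_exp ?q m * k" unfolding nE k using l1 by (simp add: mult.left_commute[of _ l])
        hence "?y ^ (n div l) = to_ac (\<gamma> ^ k)" by (simp add: power_mult yE)
        moreover have "\<gamma> ^ k \<noteq> 1"
        proof
          assume "\<gamma> ^ k = 1"
          hence "?q - 1 dvd k" using generator_power_eq_1_iff[OF \<gamma>] by blast
          moreover have "k > 0" using k q2 by (auto intro: gr0I)
          ultimately have "?q - 1 \<le> k" by (rule dvd_imp_le)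
          thus False using k l1 \<open>k > 0\<close> by simp
        qed
        ultimately show ?thesis by (metis to_ac_1 to_ac_eq_iff)
      qed
    qed
    thus "?q ^ degree Q - 1 \<le> i" by (simp add: n_def Qm)
  qed
qed

section \<open>Carlitz polynomials\<close>

text \<open>The coefficient of X^(q^i) in the Carlitz polynomial of t^n; the recursion is
  composition with rho_t on the left.\<close>

primrec carlitz_coeff :: "nat \<Rightarrow> nat \<Rightarrow> 'a::{finite,field} poly" where
  "carlitz_coeff 0 i = (if i = 0 then 1 else 0)"
| "carlitz_coeff (Suc n) i = [:0, 1:] * carlitz_coeff n i + (if i = 0 then 0 else carlitz_coeff n (i - 1) ^ CARD('a))"

definition carlitz_poly_coeff :: "'a::{finite,field} poly \<Rightarrow> nat \<Rightarrow> 'a poly" where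
  "carlitz_poly_coeff M i = (\<Sum>n\<le>degree M. smult (coeff M n) (carlitz_coeff n i))"

text \<open>The Carlitz polynomial of \<open>M\<close> divided by \<open>X\<close>.\<close>

definition carlitz_Phi :: "'a::{finite,field} poly \<Rightarrow> 'a poly poly" where
  "carlitz_Phi M = (\<Sum>i\<le>degree M. monom (carlitz_poly_coeff M i) (CARD('a) ^ i - 1))"

lemma carlitz_coeff_gt: "i > n \<Longrightarrow> carlitz_coeff n i = 0"
  by (induction n arbitrary: i) auto

lemma carlitz_coeff_same: "carlitz_coeff n n = 1"
  by (induction n) (auto simp: carlitz_coeff_gt)

lemma carlitz_coeff_0: "carlitz_coeff n 0 = [:0, 1:] ^ n"
  by (induction n) auto

lemma carlitz_poly_coeff_0: "carlitz_poly_coeff M 0 = M"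
proof -
  have "carlitz_poly_coeff M 0 = (\<Sum>n\<le>degree M. monom (coeff M n) n)"
    unfolding carlitz_poly_coeff_def carlitz_coeff_0
    by (intro sum.cong refl) (metis monom_altdef)
  thus ?thesis by (simp add: poly_as_sum_of_monoms)
qed

lemma carlitz_poly_coeff_degree: "carlitz_poly_coeff M (degree M) = [:lead_coeff M:]"
proof -
  have "carlitz_poly_coeff M (degree M) = (\<Sum>n\<le>degree M. if n = degree M then [:lead_coeff M:] else 0)"
    unfolding carlitz_poly_coeff_def
    by (intro sum.cong refl) (auto simp: carlitz_coeff_same carlitz_coeff_gt one_pCons)
  thus ?thesis by simp
qed

lemma fq_algebra_poly: "fq_algebra (\<lambda>c::'a::{finite,field}. [:c:]) CARD('a)"
  by unfold_locales (auto simp: one_pCons)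

text \<open>Composition with rho_t on the right instead; that both recursions hold expresses that
  rho_t commutes with its iterates.\<close>

lemma carlitz_coeff_Suc':
  "carlitz_coeff (Suc n) i = [:0, 1:] ^ (CARD('a) ^ i) * carlitz_coeff n i + 
    (if i = 0 then 0 else carlitz_coeff n (i - 1) :: 'a::{finite,field} poly)"
proof (induction n arbitrary: i)
  case 0
  have "(0 :: 'a poly) ^ CARD('a) = 0" by simp
  thus ?case by (cases "i = 0") auto
next
  case (Suc n)
  interpret pa: fq_algebra "\<lambda>c::'a. [:c:]" "CARD('a)" by (rule fq_algebra_poly)
  let ?X = "[:0, 1:] :: 'a poly" and ?c = "carlitz_coeff :: nat \<Rightarrow> nat \<Rightarrow> 'a poly"
  show ?case
  proof (cases i)
    case 0
    thus ?thesis by (simp add: carlitz_coeff_0)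
  next
    case (Suc k)
    have "?c (Suc (Suc n)) i = ?X * ?c (Suc n) i + ?c (Suc n) k ^ CARD('a)" by (simp only: carlitz_coeff.simps(2)[of "Suc n"]) (simp add: Suc)
    also have "\<dots> = ?X * (?X ^ (CARD('a) ^ i) * ?c n i + ?c n k) + 
        (?X ^ (CARD('a) ^ k) * ?c n k + (if k = 0 then 0 else ?c n (k - 1))) ^ CARD('a)"
      unfolding Suc.IH[of i] Suc.IH[of k] using Suc by simp
    also have "\<dots> = ?X * (?X ^ (CARD('a) ^ i) * ?c n i + ?c n k) + 
        (?X ^ (CARD('a) ^ i) * ?c n k ^ CARD('a) + (if k = 0 then 0 else ?c n (k - 1) ^ CARD('a)))"
      by (simp add: pa.frob_add power_mult_distrib Suc mult.commute[of "CARD('a)"] flip: power_mult)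
    also have "\<dots> = ?X ^ (CARD('a) ^ i) * (?X * ?c n i + ?c n k ^ CARD('a)) + (?X * ?c n k + (if k = 0 then 0 else ?c n (k - 1) ^ CARD('a)))"
      by (simp only: distrib_left mult.left_commute add_ac)
    also have "\<dots> = ?X ^ (CARD('a) ^ i) * ?c (Suc n) i + ?c (Suc n) k" by (simp add: Suc)
    finally show ?thesis by (simp add: Suc)
  qed
qed

text \<open>This follows from comparing \<open>\<rho>\<^sub>t \<rho>\<^sub>M\<close> with \<open>\<rho>\<^sub>M \<rho>\<^sub>t\<close>.\<close>

lemma carlitz_poly_coeff_rel:
  fixes M :: "'a::{finite,field} poly"
  assumes "i > 0"
  shows "([:0, 1:] ^ (CARD('a) ^ i) - [:0, 1:]) * carlitz_poly_coeff M i 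
     = carlitz_poly_coeff M (i - 1) ^ CARD('a) - carlitz_poly_coeff M (i - 1)"
proof -
  interpret pa: fq_algebra "\<lambda>c::'a. [:c:]" "CARD('a)" by (rule fq_algebra_poly)
  let ?X = "[:0, 1:] :: 'a poly" and ?c = "carlitz_coeff :: nat \<Rightarrow> nat \<Rightarrow> 'a poly"
  have step: "(?X ^ (CARD('a) ^ i) - ?X) * ?c n i = ?c n (i - 1) ^ CARD('a) - ?c n (i - 1)" for n
  proof -
    have "?X ^ (CARD('a) ^ i) * ?c n i + (if i = 0 then 0 else ?c n (i - 1)) = ?X * ?c n i + (if i = 0 then 0 else ?c n (i - 1) ^ CARD('a))"
      by (rule trans[OF carlitz_coeff_Suc'[symmetric] carlitz_coeff.simps(2)])
    moreover have "i \<noteq> 0" using assms by simp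
    ultimately have "?X ^ (CARD('a) ^ i) * ?c n i + ?c n (i - 1) = ?X * ?c n i + ?c n (i - 1) ^ CARD('a)"
      by (simp only: if_False)
    moreover have "a + b = c + e \<Longrightarrow> a - c = e - b" for a b c e :: "'a poly" by (simp add: algebra_simps)
    ultimately show ?thesis unfolding left_diff_distrib by blast
  qed
  have "(?X ^ (CARD('a) ^ i) - ?X) * carlitz_poly_coeff M i = (\<Sum>n\<le>degree M. smult (coeff M n) ((?X ^ (CARD('a) ^ i) - ?X) * ?c n i))"
    unfolding carlitz_poly_coeff_def sum_distrib_left mult_smult_right ..
  also have "\<dots> = (\<Sum>n\<le>degree M. smult (coeff M n) (?c n (i - 1) ^ CARD('a)) - smult (coeff M n) (?c n (i - 1)))"
    unfolding step smult_diff_right ..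
  also have "\<dots> = (\<Sum>n\<le>degree M. smult (coeff M n) (?c n (i - 1)) ^ CARD('a)) - carlitz_poly_coeff M (i - 1)"
    unfolding sum_subtractf carlitz_poly_coeff_def by (simp add: smult_power field_power_card)
  also have "\<dots> = carlitz_poly_coeff M (i - 1) ^ CARD('a) - carlitz_poly_coeff M (i - 1)"
    unfolding carlitz_poly_coeff_def pa.frob_sum ..
  finally show ?thesis .
qed

text \<open>Translation by 1 permutes the field, so the sum of all elements is unchanged when q
  times 1 is added.\<close>

lemma of_nat_card_eq_0: "of_nat CARD('a) = (0 :: 'a::{finite,field})"
proof -
  have "(\<Sum>x\<in>(UNIV::'a set). x) = (\<Sum>x\<in>UNIV. x + 1)"
    by (rule sum.reindex_bij_witness[of _ "\<lambda>x. x + 1" "\<lambda>x. x - 1"]) auto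
  thus ?thesis by (simp add: sum.distrib)
qed

lemma pow_card_pos: "CARD('a::{finite,field}) ^ i > 0" by simp

lemma carlitz_Phi_monic:
  fixes M :: "'a::{finite,field} poly"
  assumes "lead_coeff M = 1"
  shows "degree (carlitz_Phi M) = CARD('a) ^ degree M - 1" "lead_coeff (carlitz_Phi M) = 1"
proof -
  let ?q = "CARD('a)" and ?m = "degree M"
  have inj: "?q ^ i - 1 = ?q ^ j - 1 \<longleftrightarrow> i = j" for i j
  proof -
    have "?q ^ i - 1 = ?q ^ j - 1 \<longleftrightarrow> ?q ^ i = ?q ^ j" using pow_card_pos[where 'a='a, of i] pow_card_pos[where 'a='a, of j] by linarith
    also have "\<dots> \<longleftrightarrow> i = j" using card_field_ge_2[where 'a='a] by (subst power_inject_exp) auto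
    finally show ?thesis .
  qed
  have c: "coeff (carlitz_Phi M) (?q ^ ?m - 1) = 1"
    unfolding carlitz_Phi_def coeff_sum coeff_monom inj
    using assms by (simp add: carlitz_poly_coeff_degree one_pCons)
  have "degree (carlitz_Phi M) \<le> ?q ^ ?m - 1"
    unfolding carlitz_Phi_def
  proof (intro degree_sum_le)
    fix i assume "i \<in> {..?m}"
    hence "?q ^ i \<le> ?q ^ ?m" by (intro power_increasing) auto
    thus "degree (monom (carlitz_poly_coeff M i) (?q ^ i - 1)) \<le> ?q ^ ?m - 1"
      by (intro order.trans[OF degree_monom_le]) simp
  qed simp
  moreover have "degree (carlitz_Phi M) \<ge> ?q ^ ?m - 1" using c by (intro le_degree) simp
  ultimately show "degree (carlitz_Phi M) = ?q ^ ?m - 1" by simp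
  thus "lead_coeff (carlitz_Phi M) = 1" using c by simp
qed

section \<open>The Carlitz action with t specialized to an arbitrary element\<close>

context fq_algebra
begin

text \<open>Iterates of rho_t with \<open>\<tau>\<close> in the place of t, from which
  \<open>car\<close> is built. At \<open>emb_t\<close> the result is \<open>carlitz\<close>; at a
  root of P it is the reduction of the Carlitz module modulo P.\<close>

primrec cit :: "'b \<Rightarrow> nat \<Rightarrow> 'b \<Rightarrow> 'b" where
  "cit \<tau> 0 x = x"
| "cit \<tau> (Suc n) x = \<tau> * cit \<tau> n x + (cit \<tau> n x) ^ q"

definition car :: "'b \<Rightarrow> 'a poly \<Rightarrow> 'b \<Rightarrow> 'b" where
  "car \<tau> M x = (\<Sum>i\<le>degree M. \<iota> (coeff M i) * cit \<tau> i x)"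

lemma cit_add: "cit \<tau> n (x + y) = cit \<tau> n x + cit \<tau> n y"
  by (induction n) (simp_all add: frob_add algebra_simps)

lemma car_add_arg: "car \<tau> M (x + y) = car \<tau> M x + car \<tau> M y"
  by (simp add: car_def cit_add algebra_simps sum.distrib)

lemma car_bound: "degree M \<le> N \<Longrightarrow> car \<tau> M x = (\<Sum>i\<le>N. \<iota> (coeff M i) * cit \<tau> i x)"
  unfolding car_def by (rule sum.mono_neutral_left) (auto simp: coeff_eq_0)

lemma car_add: "car \<tau> (A + B) x = car \<tau> A x + car \<tau> B x"
proof -
  let ?N = "max (degree A) (degree B)"
  have "degree (A + B) \<le> ?N" by (rule degree_add_le_max)
  thus ?thesis by (simp add: car_bound[of _ ?N] hom_add algebra_simps sum.distrib)
qed

lemma car_smult: "car \<tau> (smult c A) x = \<iota> c * car \<tau> A x"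
  using car_bound[of "smult c A" "degree A"] by (simp add: car_def hom_mult sum_distrib_left mult.assoc)

lemma car_0 [simp]: "car \<tau> 0 x = 0" by (simp add: car_def)

lemma car_const: "car \<tau> [:c:] x = \<iota> c * x" by (simp add: car_def)

lemma car_1 [simp]: "car \<tau> 1 x = x" using car_const[of \<tau> 1 x] by (simp add: one_pCons)

lemma car_pCons: "car \<tau> (pCons c A) x = \<iota> c * x + (\<tau> * car \<tau> A x + car \<tau> A x ^ q)"
proof -
  have "car \<tau> (pCons c A) x = (\<Sum>i\<le>Suc (degree A). \<iota> (coeff (pCons c A) i) * cit \<tau> i x)"
    by (rule car_bound) (rule degree_pCons_le)
  also have "\<dots> = \<iota> c * x + (\<Sum>i\<le>degree A. \<iota> (coeff A i) * (\<tau> * cit \<tau> i x + cit \<tau> i x ^ q))"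
    by (subst sum.atMost_Suc_shift) simp
  also have "(\<Sum>i\<le>degree A. \<iota> (coeff A i) * (\<tau> * cit \<tau> i x + cit \<tau> i x ^ q)) 
     = (\<tau> * car \<tau> A x + car \<tau> A x ^ q)"
    by (simp add: car_def frob_sum power_mult_distrib iota_pow_q sum_distrib_left algebra_simps sum.distrib)
  finally show ?thesis .
qed

lemma car_mult: "car \<tau> (A * B) x = car \<tau> A (car \<tau> B x)"
proof (induction A)
  case (pCons c A)
  have "car \<tau> (pCons c A * B) x = \<iota> c * car \<tau> B x + car \<tau> (pCons 0 (A * B)) x"
    by (simp add: car_add car_smult)
  also have "\<dots> = \<iota> c * car \<tau> B x + (\<tau> * car \<tau> A (car \<tau> B x) + car \<tau> A (car \<tau> B x) ^ q)"
    by (simp add: car_pCons pCons.IH)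
  also have "\<dots> = car \<tau> (pCons c A) (car \<tau> B x)" by (simp add: car_pCons)
  finally show ?case .
qed simp

lemma car_uminus: "car \<tau> (- A) x = - car \<tau> A x"
  using car_smult[of \<tau> "-1" A x] by (simp add: hom_uminus)

lemma car_diff: "car \<tau> (A - B) x = car \<tau> A x - car \<tau> B x"
  using car_add[of \<tau> A "- B" x] by (simp add: car_uminus)

lemma car_zero_arg [simp]: "car \<tau> M 0 = 0"
  using car_add_arg[of \<tau> M 0 0] by (metis add.right_neutral add_left_cancel)

lemma cit_expand: "cit \<tau> n x = (\<Sum>i\<le>n. ev \<tau> (carlitz_coeff n i) * x ^ (q ^ i))"
proof (induction n)
  case (Suc n)
  have "cit \<tau> (Suc n) x = (\<Sum>i\<le>n. \<tau> * ev \<tau> (carlitz_coeff n i) * x ^ (q ^ i)) + (\<Sum>i\<le>n. ev \<tau> (carlitz_coeff n i) ^ q * x ^ (q ^ Suc i))"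
    by (simp add: Suc frob_sum sum_distrib_left power_mult_distrib mult.assoc mult.commute[of q] flip: power_mult)
  also have "(\<Sum>i\<le>n. \<tau> * ev \<tau> (carlitz_coeff n i) * x ^ (q ^ i)) = (\<Sum>i\<le>Suc n. \<tau> * ev \<tau> (carlitz_coeff n i) * x ^ (q ^ i))"
    by (simp add: carlitz_coeff_gt)
  also have "(\<Sum>i\<le>n. ev \<tau> (carlitz_coeff n i) ^ q * x ^ (q ^ Suc i)) 
    = (\<Sum>i\<le>Suc n. (if i = 0 then 0 else ev \<tau> (carlitz_coeff n (i - 1)) ^ q) * x ^ (q ^ i))"
    by (subst sum.atMost_Suc_shift) simp
  finally have "cit \<tau> (Suc n) x = (\<Sum>i\<le>Suc n. \<tau> * ev \<tau> (carlitz_coeff n i) * x ^ (q ^ i)) +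
     (\<Sum>i\<le>Suc n. (if i = 0 then 0 else ev \<tau> (carlitz_coeff n (i - 1)) ^ q) * x ^ (q ^ i))" .
  moreover have "ev \<tau> (carlitz_coeff (Suc n) i) = \<tau> * ev \<tau> (carlitz_coeff n i) + (if i = 0 then 0 else ev \<tau> (carlitz_coeff n (i - 1)) ^ q)" for i
    by (simp only: carlitz_coeff.simps(2) ev_add ev_mult ev_X) (simp add: q_eq)
  ultimately show ?case by (simp only: sum.distrib[symmetric] distrib_right)
qed simp

lemma car_expand: "car \<tau> M x = (\<Sum>i\<le>degree M. ev \<tau> (carlitz_poly_coeff M i) * x ^ (q ^ i))"
proof -
  have ext: "cit \<tau> n x = (\<Sum>i\<le>degree M. ev \<tau> (carlitz_coeff n i) * x ^ (q ^ i))" if "n \<le> degree M" for n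
    unfolding cit_expand by (rule sum.mono_neutral_left) (use that in \<open>auto simp: carlitz_coeff_gt\<close>)
  have sm: "ev \<tau> (smult c p) = \<iota> c * ev \<tau> p" for c p using ev_mult[of \<tau> "[:c:]" p] by simp
  have "car \<tau> M x = (\<Sum>n\<le>degree M. \<Sum>i\<le>degree M. \<iota> (coeff M n) * (ev \<tau> (carlitz_coeff n i) * x ^ (q ^ i)))"
    unfolding car_def by (intro sum.cong refl) (simp add: ext sum_distrib_left)
  also have "\<dots> = (\<Sum>i\<le>degree M. \<Sum>n\<le>degree M. \<iota> (coeff M n) * (ev \<tau> (carlitz_coeff n i) * x ^ (q ^ i)))"
    by (rule sum.swap)
  also have "\<dots> = (\<Sum>i\<le>degree M. ev \<tau> (carlitz_poly_coeff M i) * x ^ (q ^ i))"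
    by (simp add: carlitz_poly_coeff_def ev_sum sm sum_distrib_right mult.assoc)
  finally show ?thesis .
qed

abbreviation red :: "'b \<Rightarrow> 'a poly poly \<Rightarrow> 'b poly" where "red \<tau> f \<equiv> map_poly (ev \<tau>) f"

lemma red_hom: "map_poly_comm_ring_hom (ev \<tau>)"
  using ev_hom by (simp add: map_poly_comm_ring_hom_def)

lemma red_add [simp]: "red \<tau> (f + g) = red \<tau> f + red \<tau> g"
  and red_mult [simp]: "red \<tau> (f * g) = red \<tau> f * red \<tau> g"
  and red_diff [simp]: "red \<tau> (f - g) = red \<tau> f - red \<tau> g"
  and red_pow [simp]: "red \<tau> (f ^ n) = red \<tau> f ^ n"
  and red_sum: "red \<tau> (\<Sum>i\<in>I. F i) = (\<Sum>i\<in>I. red \<tau> (F i))"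
proof -
  interpret r: map_poly_comm_ring_hom "ev \<tau>" by (rule red_hom)
  show "red \<tau> (f + g) = red \<tau> f + red \<tau> g" "red \<tau> (f * g) = red \<tau> f * red \<tau> g"
    "red \<tau> (f - g) = red \<tau> f - red \<tau> g" "red \<tau> (f ^ n) = red \<tau> f ^ n"
    "red \<tau> (\<Sum>i\<in>I. F i) = (\<Sum>i\<in>I. red \<tau> (F i))"
    by (simp_all only: r.hom_add r.hom_mult r.hom_minus r.hom_power r.hom_sum)
qed

lemma red_smult [simp]: "red \<tau> (smult c f) = smult (ev \<tau> c) (red \<tau> f)"
  by (rule poly_eqI) (simp add: coeff_map_poly)

lemma poly_red_Phi: "poly (red \<tau> (carlitz_Phi M)) x * x = car \<tau> M x"
proof -
  have e: "x ^ (q ^ i - 1) * x = x ^ (q ^ i)" for i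
    using q_pos by (metis Suc_diff_1 power_Suc2 zero_less_power)
  have "poly (red \<tau> (carlitz_Phi M)) x * x = (\<Sum>i\<le>degree M. ev \<tau> (carlitz_poly_coeff M i) * (x ^ (q ^ i - 1) * x))"
    by (simp add: carlitz_Phi_def red_sum map_poly_monom poly_sum poly_monom sum_distrib_right q_eq mult.assoc)
  also have "\<dots> = car \<tau> M x" by (simp only: e car_expand)
  finally show ?thesis .
qed

lemma poly_red_Phi_0: "poly (red \<tau> (carlitz_Phi M)) 0 = ev \<tau> M"
proof -
  have z: "(0::'b) ^ (CARD('a) ^ i - Suc 0) = (if i = 0 then 1 else 0)" for i
  proof (cases "i = 0")
    case False
    have "CARD('a) ^ i \<ge> CARD('a) ^ 1" using False by (intro power_increasing) auto
    hence "CARD('a) ^ i - 1 > 0" using q_ge_2 q_eq by simp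
    thus ?thesis using False by simp
  qed simp
  have "poly (red \<tau> (carlitz_Phi M)) 0 = (\<Sum>i\<le>degree M. ev \<tau> (carlitz_poly_coeff M i) * (if i = 0 then 1 else 0))"
    by (simp add: carlitz_Phi_def red_sum map_poly_monom poly_sum poly_monom z)
  also have "\<dots> = ev \<tau> M" by (simp add: sum.delta carlitz_poly_coeff_0 if_distrib[of "\<lambda>x. _ * x"] cong: if_cong)
  finally show ?thesis .
qed

lemma red_Phi_monic:
  assumes "lead_coeff M = 1"
  shows "degree (red \<tau> (carlitz_Phi M)) = q ^ degree M - 1" "lead_coeff (red \<tau> (carlitz_Phi M)) = 1"
proof -
  have c: "coeff (red \<tau> (carlitz_Phi M)) (q ^ degree M - 1) = 1"
    using carlitz_Phi_monic[OF assms] by (simp add: coeff_map_poly q_eq)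
  have "degree (red \<tau> (carlitz_Phi M)) \<le> q ^ degree M - 1"
    using map_poly_degree_leq[of "ev \<tau>" "carlitz_Phi M"] carlitz_Phi_monic(1)[OF assms] by (simp add: q_eq)
  moreover have "degree (red \<tau> (carlitz_Phi M)) \<ge> q ^ degree M - 1" using c by (intro le_degree) simp
  ultimately show "degree (red \<tau> (carlitz_Phi M)) = q ^ degree M - 1" by simp
  thus "lead_coeff (red \<tau> (carlitz_Phi M)) = 1" using c by simp
qed

lemma of_nat_q [simp]: "of_nat q = (0 :: 'b)"
proof -
  have "of_nat q = \<iota> (of_nat q)" by (simp add: hom_distribs)
  thus ?thesis using of_nat_card_eq_0[where 'a='a] by (simp add: q_eq)
qed

text \<open>Only the linear term of the additive Carlitz polynomial survives differentiation.\<close>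

lemma Phi_pderiv: 
  "poly (red \<tau> (carlitz_Phi M)) x + x * poly (pderiv (red \<tau> (carlitz_Phi M))) x = ev \<tau> M"
proof -
  let ?F = "red \<tau> (carlitz_Phi M)"
  have F: "pCons 0 ?F = (\<Sum>i\<le>degree M. monom (ev \<tau> (carlitz_poly_coeff M i)) (q ^ i))"
  proof -
    have "pCons 0 ?F = monom 1 1 * ?F" by (simp add: monom_altdef)
    also have "\<dots> = (\<Sum>i\<le>degree M. monom 1 1 * monom (ev \<tau> (carlitz_poly_coeff M i)) (q ^ i - 1))"
      by (simp add: carlitz_Phi_def red_sum map_poly_monom q_eq sum_distrib_left)
    also have "\<dots> = (\<Sum>i\<le>degree M. monom (ev \<tau> (carlitz_poly_coeff M i)) (q ^ i))"
      by (intro sum.cong refl) (simp add: mult_monom)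
    finally show ?thesis .
  qed
  have "poly ?F x + x * poly (pderiv ?F) x = poly (pderiv (pCons 0 ?F)) x" by (simp add: pderiv_pCons)
  also have "\<dots> = (\<Sum>i\<le>degree M. poly (pderiv (monom (ev \<tau> (carlitz_poly_coeff M i)) (q ^ i))) x)"
    unfolding F by (simp add: pderiv_sum poly_sum)
  also have "\<dots> = (\<Sum>i\<le>degree M. if i = 0 then ev \<tau> M else 0)"
    by (intro sum.cong refl) (auto simp: pderiv_monom poly_monom carlitz_poly_coeff_0)
  finally show ?thesis by simp
qed

lemma car_torsion_annihilator:
  assumes M: "irreducible M" and \<mu>: "car \<tau> M \<mu> = 0" "\<mu> \<noteq> 0"
  shows "car \<tau> A \<mu> = 0 \<longleftrightarrow> M dvd A"
proof
  assume "M dvd A"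
  then obtain B where "A = M * B" by (elim dvdE)
  hence "A = B * M" by (simp only: mult.commute)
  thus "car \<tau> A \<mu> = 0" using \<mu> by (simp add: car_mult)
next
  assume A: "car \<tau> A \<mu> = 0"
  show "M dvd A"
  proof (rule ccontr)
    assume "\<not> M dvd A"
    then obtain u v where "u * A + v * M = 1" by (rule irreducible_bezout[OF M])
    hence "car \<tau> (u * A + v * M) \<mu> = \<mu>" by simp
    thus False using A \<mu> by (simp add: car_add car_mult)
  qed
qed

text \<open>The q^m multiples of one nonzero torsion point are distinct, because M generates its
  annihilator, and the Carlitz polynomial of M has at most q^m roots.\<close>

lemma car_torsion_eq:
  assumes M: "irreducible M" "lead_coeff M = 1" and \<mu>: "car \<tau> M \<mu> = 0" "\<mu> \<noteq> 0"
  shows "{x. car \<tau> M x = 0} = (\<lambda>A. car \<tau> A \<mu>) ` {A. degree A < degree M}"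
proof -
  have m: "degree M > 0" using M(1) by (rule irreducible_poly_degree_pos)
  let ?D = "{A :: 'a poly. degree A < degree M}"
  have cD: "card ?D = q ^ degree M" "finite ?D" using card_polys_degree_less[OF m, where 'a='a] by (simp_all add: q_eq)
  have inj: "inj_on (\<lambda>A. car \<tau> A \<mu>) ?D"
  proof (rule inj_onI)
    fix A B assume AB: "A \<in> ?D" "B \<in> ?D" "car \<tau> A \<mu> = car \<tau> B \<mu>"
    hence "car \<tau> (A - B) \<mu> = 0" by (simp add: car_diff)
    hence "M dvd A - B" using car_torsion_annihilator[OF M(1) \<mu>] by blast
    moreover have "degree (A - B) < degree M" using AB by (simp add: degree_diff_less)
    ultimately show "A = B" by (metis dvd_imp_degree_le eq_iff_diff_eq_0 not_less)
  qed
  let ?G = "pCons 0 (red \<tau> (carlitz_Phi M))"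
  have G: "poly ?G x = car \<tau> M x" for x using poly_red_Phi[of \<tau> M x] by (simp add: mult.commute)
  have "red \<tau> (carlitz_Phi M) \<noteq> 0" using red_Phi_monic(2)[OF M(2)] by (metis leading_coeff_0_iff zero_neq_one)
  hence G0: "?G \<noteq> 0" and dG: "degree ?G = q ^ degree M"
    using red_Phi_monic(1)[OF M(2), of \<tau>] q_pos by (auto simp: degree_pCons_eq)
  have fin: "finite {x. car \<tau> M x = 0}" using poly_roots_finite[OF G0] by (simp only: G)
  have le: "card {x. car \<tau> M x = 0} \<le> q ^ degree M" using card_poly_roots_bound[OF G0] by (simp only: G dG)
  have sub: "(\<lambda>A. car \<tau> A \<mu>) ` ?D \<subseteq> {x. car \<tau> M x = 0}"
    using \<mu> by (auto simp flip: car_mult) (simp add: car_mult mult.commute[of M])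
  have "card ((\<lambda>A. car \<tau> A \<mu>) ` ?D) = q ^ degree M" using inj cD by (simp add: card_image)
  hence "(\<lambda>A. car \<tau> A \<mu>) ` ?D = {x. car \<tau> M x = 0}"
    using fin sub le card_mono[OF fin sub] by (intro card_subset_eq) auto
  thus ?thesis ..
qed

text \<open>Let b be the root \<open>\<beta>\<close>. The coefficients c_i of rho_P modulo P satisfy
  (b^(q^i) - b) c_i = c_(i-1)^q - c_(i-1). As c_0 = P(b) = 0 and the factor on the left is nonzero
  for 0 < i < deg P, only the leading coefficient survives.\<close>

lemma car_prime_frobenius:
  assumes P: "irreducible P" "lead_coeff P = 1" "ev \<beta> P = 0"
  shows "car \<beta> P x = x ^ (q ^ degree P)"
proof -
  let ?d = "degree P"
  have z: "i < ?d \<longrightarrow> ev \<beta> (carlitz_poly_coeff P i) = 0" for i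
  proof (induction i)
    case 0
    show ?case using P by (simp add: carlitz_poly_coeff_0)
  next
    case (Suc i)
    show ?case
    proof
      assume i: "Suc i < ?d"
      have "ev \<beta> (([:0, 1:] ^ (q ^ Suc i) - [:0, 1:]) * carlitz_poly_coeff P (Suc i)) 
          = ev \<beta> (carlitz_poly_coeff P i ^ q - carlitz_poly_coeff P i)"
        using carlitz_poly_coeff_rel[of "Suc i" P] by (simp add: q_eq)
      hence "(\<beta> ^ (q ^ Suc i) - \<beta>) * ev \<beta> (carlitz_poly_coeff P (Suc i)) = 0"
        using Suc i by (simp only: ev_mult ev_diff ev_pow ev_X) (simp add: zero_power)
      moreover have "\<beta> ^ (q ^ Suc i) \<noteq> \<beta>" using frob_ne[OF P(1,3), of "Suc i"] i by simp
      ultimately show "ev \<beta> (carlitz_poly_coeff P (Suc i)) = 0" by simp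
    qed
  qed
  have "car \<beta> P x = (\<Sum>i\<le>?d. if i = ?d then x ^ (q ^ ?d) else 0)"
    unfolding car_expand
    by (intro sum.cong refl) (use z P(2) in \<open>auto simp: carlitz_poly_coeff_degree\<close>)
  thus ?thesis by simp
qed

text \<open>Modulo \<open>P\<close> the Frobenius acts on the \<open>M\<close>-torsion as \<open>\<rho>\<^sub>P\<close>; if \<open>P\<close> is a primitive root modulo \<open>M\<close>, all
  nonzero torsion points are conjugate.\<close>

lemma degree_ge_of_root_mod_prime:
  assumes P: "irreducible P" "lead_coeff P = 1" "ev \<beta> P = 0"
    and M: "irreducible M" "\<not> M dvd P"
    and prim: "\<And>i. i > 0 \<Longrightarrow> M dvd P ^ i - 1 \<Longrightarrow> n \<le> i"
    and \<mu>: "car \<beta> M \<mu> = 0" "\<mu> \<noteq> 0" and f: "poly (red \<beta> f) \<mu> = 0" "red \<beta> f \<noteq> 0"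
  shows "n \<le> degree (red \<beta> f)"
proof -
  let ?d = "degree P"
  have it: "car \<beta> (P ^ i) \<mu> = \<mu> ^ (q ^ (?d * i))" for i
    by (induction i) (simp_all add: car_mult car_prime_frobenius[OF P] power_add power_mult mult.commute[of "q ^ ?d"])
  \<comment> \<open>The coefficients of the reduced f are fixed by the q^d-power map, so this map
    carries roots to roots.\<close>
  have root: "poly (red \<beta> f) (car \<beta> (P ^ i) \<mu>) = 0" for i
  proof -
    have c: "ev \<beta> c ^ (q ^ (?d * i)) = ev \<beta> c" for c
      by (induction i) (simp_all add: power_add power_mult ev_frob_period[OF P(1,3)])
    have sw: "(\<mu> ^ a) ^ b = (\<mu> ^ b) ^ a" for a b by (metis power_mult mult.commute)
    have "poly (red \<beta> f) \<mu> ^ (q ^ (?d * i)) = poly (red \<beta> f) (\<mu> ^ (q ^ (?d * i)))"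
      unfolding poly_altdef frobi_sum by (intro sum.cong refl) 
        (simp add: power_mult_distrib coeff_map_poly c sw[of _ "q ^ (?d * i)"])
    thus ?thesis using f(1) unfolding it by (simp add: zero_power)
  qed
  have inj: "inj_on (\<lambda>i. car \<beta> (P ^ i) \<mu>) {..<n}"
  proof (rule linorder_inj_onI)
    fix i j assume ij: "i < j" "i \<in> {..<n}" "j \<in> {..<n}"
    show "car \<beta> (P ^ i) \<mu> \<noteq> car \<beta> (P ^ j) \<mu>"
    proof
      assume "car \<beta> (P ^ i) \<mu> = car \<beta> (P ^ j) \<mu>"
      hence "car \<beta> (P ^ j - P ^ i) \<mu> = 0" by (simp add: car_diff)
      hence "M dvd P ^ j - P ^ i" using car_torsion_annihilator[OF M(1) \<mu>] by blast
      also have "P ^ j - P ^ i = P ^ i * (P ^ (j - i) - 1)"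
        using ij by (simp add: algebra_simps flip: power_add)
      finally have "M dvd P ^ (j - i) - 1"
        using M irreducible_dvd_mult_iff irreducible_dvd_power by blast
      thus False using prim[of "j - i"] ij by simp
    qed
  qed auto
  have "n = card ((\<lambda>i. car \<beta> (P ^ i) \<mu>) ` {..<n})" using inj by (simp add: card_image)
  also have "\<dots> \<le> degree (red \<beta> f)" by (rule card_roots_le[OF f(2)]) (use root in auto)
  finally show ?thesis .
qed

end

section \<open>Integral elements\<close>

lemma to_fract_power: "to_fract (x ^ n) = to_fract x ^ n"
  by (induction n) auto

lemma emb_add [simp]: "emb (x + y) = emb x + emb y"
  and emb_mult [simp]: "emb (x * y) = emb x * emb y"
  and emb_diff [simp]: "emb (x - y) = emb x - emb y"
  and emb_minus [simp]: "emb (- x) = - emb x"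
  and emb_0 [simp]: "emb 0 = 0" and emb_1 [simp]: "emb 1 = 1"
  and emb_power [simp]: "emb (x ^ n) = emb x ^ n"
  and emb_eq_iff [simp]: "emb x = emb y \<longleftrightarrow> x = y"
  and emb_eq_0_iff [simp]: "emb x = 0 \<longleftrightarrow> x = 0"
  by (simp_all add: emb_def to_fract_power)

lemma emb_inj_hom: "inj_idom_hom (emb :: 'a::{finite,field} poly \<Rightarrow> 'a clos)"
  by unfold_locales auto

interpretation emb: inj_idom_hom "emb :: 'a::{finite,field} poly \<Rightarrow> 'a clos" by (rule emb_inj_hom)
interpretation embp: map_poly_inj_idom_hom "emb :: 'a::{finite,field} poly \<Rightarrow> 'a clos" ..

lemma emb_pCons: "map_poly emb (pCons a p) = pCons (emb a) (map_poly emb p)"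
  by (rule poly_eqI) (simp add: coeff_map_poly coeff_pCons split: nat.splits)

interpretation cl: fq_algebra "\<lambda>c::'a::{finite,field}. emb [:c:]" "CARD('a)"
proof unfold_locales
  fix x y :: 'a
  show "emb [:x + y:] = emb [:x:] + emb [:y:]" by (simp flip: emb_add)
  show "emb [:x * y:] = emb [:x:] * emb [:y:]" by (simp flip: emb_mult)
qed (auto simp: one_pCons[symmetric])

abbreviation emb_t :: "'a::{finite,field} clos" where "emb_t \<equiv> emb [:0, 1:]"

lemma cl_ev: "cl.ev emb_t p = emb p"
proof (induction p)
  case (pCons a p)
  have "pCons a p = [:a:] + [:0, 1:] * p" by simp
  thus ?case using pCons by (simp only: cl.ev_add cl.ev_mult cl.ev_const cl.ev_X emb_add emb_mult)
qed simp

lemma cl_ev_fun: "cl.ev emb_t = emb" by (rule ext) (rule cl_ev)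

lemma carlitz_iter_eq: "carlitz_iter n x = cl.cit emb_t n x"
  by (induction n) simp_all

lemma carlitz_eq: "carlitz M x = cl.car emb_t M x"
  by (simp add: carlitz_def cl.car_def carlitz_iter_eq)

definition integral_elem :: "'a::{finite,field} clos \<Rightarrow> bool" where
  "integral_elem x \<longleftrightarrow> (\<exists>p :: 'a poly poly. lead_coeff p = 1 \<and> poly (map_poly emb p) x = 0)"

lemma int_closure_altdef: "int_closure K = {x \<in> K. integral_elem x}"
  by (simp add: int_closure_def integral_elem_def)

text \<open>Cayley--Hamilton: \<open>x\<close> is a root of the characteristic polynomial of its multiplication matrix.\<close>

lemma integral_elem_matrix:
  fixes v :: "nat \<Rightarrow> 'a::{finite,field} clos"
  assumes eq: "\<And>i. i < n \<Longrightarrow> x * v i = (\<Sum>j<n. emb (A i j) * v j)" and nz: "i0 < n" "v i0 \<noteq> 0"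
  shows "integral_elem x"
proof -
  let ?A = "mat n n (\<lambda>(i,j). A i j)"
  let ?B = "map_mat emb ?A" and ?v = "vec n v"
  have A: "?A \<in> carrier_mat n n" and B: "?B \<in> carrier_mat n n" by auto
  have "?B *\<^sub>v ?v = x \<cdot>\<^sub>v ?v"
  proof (rule eq_vecI)
    fix i assume "i < dim_vec (x \<cdot>\<^sub>v ?v)"
    hence i: "i < n" by simp
    show "vec_index (?B *\<^sub>v ?v) i = vec_index (x \<cdot>\<^sub>v ?v) i"
      using i by (simp add: scalar_prod_def eq atLeast0LessThan)
  qed simp
  moreover have "?v \<noteq> 0\<^sub>v n" using nz by (metis index_vec index_zero_vec(1))
  ultimately have "eigenvector ?B ?v x" by (simp add: eigenvector_def)
  hence "eigenvalue ?B x" unfolding eigenvalue_def by blast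
  hence "poly (char_poly ?B) x = 0" using eigenvalue_root_char_poly[OF B] by blast
  hence "poly (map_poly emb (char_poly ?A)) x = 0" using emb.char_poly_hom[OF A] by simp
  moreover have "lead_coeff (char_poly ?A) = 1" using degree_monic_char_poly[OF A] by simp
  ultimately show ?thesis unfolding integral_elem_def by blast
qed

section \<open>Integrality through stable finitely generated modules\<close>

definition emb_span :: "'i set \<Rightarrow> ('i \<Rightarrow> 'a::{finite,field} clos) \<Rightarrow> 'a clos set" where
  "emb_span I v = {\<Sum>i\<in>I. emb (c i) * v i | c. True}"

lemma emb_spanI: "(\<Sum>i\<in>I. emb (c i) * v i) \<in> emb_span I v"
  unfolding emb_span_def by blast

lemma emb_span_add: "x \<in> emb_span I v \<Longrightarrow> y \<in> emb_span I v \<Longrightarrow> x + y \<in> emb_span I v"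
proof -
  assume "x \<in> emb_span I v" "y \<in> emb_span I v"
  then obtain c c' where "x = (\<Sum>i\<in>I. emb (c i) * v i)" "y = (\<Sum>i\<in>I. emb (c' i) * v i)"
    by (auto simp: emb_span_def)
  hence "x + y = (\<Sum>i\<in>I. emb (c i + c' i) * v i)" by (simp add: sum.distrib distrib_right)
  thus ?thesis by (simp only: emb_spanI)
qed

lemma emb_span_scale: "x \<in> emb_span I v \<Longrightarrow> emb a * x \<in> emb_span I v"
proof -
  assume "x \<in> emb_span I v"
  then obtain c where "x = (\<Sum>i\<in>I. emb (c i) * v i)" by (auto simp: emb_span_def)
  hence "emb a * x = (\<Sum>i\<in>I. emb (a * c i) * v i)" by (simp add: sum_distrib_left mult.assoc)
  thus ?thesis by (simp only: emb_spanI)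
qed

lemma emb_span_0: "0 \<in> emb_span I v"
  using emb_spanI[of "\<lambda>_. 0" v I] by simp

lemma emb_span_sum: "(\<And>j. j \<in> J \<Longrightarrow> f j \<in> emb_span I v) \<Longrightarrow> (\<Sum>j\<in>J. f j) \<in> emb_span I v"
  by (induction J rule: infinite_finite_induct) (auto intro: emb_span_add emb_span_0)

lemma emb_span_base: "finite I \<Longrightarrow> i \<in> I \<Longrightarrow> v i \<in> emb_span I v"
proof -
  assume I: "finite I" "i \<in> I"
  have "v i = (\<Sum>j\<in>I. emb (if j = i then 1 else 0) * v j)"
  proof -
    have "(\<Sum>j\<in>I. emb (if j = i then 1 else 0) * v j) = (\<Sum>j\<in>I. if j = i then v j else 0)"
      by (intro sum.cong) auto
    thus ?thesis using I by simp
  qed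
  thus ?thesis using emb_spanI[of "\<lambda>j. if j = i then 1 else 0" v I] by (simp only:)
qed

lemma integral_elem_span:
  fixes v :: "'i \<Rightarrow> 'a::{finite,field} clos"
  assumes fin: "finite I" and st: "\<And>i. i \<in> I \<Longrightarrow> x * v i \<in> emb_span I v" and nz: "i0 \<in> I" "v i0 \<noteq> 0"
  shows "integral_elem x"
proof -
  obtain e n where e: "bij_betw e {..<n::nat} I"
    using ex_bij_betw_nat_finite[OF fin] by (auto simp: atLeast0LessThan)
  have "\<exists>c. x * v i = (\<Sum>j\<in>I. emb (c j) * v j)" if "i \<in> I" for i
    using st[OF that] by (auto simp: emb_span_def)
  then obtain c where c: "\<And>i. i \<in> I \<Longrightarrow> x * v i = (\<Sum>j\<in>I. emb (c i j) * v j)" by metis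
  obtain k where k: "k < n" "e k = i0" using e nz(1) by (auto simp: bij_betw_def)
  show ?thesis
  proof (rule integral_elem_matrix[of n x "v \<circ> e" "\<lambda>i j. c (e i) (e j)"])
    fix i assume "i < n"
    hence "e i \<in> I" using e by (auto simp: bij_betw_def)
    from c[OF this] show "x * (v \<circ> e) i = (\<Sum>j<n. emb (c (e i) (e j)) * (v \<circ> e) j)"
      using sum.reindex_bij_betw[OF e, of "\<lambda>j. emb (c (e i) j) * v j"] by simp
  qed (use k nz in auto)
qed

lemma integral_elem_power_eq:
  assumes "integral_elem x"
  obtains a c where "a > 0" "x ^ a = (\<Sum>k<a. emb (c k) * x ^ k)"
proof -
  obtain p where p: "lead_coeff p = 1" "poly (map_poly emb p) x = 0" using assms by (auto simp: integral_elem_def)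
  have a0: "degree p > 0"
  proof (rule ccontr)
    assume "\<not> degree p > 0"
    then obtain c where "p = [:c:]" by (auto elim: degree_eq_zeroE)
    thus False using p by (simp add: emb_pCons)
  qed
  have "0 = (\<Sum>k\<le>degree p. emb (coeff p k) * x ^ k)" using p(2) by (simp add: poly_altdef)
  also have "\<dots> = (\<Sum>k<degree p. emb (coeff p k) * x ^ k) + x ^ degree p"
    using p(1) by (simp add: lessThan_Suc_atMost[symmetric])
  finally have "x ^ degree p = - (\<Sum>k<degree p. emb (coeff p k) * x ^ k)" by (simp add: add_eq_0_iff)
  hence "x ^ degree p = (\<Sum>k<degree p. emb (- coeff p k) * x ^ k)" by (simp add: sum_negf)
  thus ?thesis by (rule that[OF a0])
qed

text \<open>The products x^i y^j with exponents below the degrees of the two integral equations span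
  a module that x and y map into itself.\<close>

lemma integral_elem_add_mult:
  assumes x: "integral_elem x" and y: "integral_elem y"
  shows "integral_elem (x + y)" "integral_elem (x * y)"
proof -
  obtain a c where a: "a > 0" "x ^ a = (\<Sum>k<a. emb (c k) * x ^ k)" by (rule integral_elem_power_eq[OF x])
  obtain b e where b: "b > 0" "y ^ b = (\<Sum>k<b. emb (e k) * y ^ k)" by (rule integral_elem_power_eq[OF y])
  let ?I = "{..<a} \<times> {..<b}" and ?v = "\<lambda>(i,j). x ^ i * y ^ j"
  have base: "x ^ i * y ^ j \<in> emb_span ?I ?v" if "i < a" "j < b" for i j
    using emb_span_base[of ?I "(i,j)" ?v] that by simp
  have xm: "x * (x ^ i * y ^ j) \<in> emb_span ?I ?v" if ij: "i < a" "j < b" for i j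
  proof (cases "Suc i < a")
    case True
    thus ?thesis using base[of "Suc i" j] ij by (simp add: mult.assoc)
  next
    case False
    hence "Suc i = a" using ij by simp
    hence "x * (x ^ i * y ^ j) = x ^ a * y ^ j" by (metis mult.assoc power_Suc)
    also have "\<dots> = (\<Sum>k<a. emb (c k) * (x ^ k * y ^ j))" unfolding a(2) by (simp add: sum_distrib_right mult.assoc)
    also have "\<dots> \<in> emb_span ?I ?v" by (intro emb_span_sum emb_span_scale base) (use ij in auto)
    finally show ?thesis .
  qed
  have ym: "y * (x ^ i * y ^ j) \<in> emb_span ?I ?v" if ij: "i < a" "j < b" for i j
  proof (cases "Suc j < b")
    case True
    thus ?thesis using base[of i "Suc j"] ij by (simp add: mult.left_commute)
  next
    case False
    hence "Suc j = b" using ij by simp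
    hence "y * (x ^ i * y ^ j) = x ^ i * y ^ b" by (metis mult.left_commute power_Suc)
    also have "\<dots> = (\<Sum>k<b. emb (e k) * (x ^ i * y ^ k))" unfolding b(2) by (simp add: sum_distrib_left mult.left_commute)
    also have "\<dots> \<in> emb_span ?I ?v" by (intro emb_span_sum emb_span_scale base) (use ij in auto)
    finally show ?thesis .
  qed
  have xs: "x * z \<in> emb_span ?I ?v" if "z \<in> emb_span ?I ?v" for z
  proof -
    from that obtain f where z: "z = (\<Sum>i\<in>?I. emb (f i) * ?v i)" by (auto simp: emb_span_def)
    have "x * z = (\<Sum>i\<in>?I. emb (f i) * (x * ?v i))" unfolding z by (simp add: sum_distrib_left mult.left_commute)
    also have "\<dots> \<in> emb_span ?I ?v" by (intro emb_span_sum emb_span_scale) (auto intro: xm)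
    finally show ?thesis .
  qed
  show "integral_elem (x + y)"
  proof (rule integral_elem_span[of ?I _ ?v "(0,0)"])
    fix i assume "i \<in> ?I"
    thus "(x + y) * ?v i \<in> emb_span ?I ?v" by (auto simp: distrib_right intro: emb_span_add xm ym)
  qed (use a b in auto)
  show "integral_elem (x * y)"
  proof (rule integral_elem_span[of ?I _ ?v "(0,0)"])
    fix i assume "i \<in> ?I"
    hence "x * (y * ?v i) \<in> emb_span ?I ?v" by (intro xs) (auto intro: ym)
    thus "(x * y) * ?v i \<in> emb_span ?I ?v" by (simp add: mult.assoc)
  qed (use a b in auto)
qed

lemma integral_elem_emb [simp]: "integral_elem (emb a)"
  unfolding integral_elem_def by (intro exI[of _ "[:- a, 1:]"]) (simp add: emb_pCons)

lemma integral_elem_1 [simp]: "integral_elem 1" using integral_elem_emb[of 1] by simp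
lemma integral_elem_0 [simp]: "integral_elem 0" using integral_elem_emb[of 0] by simp

lemma integral_elem_minus: "integral_elem x \<Longrightarrow> integral_elem (- x)"
  using integral_elem_add_mult(2)[OF integral_elem_emb[of "- 1"], of x] by simp

lemma integral_elem_sum: "(\<And>i. i \<in> I \<Longrightarrow> integral_elem (f i)) \<Longrightarrow> integral_elem (\<Sum>i\<in>I. f i)"
  by (induction I rule: infinite_finite_induct) (auto intro: integral_elem_add_mult)

lemma integral_elem_prod: "(\<And>i. i \<in> I \<Longrightarrow> integral_elem (f i)) \<Longrightarrow> integral_elem (\<Prod>i\<in>I. f i)"
  by (induction I rule: infinite_finite_induct) (auto intro: integral_elem_add_mult)

lemma integral_elem_power: "integral_elem x \<Longrightarrow> integral_elem (x ^ n)"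
  by (induction n) (auto intro: integral_elem_add_mult)

lemma integral_elem_poly:
  "integral_elem x \<Longrightarrow> integral_elem (poly (map_poly emb f) x)"
  unfolding poly_altdef by (intro integral_elem_sum integral_elem_add_mult integral_elem_power) auto

lemma integral_elem_of_int: "integral_elem (of_int k)"
proof -
  have nat: "emb (of_nat n) = of_nat n" for n by (induction n) simp_all
  have "emb (of_int k) = of_int k" by (cases k rule: int_cases2) (simp_all add: nat)
  thus ?thesis by (metis integral_elem_emb)
qed

lemma integral_elem_det:
  assumes A: "A \<in> carrier_mat n n" and "\<And>i j. i < n \<Longrightarrow> j < n \<Longrightarrow> integral_elem (A $$ (i,j))"
  shows "integral_elem (det A)"
  unfolding det_def'[OF A]
  by (intro integral_elem_sum integral_elem_add_mult integral_elem_of_int integral_elem_prod)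
    (auto intro!: assms dest: permutes_in_image)

lemma fract_denominator:
  obtains a b where "b \<noteq> 0" "to_fract b * y = to_fract a"
proof -
  obtain a b where "y = Fract a b" "b \<noteq> 0" by (cases y) auto
  hence "to_fract b * y = to_fract a" by (simp add: Fract_conv_to_fract)
  thus ?thesis using that \<open>b \<noteq> 0\<close> by blast
qed

text \<open>F_q[t] is integrally closed: a prime factor Q of a denominator of least degree would, by
  the cleared integral equation, divide a power of the numerator a, hence a, and could be
  cancelled.\<close>

lemma integral_fract:
  assumes "integral_elem (to_ac y :: 'a::{finite,field} clos)"
  obtains p where "y = to_fract p"
proof -
  let ?S = "\<lambda>b. b \<noteq> 0 \<and> (\<exists>a. to_fract b * y = to_fract a)"
  obtain b0 where "?S b0" using fract_denominator[of y] by metis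
  define b where "b = (ARG_MIN degree b. ?S b)"
  have b: "?S b" and bmin: "\<And>c. ?S c \<Longrightarrow> degree b \<le> degree c"
    using arg_min_natI[of ?S b0 degree] arg_min_nat_le[of ?S _ degree] \<open>?S b0\<close> unfolding b_def by auto
  obtain a where a: "to_fract b * y = to_fract a" using b by blast
  have "degree b = 0"
  proof (rule ccontr)
    assume "degree b \<noteq> 0"
    then obtain Q where Q: "irreducible Q" "lead_coeff Q = 1" "Q dvd b"
      using exists_monic_irreducible_factor[of b] by (metis gr0I)
    then obtain b' where b': "b = Q * b'" by (elim dvdE)
    obtain k c where k: "k > 0" "to_ac y ^ k = (\<Sum>i<k. emb (c i) * to_ac y ^ i)"
      by (rule integral_elem_power_eq[OF assms])
    have ay: "emb b * to_ac y = emb a" using a by (metis emb_def to_ac_mult)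
    have "emb (a ^ k) = emb b ^ k * to_ac y ^ k" by (simp flip: ay power_mult_distrib)
    also have "\<dots> = (\<Sum>i<k. emb b ^ k * (emb (c i) * to_ac y ^ i))" unfolding k(2) by (simp add: sum_distrib_left)
    also have "\<dots> = (\<Sum>i<k. emb (b * (b ^ (k - Suc i) * c i * a ^ i)))"
    proof (intro sum.cong refl)
      fix i assume "i \<in> {..<k}"
      hence "k = Suc (k - Suc i) + i" by simp
      hence "emb b ^ k = emb b * emb b ^ (k - Suc i) * emb b ^ i" by (metis power_Suc power_add)
      moreover have "emb a ^ i = emb b ^ i * to_ac y ^ i" by (simp flip: ay power_mult_distrib)
      ultimately show "emb b ^ k * (emb (c i) * to_ac y ^ i) = emb (b * (b ^ (k - Suc i) * c i * a ^ i))"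
        by (simp add: mult_ac)
    qed
    also have "\<dots> = emb (b * (\<Sum>i<k. b ^ (k - Suc i) * c i * a ^ i))"
      by (simp only: emb.hom_sum sum_distrib_left)
    finally have "a ^ k = b * (\<Sum>i<k. b ^ (k - Suc i) * c i * a ^ i)" by (simp only: emb_eq_iff)
    hence "Q dvd a ^ k" using Q(3) by (metis dvd_mult2)
    hence "Q dvd a" using Q(1) irreducible_dvd_power by blast
    then obtain a' where a': "a = Q * a'" by (elim dvdE)
    have Q0: "Q \<noteq> 0" using Q(1) by auto
    have "to_fract Q * (to_fract b' * y) = to_fract Q * to_fract a'" using a by (simp add: a' b' mult.assoc)
    hence "to_fract b' * y = to_fract a'" using Q0 by (metis mult_left_cancel to_fract_eq_0_iff)
    moreover have "b' \<noteq> 0" using b b' by auto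
    ultimately have "degree b \<le> degree b'" by (intro bmin) auto
    moreover have "degree b = degree Q + degree b'" unfolding b' using Q0 \<open>b' \<noteq> 0\<close> by (rule degree_mult_eq)
    ultimately show False using irreducible_poly_degree_pos[OF Q(1)] by simp
  qed
  then obtain b0 where b0: "b = [:b0:]" by (elim degree_eq_zeroE)
  hence "b0 \<noteq> 0" using b by auto
  hence "b * [:inverse b0:] = 1" by (simp add: b0 one_pCons)
  hence "y = to_fract (b * [:inverse b0:]) * y" by simp
  also have "\<dots> = to_fract (a * [:inverse b0:])" using a by (simp only: to_fract_mult) (metis mult.assoc mult.commute)
  finally show ?thesis by (rule that)
qed

lemma clear_denominators:
  fixes f :: "'c::idom fract poly"
  obtains c F where "c \<noteq> 0" "smult (to_fract c) f = map_poly to_fract F" "degree F = degree f"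
proof -
  have "\<exists>c F. c \<noteq> 0 \<and> smult (to_fract c) f = map_poly to_fract F"
  proof (induction f)
    case 0
    show ?case by (intro exI[of _ 1] exI[of _ 0]) simp
  next
    case (pCons y f)
    then obtain c F where cF: "c \<noteq> 0" "smult (to_fract c) f = map_poly to_fract F" by blast
    obtain a b where ab: "b \<noteq> 0" "to_fract b * y = to_fract a" by (rule fract_denominator)
    have "smult (to_fract (b * c)) (pCons y f) = pCons (to_fract (c * a)) (smult (to_fract b) (map_poly to_fract F))"
      unfolding cF(2)[symmetric]
    proof -
      have "to_fract (b * c) * y = to_fract c * (to_fract b * y)" by (simp add: mult_ac)
      thus "smult (to_fract (b * c)) (pCons y f) = pCons (to_fract (c * a)) (smult (to_fract b) (smult (to_fract c) f))"
        by (simp add: ab(2))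
    qed
    also have "\<dots> = map_poly to_fract (pCons (c * a) (smult b F))"
      by (rule poly_eqI) (simp add: coeff_map_poly coeff_pCons split: nat.splits)
    finally show ?case using ab(1) cF(1) by (intro exI[of _ "b * c"] exI[of _ "pCons (c * a) (smult b F)"]) simp
  qed
  then obtain c F where cF: "c \<noteq> 0" "smult (to_fract c) f = map_poly to_fract F" by blast
  have "degree F = degree (map_poly to_fract F)"
    by (rule Polynomial.degree_map_poly[symmetric]) simp
  also have "\<dots> = degree f" using cF by (metis degree_smult_eq to_fract_eq_0_iff)
  finally show ?thesis using that cF by blast
qed

section \<open>Inert primes in cyclotomic function fields\<close>

lemma (in fq_algebra) red_eq_0_smult:
  assumes P: "irreducible P" "ev \<beta> P = 0" and f: "red \<beta> f = 0"
  obtains f' where "f = smult P f'"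
proof -
  have P0: "P \<noteq> 0" using P by auto
  have d: "P dvd coeff f i" for i
  proof -
    have "ev \<beta> (coeff f i) = coeff (red \<beta> f) i" by (simp add: coeff_map_poly)
    thus ?thesis using f ev_eq_0_iff[OF P] by simp
  qed
  have "f = smult P (map_poly (\<lambda>c. c div P) f)"
    by (rule poly_eqI) (simp add: coeff_map_poly d)
  thus ?thesis by (rule that)
qed

lemma (in fq_algebra) strip_prime_factor:
  assumes P: "irreducible P" "ev \<beta> P = 0" and f: "f \<noteq> 0"
  obtains k f' where "f = smult (P ^ k) f'" "red \<beta> f' \<noteq> 0"
proof -
  have P0: "P \<noteq> 0" using P by auto
  have "\<exists>k f'. f = smult (P ^ k) f' \<and> red \<beta> f' \<noteq> 0" using f
  proof (induction "degree (lead_coeff f)" arbitrary: f rule: less_induct)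
    case less
    show ?case
    proof (cases "red \<beta> f = 0")
      case False
      thus ?thesis by (intro exI[of _ 0] exI[of _ f]) simp
    next
      case True
      then obtain f1 where f1: "f = smult P f1" by (rule red_eq_0_smult[OF P])
      have f10: "f1 \<noteq> 0" using f1 less.prems by auto
      have "lead_coeff f = P * lead_coeff f1" unfolding f1 using P0 by simp
      hence "degree (lead_coeff f) = degree P + degree (lead_coeff f1)" using f10 P0 by (simp add: degree_mult_eq)
      hence "degree (lead_coeff f1) < degree (lead_coeff f)" using irreducible_poly_degree_pos[OF P(1)] by simp
      from less.hyps[OF this f10] obtain k f' where "f1 = smult (P ^ k) f'" "red \<beta> f' \<noteq> 0" by blast
      thus ?thesis unfolding f1 by (intro exI[of _ "Suc k"] exI[of _ f']) simp
    qed
  qed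
  thus ?thesis using that by blast
qed


text \<open>Gauss's lemma at the single prime P: as long as P divides c, it divides f G but not f,
  so it divides G and cancels on both sides.\<close>

lemma (in fq_algebra) cancel_prime_factor:
  assumes P: "irreducible P" "ev \<beta> P = 0" and f: "red \<beta> f \<noteq> 0" 
    and eq: "smult c F = f * G" "c \<noteq> 0"
  obtains c' G' where "smult c' F = f * G'" "ev \<beta> c' \<noteq> 0"
proof -
  have P0: "P \<noteq> 0" using P by auto
  have "\<exists>c' G'. smult c' F = f * G' \<and> ev \<beta> c' \<noteq> 0" using eq
  proof (induction "degree c" arbitrary: c G rule: less_induct)
    case less
    show ?case
    proof (cases "ev \<beta> c = 0")
      case False
      thus ?thesis using less.prems by blast
    next
      case True
      hence "red \<beta> f * red \<beta> G = 0" using less.prems(1) by (metis red_mult red_smult smult_0_left)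
      hence "red \<beta> G = 0" using f by simp
      then obtain G1 where G1: "G = smult P G1" by (rule red_eq_0_smult[OF P])
      have "P dvd c" using True ev_eq_0_iff[OF P] by blast
      then obtain c1 where c1: "c = P * c1" by (elim dvdE)
      have "smult P (smult c1 F) = smult P (f * G1)" using less.prems(1) by (simp add: c1 G1)
      hence "smult P (smult c1 F - f * G1) = 0" by (simp only: smult_diff_right) simp
      hence eq1: "smult c1 F = f * G1" using P0 by (simp only: smult_eq_0_iff eq_iff_diff_eq_0[of "smult c1 F"]) simp
      have c10: "c1 \<noteq> 0" using less.prems(2) c1 by auto
      have "degree c1 < degree c" unfolding c1 using P0 c10 irreducible_poly_degree_pos[OF P(1)] by (simp add: degree_mult_eq)
      from less.hyps[OF this eq1 c10] show ?thesis .
    qed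
  qed
  thus ?thesis using that by blast
qed

lemma distinct_roots_of_pderiv:
  fixes p :: "'b::alg_closed_field poly"
  assumes p: "p \<noteq> 0" and sep: "\<And>x. poly p x = 0 \<Longrightarrow> poly (pderiv p) x \<noteq> 0"
  shows "card {x. poly p x = 0} = degree p"
    and "p = smult (lead_coeff p) (\<Prod>x | poly p x = 0. [:- x, 1:])"
proof -
  obtain A where A: "size A = degree p" "p = smult (lead_coeff p) (\<Prod>x\<in>#A. [:-x, 1:])"
    using alg_closed_imp_factorization[OF p] by blast
  have le1: "count A x \<le> 1" for x
  proof (rule ccontr)
    assume "\<not> count A x \<le> 1"
    hence "{#x, x#} \<subseteq># A" by (auto simp: subseteq_mset_def)
    then obtain B where "A = {#x, x#} + B" by (auto simp: mset_subset_eq_exists_conv)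
    hence p2: "p = [:-x, 1:] * ([:-x, 1:] * smult (lead_coeff p) (\<Prod>x\<in>#B. [:-x, 1:]))"
      using A(2) by (simp only: image_mset_union prod_mset_Un image_mset_add_mset prod_mset.add_mset image_mset_empty prod_mset_empty mult_smult_right) (simp only: mult.assoc mult_1_right mult_1_left)
    have "poly (pderiv ([:-x, 1:] * ([:-x, 1:] * r))) x = 0" for r by (simp only: pderiv_mult poly_add poly_mult) simp
    moreover have "poly p x = 0" by (subst p2) simp
    ultimately show False using sep p2 by metis
  qed
  have set: "set_mset A = {x. poly p x = 0}"
  proof -
    have "poly p x = 0 \<longleftrightarrow> x \<in># A" for x
    proof -
      have "poly p x = lead_coeff p * (\<Prod>y\<in>#A. x - y)"
        by (subst A(2)) (simp add: poly_prod_mset image_mset.compositionality o_def)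
      thus ?thesis using p by (auto simp: prod_mset_zero_iff)
    qed
    thus ?thesis by auto
  qed
  have AA: "A = mset_set {x. poly p x = 0}"
  proof (rule multiset_eqI)
    fix x show "count A x = count (mset_set {x. poly p x = 0}) x"
      using le1[of x] set poly_roots_finite[OF p] by (cases "x \<in># A") (auto simp: count_eq_zero_iff not_in_iff le_Suc_eq)
  qed
  show "card {x. poly p x = 0} = degree p" using A(1) AA by (metis size_mset_set)
  show "p = smult (lead_coeff p) (\<Prod>x | poly p x = 0. [:- x, 1:])"
    using A(2) unfolding AA by (simp add: prod_unfold_prod_mset)
qed

text \<open>As n is the order of the unit group modulo M, \<open>prim\<close> makes P a primitive
  root modulo M. The element z is a nonzero M-torsion point, which will generate the cyclotomic
  field of degree n.\<close>

locale inert_prime =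
  fixes P M :: "'a::{finite,field} poly" and z :: "'a clos" and n :: nat
  assumes P: "P \<in> monic_irr" and M: "M \<in> monic_irr" and PM: "\<not> M dvd P"
    and prim: "\<And>i. i > 0 \<Longrightarrow> M dvd P ^ i - 1 \<Longrightarrow> n \<le> i"
    and n_eq: "n = CARD('a) ^ degree M - 1"
    and lam: "poly (map_poly emb (carlitz_Phi M)) z = 0"
begin

abbreviation Phi :: "'a poly poly" where "Phi \<equiv> carlitz_Phi M"
abbreviation E :: "'a poly poly \<Rightarrow> 'a clos" where "E f \<equiv> poly (map_poly emb f) z"

lemma P_irr: "irreducible P" "lead_coeff P = 1" using P by (auto simp: monic_irr_def)
lemma M_irr: "irreducible M" "lead_coeff M = 1" using M by (auto simp: monic_irr_def)
lemma P_nz: "P \<noteq> 0" using P_irr by auto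
lemma M_nz: "M \<noteq> 0" using M_irr by auto

lemma n_pos: "n > 0"
proof -
  have "CARD('a) ^ degree M > 1" using card_field_ge_2[where 'a='a] monic_irr_degree_pos[OF M] by (intro one_less_power) auto
  thus ?thesis by (simp add: n_eq)
qed

lemma Phi_degree: "degree Phi = n" and Phi_lc: "lead_coeff Phi = 1"
  using carlitz_Phi_monic[OF M_irr(2)] by (simp_all add: n_eq)

lemma Phi_nz: "Phi \<noteq> 0" using Phi_lc by (metis leading_coeff_0_iff zero_neq_one)

lemma E_add: "E (f + g) = E f + E g" and E_mult: "E (f * g) = E f * E g"
  and E_diff: "E (f - g) = E f - E g" and E_smult: "E (smult c f) = emb c * E f"
  and E_const: "E [:c:] = emb c" and E_1: "E 1 = 1" and E_pow: "E (f ^ k) = E f ^ k"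
proof -
  show E_smult: "E (smult c f) = emb c * E f" by (simp add: map_poly_smult)
  show "E (f + g) = E f + E g" "E (f * g) = E f * E g" "E (f - g) = E f - E g" "E 1 = 1" "E (f ^ k) = E f ^ k"
    by (simp_all add: embp.hom_add embp.hom_mult embp.hom_minus embp.hom_power)
  show "E [:c:] = emb c" by (simp add: emb_pCons)
qed

lemma E_X: "E [:0, 1:] = z" by (simp add: emb_pCons)

lemma ac_root: "degree (ac.red \<beta> f) > 0 \<Longrightarrow> \<exists>\<mu>. poly (ac.red \<beta> f) \<mu> = 0"
  by (rule alg_closed_imp_poly_has_root)

lemma ac_M_nz: assumes "irreducible R" "ac.ev \<beta> R = 0" "\<not> R dvd M" shows "ac.ev \<beta> M \<noteq> 0"
  using ac.ev_eq_0_iff[OF assms(1,2)] assms(3) by blast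

lemma not_dvd_M: "\<not> P dvd M"
  using P M PM monic_irr_dvd_eq[OF P M] by auto

lemma red_Phi_root: 
  assumes "ac.ev \<beta> M \<noteq> 0" "poly (ac.red \<beta> Phi) \<mu> = 0"
  shows "ac.car \<beta> M \<mu> = 0" "\<mu> \<noteq> 0"
proof -
  show "ac.car \<beta> M \<mu> = 0" using ac.poly_red_Phi[of \<beta> M \<mu>] assms by simp
  show "\<mu> \<noteq> 0" using ac.poly_red_Phi_0[of \<beta> M] assms by auto
qed

text \<open>This is the inertness of P: a root of the reduced \<open>Phi\<close> has degree n over
  the residue field of P.\<close>

lemma red_small_degree_no_root:
  assumes \<beta>: "ac.ev \<beta> P = 0" and \<mu>: "poly (ac.red \<beta> Phi) \<mu> = 0"
    and f: "poly (ac.red \<beta> f) \<mu> = 0" "ac.red \<beta> f \<noteq> 0"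
  shows "n \<le> degree (ac.red \<beta> f)"
  using ac.degree_ge_of_root_mod_prime[OF P_irr \<beta> M_irr(1) PM prim
      red_Phi_root[OF ac_M_nz[OF P_irr(1) \<beta> not_dvd_M] \<mu>] f] by simp

text \<open>Irreducibility of \<open>Phi\<close> over F_q(t), inherited from its reduction modulo P.
  A relation of least degree divides c times \<open>Phi\<close> for some nonzero c in F_q[t], which
  by Gauss's lemma may be taken prime to P; its reduction is then a nonconstant factor of degree
  below n of the reduced \<open>Phi\<close>.\<close>

theorem E_eq_0_small_degree:
  assumes f: "degree f < n" "E f = 0"
  shows "f = 0"
proof (rule ccontr)
  assume "f \<noteq> 0"
  let ?Z = "\<lambda>f. f \<noteq> 0 \<and> E f = 0"
  define f0 where "f0 = (ARG_MIN degree f. ?Z f)"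
  have f0: "?Z f0" and fmin: "\<And>h. ?Z h \<Longrightarrow> degree f0 \<le> degree h"
    using arg_min_natI[of ?Z f degree] arg_min_nat_le[of ?Z _ degree] f \<open>f \<noteq> 0\<close> unfolding f0_def by auto
  have f0n: "degree f0 < n" using fmin[of f] f \<open>f \<noteq> 0\<close> by simp
  obtain \<beta> where \<beta>: "ac.ev \<beta> P = 0"
    using alg_closed_imp_poly_has_root[of "map_poly to_ac P"] monic_irr_degree_pos[OF P] by (auto simp: ac.ev_def)
  have "f0 \<noteq> 0" using f0 by simp
  then obtain k f1 where f1: "f0 = smult (P ^ k) f1" "ac.red \<beta> f1 \<noteq> 0"
    by (rule ac.strip_prime_factor[OF P_irr(1) \<beta>])
  have f1nz: "f1 \<noteq> 0" using f1 by auto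
  have Ef1: "E f1 = 0" using f0 P_nz unfolding f1(1) E_smult by simp
  have df1: "degree f1 = degree f0" unfolding f1(1) using P_nz by simp
  have pos: "degree f1 > 0"
  proof (rule ccontr)
    assume "\<not> degree f1 > 0"
    then obtain a where "f1 = [:a:]" by (auto elim: degree_eq_zeroE)
    thus False using Ef1 f1nz by (simp add: E_const)
  qed
  obtain Q R where QR: "pseudo_divmod Phi f1 = (Q, R)" by (cases "pseudo_divmod Phi f1") auto
  define c where "c = coeff f1 (degree f1) ^ (Suc (degree Phi) - degree f1)"
  have c0: "c \<noteq> 0" using f1nz by (simp add: c_def)
  have eq: "smult c Phi = f1 * Q + R" "R = 0 \<or> degree R < degree f1"
    using pseudo_divmod[OF f1nz QR] by (auto simp: c_def)
  have "E R = 0"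
  proof -
    have "E (smult c Phi) = E f1 * E Q + E R" unfolding eq(1) E_add E_mult ..
    thus ?thesis using lam Ef1 by (simp add: E_smult)
  qed
  hence "R = 0" using eq(2) fmin[of R] df1 by (metis not_less)
  hence "smult c Phi = f1 * Q" using eq(1) by simp
  then obtain c' G where cG: "smult c' Phi = f1 * G" "ac.ev \<beta> c' \<noteq> 0"
    using ac.cancel_prime_factor[OF P_irr(1) \<beta> f1(2) _ c0] by metis
  have c'0: "c' \<noteq> 0" using cG(2) by auto
  have red: "smult (ac.ev \<beta> c') (ac.red \<beta> Phi) = ac.red \<beta> f1 * ac.red \<beta> G"
    using cG(1) by (metis ac.red_mult ac.red_smult)
  have rPhi: "degree (ac.red \<beta> Phi) = n" "ac.red \<beta> Phi \<noteq> 0"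
    using ac.red_Phi_monic[OF M_irr(2), of \<beta>] n_pos by (auto simp: n_eq)
  have rG: "ac.red \<beta> G \<noteq> 0" using red rPhi cG(2) by (metis mult_zero_right smult_eq_0_iff)
  have G0: "G \<noteq> 0" using rG by auto
  \<comment> \<open>Reduction can only lower the degrees of f1 and G, yet they add up to n before
    and after; so f1 keeps its positive degree and has a root.\<close>
  have "n = degree (ac.red \<beta> f1) + degree (ac.red \<beta> G)"
    using arg_cong[OF red, of degree] rPhi cG(2) f1(2) rG by (simp add: degree_mult_eq)
  moreover have "degree (ac.red \<beta> G) \<le> degree G" by (rule map_poly_degree_leq)
  moreover have "n = degree f1 + degree G"
    using arg_cong[OF cG(1), of degree] c'0 f1nz G0 by (simp add: degree_mult_eq Phi_degree)
  ultimately have "degree (ac.red \<beta> f1) \<ge> degree f1" by linarith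
  moreover have "degree (ac.red \<beta> f1) \<le> degree f1" by (rule map_poly_degree_leq)
  ultimately have drf: "degree (ac.red \<beta> f1) = degree f1" by simp
  then obtain \<mu> where \<mu>: "poly (ac.red \<beta> f1) \<mu> = 0" using ac_root[of \<beta> f1] pos by auto
  hence "poly (smult (ac.ev \<beta> c') (ac.red \<beta> Phi)) \<mu> = 0" unfolding red by simp
  hence "poly (ac.red \<beta> Phi) \<mu> = 0" using cG(2) by simp
  hence "n \<le> degree (ac.red \<beta> f1)" by (rule red_small_degree_no_root[OF \<beta> _ \<mu> f1(2)])
  thus False using drf df1 f0n by simp
qed

lemma divide_by_Phi:
  obtains Q R where "F = Phi * Q + R" "degree R < n"
proof -
  obtain Q R where QR: "pseudo_divmod F Phi = (Q, R)" by (cases "pseudo_divmod F Phi") auto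
  have "F = Phi * Q + R" "R = 0 \<or> degree R < n"
    using pseudo_divmod[OF Phi_nz QR] Phi_lc by (auto simp: Phi_degree)
  thus ?thesis using that n_pos by (metis degree_0)
qed

lemma E_eq_0_iff: "E F = 0 \<longleftrightarrow> Phi dvd F"
proof
  assume F: "E F = 0"
  obtain Q R where QR: "F = Phi * Q + R" "degree R < n" by (rule divide_by_Phi)
  have "E R = 0" using F lam unfolding QR(1) E_add E_mult by simp
  hence "R = 0" using QR(2) E_eq_0_small_degree by blast
  thus "Phi dvd F" using QR(1) by simp
next
  assume "Phi dvd F"
  then obtain Q where "F = Phi * Q" by (elim dvdE)
  thus "E F = 0" using lam by (simp add: E_mult)
qed

text \<open>As \<open>Phi\<close> generates the kernel of \<open>E\<close>, evaluation at a root of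
  the reduced \<open>Phi\<close> is well defined on F_q[t][z]. Since \<open>\<beta>\<close> is not
  tied to P, this provides residue maps at all primes, as \<open>localization\<close> needs.\<close>

lemma red_root_of_E_eq_0:
  assumes "E F = 0" "poly (ac.red \<beta> Phi) \<mu> = 0"
  shows "poly (ac.red \<beta> F) \<mu> = 0"
proof -
  have "Phi dvd F" using assms(1) E_eq_0_iff by blast
  then obtain Q where "F = Phi * Q" by (elim dvdE)
  thus ?thesis using assms(2) by simp
qed

lemma conj_root_of_E_eq_0:
  assumes "E F = 0" "poly (map_poly emb Phi) z' = 0"
  shows "poly (map_poly emb F) z' = 0"
proof -
  have "Phi dvd F" using assms(1) E_eq_0_iff by blast
  then obtain Q where "F = Phi * Q" by (elim dvdE)
  thus ?thesis using assms(2) by (simp add: embp.hom_mult)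
qed

end

interpretation tac: inj_idom_hom "to_ac :: 'c::field \<Rightarrow> 'c alg_closure" by unfold_locales auto
interpretation tacp: map_poly_inj_idom_hom "to_ac :: 'c::field \<Rightarrow> 'c alg_closure" ..
interpretation tof: inj_idom_hom "to_fract :: 'c::idom \<Rightarrow> 'c fract" by unfold_locales auto
interpretation tofp: map_poly_inj_idom_hom "to_fract :: 'c::idom \<Rightarrow> 'c fract" ..

lemma map_poly_emb: "map_poly emb F = map_poly to_ac (map_poly to_fract F)"
  by (rule poly_eqI) (simp add: coeff_map_poly emb_def)

section \<open>The field generated by z and its identification with the cyclotomic field\<close>

context inert_prime
begin

definition Ek :: "'a clos \<Rightarrow> 'a poly fract poly \<Rightarrow> 'a clos" where
  "Ek x f = poly (map_poly to_ac f) x"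

lemma Ek_add: "Ek x (f + g) = Ek x f + Ek x g" and Ek_mult: "Ek x (f * g) = Ek x f * Ek x g"
  and Ek_diff: "Ek x (f - g) = Ek x f - Ek x g" and Ek_smult: "Ek x (smult c f) = to_ac c * Ek x f"
  and Ek_const: "Ek x [:c:] = to_ac c" and Ek_0: "Ek x 0 = 0" and Ek_1: "Ek x 1 = 1"
  and Ek_sum: "Ek x (\<Sum>i\<in>I. F i) = (\<Sum>i\<in>I. Ek x (F i))"
proof -
  show "Ek x (smult c f) = to_ac c * Ek x f" by (simp add: Ek_def map_poly_smult)
  show "Ek x (f + g) = Ek x f + Ek x g" "Ek x (f * g) = Ek x f * Ek x g" "Ek x (f - g) = Ek x f - Ek x g" "Ek x 0 = 0" "Ek x 1 = 1"
    "Ek x (\<Sum>i\<in>I. F i) = (\<Sum>i\<in>I. Ek x (F i))"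
    by (simp_all add: Ek_def tacp.hom_add tacp.hom_mult tacp.hom_minus tacp.hom_sum poly_sum)
  show "Ek x [:c:] = to_ac c" by (simp add: Ek_def poly_altdef coeff_map_poly)
qed

lemma Ek_monom: "Ek x (monom c i) = to_ac c * x ^ i"
  by (simp add: Ek_def map_poly_monom poly_monom)

lemma E_eq_Ek: "poly (map_poly emb F) x = Ek x (map_poly to_fract F)"
  by (simp add: Ek_def map_poly_emb)

lemma Ek_eq_0_small:
  assumes "Ek z f = 0" "degree f < n" shows "f = 0"
proof -
  obtain c F where cF: "c \<noteq> 0" "smult (to_fract c) f = map_poly to_fract F" "degree F = degree f"
    by (rule clear_denominators)
  have "E F = 0" unfolding E_eq_Ek cF(2)[symmetric] Ek_smult using assms by simp
  hence "F = 0" using E_eq_0_small_degree[of F] cF(3) assms(2) by simp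
  hence "smult (to_fract c) f = 0" using cF(2) by simp
  thus "f = 0" using cF(1) by simp
qed

lemma Ek_conj:
  assumes "Ek z f = 0" "poly (map_poly emb Phi) x = 0" shows "Ek x f = 0"
proof -
  obtain c F where cF: "c \<noteq> 0" "smult (to_fract c) f = map_poly to_fract F" "degree F = degree f"
    by (rule clear_denominators)
  have "E F = 0" unfolding E_eq_Ek cF(2)[symmetric] Ek_smult using assms by simp
  hence "Ek x (map_poly to_fract F) = 0" using conj_root_of_E_eq_0[OF _ assms(2)] by (simp add: E_eq_Ek)
  hence "to_ac (to_fract c) * Ek x f = 0" unfolding cF(2)[symmetric] Ek_smult .
  thus ?thesis using cF(1) by simp
qed

abbreviation PhiK :: "'a poly fract poly" where "PhiK \<equiv> map_poly to_fract Phi"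

lemma PhiK_degree: "degree PhiK = n" by (simp add: Phi_degree)
lemma PhiK_root: "Ek z PhiK = 0" using lam by (simp add: E_eq_Ek)
lemma PhiK_nz: "PhiK \<noteq> 0" using Phi_nz by simp

lemma PhiK_irreducible: "irreducible PhiK"
proof (rule irreducibleI)
  show "PhiK \<noteq> 0" by (rule PhiK_nz)
  show "\<not> is_unit PhiK" using PhiK_degree n_pos PhiK_nz by (simp add: is_unit_iff_degree)
  fix a b assume ab: "PhiK = a * b"
  have nz: "a \<noteq> 0" "b \<noteq> 0" using ab PhiK_nz by auto
  have deg: "n = degree a + degree b" using PhiK_degree ab nz by (simp add: degree_mult_eq)
  have "Ek z a * Ek z b = 0" using PhiK_root unfolding ab Ek_mult .
  hence "Ek z a = 0 \<or> Ek z b = 0" by simp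
  thus "is_unit a \<or> is_unit b"
  proof
    assume "Ek z a = 0"
    hence "\<not> degree a < n" using Ek_eq_0_small nz by blast
    thus ?thesis using deg nz by (simp add: is_unit_iff_degree)
  next
    assume "Ek z b = 0"
    hence "\<not> degree b < n" using Ek_eq_0_small nz by blast
    thus ?thesis using deg nz by (simp add: is_unit_iff_degree)
  qed
qed

definition K :: "'a clos set" where "K = range (Ek z)"

lemma K_subfield: "is_subfield_of_clos K"
  unfolding is_subfield_of_clos_def
proof (intro conjI ballI)
  show "0 \<in> K" unfolding K_def using rangeI[of "Ek z" 0] by (simp only: Ek_0)
  show "1 \<in> K" unfolding K_def using rangeI[of "Ek z" 1] by (simp only: Ek_1)
  fix x y assume "x \<in> K" "y \<in> K"
  then obtain f g where "x = Ek z f" "y = Ek z g" by (auto simp: K_def)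
  thus "x + y \<in> K" "x - y \<in> K" "x * y \<in> K" unfolding K_def
    by (simp_all flip: Ek_add Ek_diff Ek_mult)
next
  fix x assume "x \<in> K"
  then obtain f where f: "x = Ek z f" by (auto simp: K_def)
  show "inverse x \<in> K"
  proof (cases "x = 0")
    case True
    thus ?thesis unfolding K_def using rangeI[of "Ek z" 0] by (simp only: Ek_0 inverse_zero)
  next
    case False
    have "\<not> PhiK dvd f"
    proof
      assume "PhiK dvd f"
      then obtain h where "f = PhiK * h" by (elim dvdE)
      thus False using False f PhiK_root by (simp add: Ek_mult)
    qed
    then obtain u v where "u * f + v * PhiK = 1" by (rule irreducible_bezout[OF PhiK_irreducible])
    hence "Ek z (u * f + v * PhiK) = 1" by (simp add: Ek_1)
    hence "Ek z u * x = 1" using f PhiK_root by (simp add: Ek_add Ek_mult)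
    hence "inverse x = Ek z u" by (metis inverse_unique mult.commute)
    thus ?thesis by (simp add: K_def)
  qed
qed

lemma z_nz: "z \<noteq> 0"
proof
  assume "z = 0"
  hence "poly (cl.red emb_t Phi) 0 = 0" using lam by (simp add: cl_ev_fun)
  thus False using cl.poly_red_Phi_0[of emb_t M] M_nz by (simp add: cl_ev)
qed

lemma z_torsion: "cl.car emb_t M z = 0"
  using cl.poly_red_Phi[of emb_t M z] lam by (simp add: cl_ev_fun)

lemma E_in_K: "E f \<in> K" by (simp add: E_eq_Ek K_def)

lemma torsion_subset_K: "carlitz_torsion M \<subseteq> K"
proof
  fix x assume "x \<in> carlitz_torsion M"
  hence "x \<in> {x. cl.car emb_t M x = 0}" by (simp add: carlitz_torsion_def carlitz_eq)
  then obtain A where A: "x = cl.car emb_t A z"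
    unfolding cl.car_torsion_eq[OF M_irr z_torsion z_nz] by auto
  have "x = (\<Sum>i\<le>degree A. emb (carlitz_poly_coeff A i) * z ^ (CARD('a) ^ i))"
    unfolding A cl.car_expand by (simp add: cl_ev)
  also have "\<dots> = E (\<Sum>i\<le>degree A. monom (carlitz_poly_coeff A i) (CARD('a) ^ i))"
    by (simp add: embp.hom_sum map_poly_monom poly_sum poly_monom)
  finally show "x \<in> K" using E_in_K by simp
qed

lemma cyclotomic_field_eq: "cyclotomic_field M = K"
proof
  have "range to_ac \<subseteq> K"
  proof
    fix x :: "'a clos" assume "x \<in> range to_ac"
    then obtain c where "x = to_ac c" by auto
    thus "x \<in> K" unfolding K_def using rangeI[of "Ek z" "[:c:]"] by (simp only: Ek_const)
  qed
  thus "cyclotomic_field M \<subseteq> K"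
    unfolding cyclotomic_field_def using torsion_subset_K K_subfield by blast
  show "K \<subseteq> cyclotomic_field M"
    unfolding cyclotomic_field_def
  proof (rule Inter_greatest, safe)
    fix S x assume S: "range to_ac \<union> carlitz_torsion M \<subseteq> S" "is_subfield_of_clos S" and "x \<in> K"
    then obtain f where f: "x = Ek z f" by (auto simp: K_def)
    have zS: "z \<in> S" using S(1) z_torsion by (auto simp: carlitz_torsion_def carlitz_eq)
    have add: "x + y \<in> S" "x * y \<in> S" if "x \<in> S" "y \<in> S" for x y
      using S(2) that by (auto simp: is_subfield_of_clos_def)
    have c: "to_ac c \<in> S" for c using S(1) by auto
    have "0 \<in> S" "1 \<in> S" using S(2) by (auto simp: is_subfield_of_clos_def)
    have pw: "z ^ i \<in> S" for i by (induction i) (auto intro: add zS \<open>1 \<in> S\<close>)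
    have "(\<Sum>i\<in>I. to_ac (coeff f i) * z ^ i) \<in> S" for I
      by (induction I rule: infinite_finite_induct) (auto intro: add c pw \<open>0 \<in> S\<close>)
    thus "x \<in> S" unfolding f Ek_def poly_altdef by simp
  qed
qed

lemma K_repr:
  assumes "x \<in> K" obtains f where "x = Ek z f" "degree f < n"
proof -
  obtain f where f: "x = Ek z f" using assms by (auto simp: K_def)
  have "f = f div PhiK * PhiK + f mod PhiK" by (rule div_mult_mod_eq[symmetric])
  hence "Ek z f = Ek z (f div PhiK * PhiK + f mod PhiK)" by (rule arg_cong)
  hence "x = Ek z (f div PhiK) * Ek z PhiK + Ek z (f mod PhiK)" by (simp only: f Ek_add Ek_mult)
  hence "x = Ek z (f mod PhiK)" by (simp add: PhiK_root)
  moreover have "degree (f mod PhiK) < n"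
    using degree_mod_less[OF PhiK_nz, of f] PhiK_degree n_pos by (metis degree_0)
  ultimately show ?thesis by (rule that)
qed

lemma K_repr_integral:
  assumes "x \<in> K" obtains c F where "c \<noteq> 0" "emb c * x = E F" "degree F < n"
proof -
  obtain f where f: "x = Ek z f" "degree f < n" using assms by (rule K_repr)
  obtain c F where cF: "c \<noteq> 0" "smult (to_fract c) f = map_poly to_fract F" "degree F = degree f"
    by (rule clear_denominators)
  have "E F = emb c * x" unfolding E_eq_Ek cF(2)[symmetric] Ek_smult f(1) emb_def ..
  thus ?thesis using that[of c F] cF f(2) by simp
qed

lemma Ek_sum_monom: "(\<Sum>i<n. to_ac (c i) * x ^ i) = Ek x (\<Sum>i<n. monom (c i) i)"
  by (simp add: Ek_sum Ek_monom)

lemma degree_sum_monom: "degree (\<Sum>i<n. monom (c i) i) < n"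
  using n_pos by (intro degree_sum_less) (auto intro: le_less_trans[OF degree_monom_le])

lemma power_basis: "is_basis K n (\<lambda>i. z ^ i)"
  unfolding is_basis_def
proof (intro conjI allI impI ballI)
  fix i assume "i < n"
  have "z ^ i = Ek z (monom 1 i)" by (simp add: Ek_monom)
  thus "z ^ i \<in> K" by (simp add: K_def)
next
  fix c i assume c: "(\<Sum>i<n. to_ac (c i) * z ^ i) = 0" and i: "i < n"
  have "(\<Sum>i<n. monom (c i) i) = 0" using c Ek_eq_0_small[OF _ degree_sum_monom] by (simp add: Ek_sum_monom)
  hence "coeff (\<Sum>j<n. monom (c j) j) i = 0" by simp
  thus "c i = 0" using i by (simp add: coeff_sum)
next
  fix x assume "x \<in> K"
  then obtain f where f: "x = Ek z f" "degree f < n" by (rule K_repr)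
  have "f = (\<Sum>i<n. monom (coeff f i) i)"
  proof (rule poly_eqI)
    fix k show "coeff f k = coeff (\<Sum>i<n. monom (coeff f i) i) k"
      using f(2) by (auto simp: coeff_sum coeff_eq_0)
  qed
  hence "x = (\<Sum>i<n. to_ac (coeff f i) * z ^ i)" unfolding Ek_sum_monom f(1) by simp
  thus "\<exists>c. x = (\<Sum>i<n. to_ac (c i) * z ^ i)" by blast
qed

end

text \<open>Invariance of dimension. It gives meaning to the \<open>THE\<close> in
  \<open>ext_degree\<close> and allows the unknown basis in \<open>field_trace\<close> to be
  compared with the powers of z.\<close>

lemma is_basis_card_unique:
  fixes K :: "'c::field alg_closure set"
  assumes "is_basis K m b" "is_basis K k b'" shows "m = k"
proof -
  interpret vs: vector_space "\<lambda>(c::'c) x. to_ac c * x"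
    by unfold_locales (simp_all add: algebra_simps)
  have *: "m = vs.dim K" if B: "is_basis K m b" for m b
  proof -
    have mem: "\<And>i. i < m \<Longrightarrow> b i \<in> K" and ind: "\<And>c. (\<Sum>i<m. to_ac (c i) * b i) = 0 \<Longrightarrow> (\<forall>i<m. c i = 0)"
      and span: "\<And>x. x \<in> K \<Longrightarrow> \<exists>c. x = (\<Sum>i<m. to_ac (c i) * b i)"
      using B by (auto simp: is_basis_def)
    have inj: "inj_on b {..<m}"
    proof (rule inj_onI)
      fix i j assume ij: "i \<in> {..<m}" "j \<in> {..<m}" "b i = b j"
      show "i = j"
      proof (rule ccontr)
        assume "i \<noteq> j"
        define c :: "nat \<Rightarrow> 'c" where "c = (\<lambda>k. if k = i then 1 else if k = j then -1 else 0)"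
        have "(\<Sum>k<m. to_ac (c k) * b k) = (\<Sum>k\<in>{i,j}. to_ac (c k) * b k)"
          using ij by (intro sum.mono_neutral_right) (auto simp: c_def)
        also have "\<dots> = 0" using \<open>i \<noteq> j\<close> ij(3) by (simp add: c_def)
        finally have "c i = 0" using ind ij(1) by blast
        thus False by (simp add: c_def)
      qed
    qed
    have "vs.independent (b ` {..<m})"
    proof
      assume "vs.dependent (b ` {..<m})"
      then obtain u where u: "\<exists>v\<in>b ` {..<m}. u v \<noteq> 0" "(\<Sum>v\<in>b ` {..<m}. to_ac (u v) * v) = 0"
        unfolding vs.dependent_finite[OF finite_imageI[OF finite_lessThan]] by blast
      have "(\<Sum>i<m. to_ac (u (b i)) * b i) = 0" using u(2) by (simp add: sum.reindex[OF inj])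
      from ind[OF this] show False using u(1) by auto
    qed
    moreover have "b ` {..<m} \<subseteq> K" using mem by auto
    moreover have "K \<subseteq> vs.span (b ` {..<m})"
    proof
      fix x assume "x \<in> K"
      then obtain c where x: "x = (\<Sum>i<m. to_ac (c i) * b i)" using span by blast
      show "x \<in> vs.span (b ` {..<m})" unfolding x
        by (intro vs.span_sum vs.span_scale vs.span_base) auto
    qed
    ultimately have "card (b ` {..<m}) = vs.dim K" by (intro vs.basis_card_eq_dim)
    thus ?thesis using inj by (simp add: card_image)
  qed
  show ?thesis using *[OF assms(1)] *[OF assms(2)] by simp
qed

lemma (in inert_prime) ext_degree_K: "ext_degree K = n"
  unfolding ext_degree_def
proof (rule the_equality)
  show "\<exists>b. is_basis K n b" using power_basis by blast
  show "m = n" if "\<exists>b. is_basis K m b" for m using that is_basis_card_unique[OF _ power_basis] by blast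
qed

section \<open>Discriminants\<close>

lemma integral_coeff_mult:
  assumes "\<And>i. integral_elem (coeff p i)" "\<And>i. integral_elem (coeff r i)"
  shows "integral_elem (coeff (p * r) i)"
  unfolding coeff_mult by (intro integral_elem_sum integral_elem_add_mult assms)

lemma integral_coeff_prod:
  assumes "\<And>j i. j \<in> J \<Longrightarrow> integral_elem (coeff (f j) i)"
  shows "integral_elem (coeff (\<Prod>j\<in>J. f j) i)"
  using assms
proof (induction J arbitrary: i rule: infinite_finite_induct)
  case (insert j J)
  thus ?case by (simp add: integral_coeff_mult)
qed (simp_all add: coeff_1)

lemma det_nat_eq_det: "det_nat n A = det (mat n n (\<lambda>(i,j). A i j))"
proof -
  have "det (mat n n (\<lambda>(i,j). A i j)) = (\<Sum>p | p permutes {0..<n}. of_int (sign p) * (\<Prod>i = 0..<n. mat n n (\<lambda>(i,j). A i j) $$ (i, p i)))"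
    by (subst det_def'[of _ n]) auto
  also have "\<dots> = det_nat n A" unfolding det_nat_def atLeast0LessThan
  proof (intro sum.cong refl)
    fix p assume "p \<in> {p. p permutes {..<n}}"
    hence "p i < n" if "i < n" for i using that permutes_in_image[of p "{..<n}" i] by auto
    thus "of_int (sign p) * (\<Prod>i<n. mat n n (\<lambda>(i,j). A i j) $$ (i, p i)) = of_int (sign p) * (\<Prod>i<n. A i (p i))"
      by (intro arg_cong2[of _ _ _ _ "(*)"] prod.cong) auto
  qed
  finally show ?thesis ..
qed

lemma mat_mult_entry:
  assumes "A \<in> carrier_mat n n" "B \<in> carrier_mat n n" "i < n" "j < n"
  shows "(A * B) $$ (i, j) = (\<Sum>k<n. A $$ (i, k) * B $$ (k, j))"
  using assms by (auto simp: scalar_prod_def atLeast0LessThan)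

context inert_prime
begin

text \<open>\<open>Phi\<close> is separable, because Phi + X Phi' = M would vanish at a double
  root.\<close>

lemma conjugates_exist:
  obtains l where "map_poly emb Phi = (\<Prod>i<n. [:- l i, 1:])"
proof -
  let ?F = "map_poly emb Phi"
  have F0: "?F \<noteq> 0" using Phi_nz by simp
  have lF: "lead_coeff ?F = 1" using Phi_lc by simp
  have dF: "degree ?F = n" by (simp add: Phi_degree)
  have sep: "poly (pderiv ?F) x \<noteq> 0" if "poly ?F x = 0" for x
  proof
    assume "poly (pderiv ?F) x = 0"
    hence "emb M = 0" using cl.Phi_pderiv[of emb_t M x] that by (simp add: cl_ev_fun)
    thus False using M_nz by simp
  qed
  let ?R = "{x. poly ?F x = 0}"
  have card: "card ?R = n" using distinct_roots_of_pderiv(1)[OF F0 sep] dF by simp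
  have fact: "?F = (\<Prod>x\<in>?R. [:- x, 1:])" using distinct_roots_of_pderiv(2)[OF F0 sep] lF by simp
  have fin: "finite ?R" by (rule poly_roots_finite[OF F0])
  obtain l where l: "bij_betw l {..<n} ?R"
    using ex_bij_betw_nat_finite[OF fin] card by (auto simp: atLeast0LessThan)
  have "?F = (\<Prod>i<n. [:- l i, 1:])"
    unfolding prod.reindex_bij_betw[OF l, of "\<lambda>x. [:- x, 1:]"] by (rule fact)
  thus ?thesis by (rule that)
qed

context
  fixes l :: "nat \<Rightarrow> 'a clos"
  assumes l_prod: "map_poly emb Phi = (\<Prod>i<n. [:- l i, 1:])"
begin

lemma l_root: "k < n \<Longrightarrow> poly (map_poly emb Phi) (l k) = 0"
  unfolding l_prod poly_prod by (subst prod_zero_iff) auto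

lemma l_integral: "k < n \<Longrightarrow> integral_elem (l k)"
  unfolding integral_elem_def using l_root Phi_lc by blast

definition Lag :: "nat \<Rightarrow> 'a clos poly" where "Lag k = (\<Prod>i\<in>{..<n} - {k}. [:- l i, 1:])"

lemma Lag_degree: "k < n \<Longrightarrow> degree (Lag k) < n"
  unfolding Lag_def by (subst degree_prod_sum_eq) auto

lemma Lag_other: "k < n \<Longrightarrow> j < n \<Longrightarrow> j \<noteq> k \<Longrightarrow> poly (Lag k) (l j) = 0"
  unfolding Lag_def poly_prod by (subst prod_zero_iff) auto

text \<open>The cofactor of X - l_k takes the value Phi'(l_k) at l_k, and Phi + X Phi' = M.\<close>

lemma Lag_same: assumes k: "k < n" shows "poly (Lag k) (l k) * l k = emb M"
proof -
  have "map_poly emb Phi = [:- l k, 1:] * Lag k"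
    unfolding l_prod Lag_def using k by (subst prod.remove[of _ k]) auto
  moreover have "poly (pderiv ([:- l k, 1:] * r)) (l k) = poly r (l k)" for r
    by (simp only: pderiv_mult poly_add poly_mult) (simp add: pderiv_pCons)
  ultimately have "poly (pderiv (map_poly emb Phi)) (l k) = poly (Lag k) (l k)" by simp
  thus ?thesis using cl.Phi_pderiv[of emb_t M "l k"] l_root[OF k] by (simp add: cl_ev_fun mult.commute)
qed

definition V :: "'a clos mat" where "V = mat n n (\<lambda>(k,i). l k ^ i)"
definition W :: "'a clos mat" where "W = mat n n (\<lambda>(i,k). coeff (Lag k) i * l k)"

lemma V_carrier [simp]: "V \<in> carrier_mat n n" and W_carrier [simp]: "W \<in> carrier_mat n n"
  by (auto simp: V_def W_def)

text \<open>\<open>W\<close> consists of the coefficients of the Lagrange polynomials scaled so that \<open>V W = M\<close>; this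
  bounds the discriminant by a power of \<open>M\<close>.\<close>

lemma V_W: "V * W = emb M \<cdot>\<^sub>m 1\<^sub>m n"
proof (rule eq_matI)
  fix k j assume "k < dim_row (emb M \<cdot>\<^sub>m 1\<^sub>m n)" "j < dim_col (emb M \<cdot>\<^sub>m 1\<^sub>m n)"
  hence kj: "k < n" "j < n" by auto
  have "(V * W) $$ (k, j) = (\<Sum>i<n. l k ^ i * (coeff (Lag j) i * l j))"
    using kj by (simp add: V_def W_def scalar_prod_def atLeast0LessThan)
  also have "\<dots> = (\<Sum>i<n. coeff (Lag j) i * l k ^ i) * l j" unfolding sum_distrib_right by (intro sum.cong refl) (simp add: mult_ac)
  also have "(\<Sum>i<n. coeff (Lag j) i * l k ^ i) = poly (Lag j) (l k)"
    unfolding poly_altdef using Lag_degree[OF kj(2)] by (intro sum.mono_neutral_right) (auto simp: coeff_eq_0)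
  also have "poly (Lag j) (l k) * l j = (if k = j then emb M else 0)"
    using kj Lag_same[of k] Lag_other[of j k] by auto
  finally show "(V * W) $$ (k, j) = (emb M \<cdot>\<^sub>m 1\<^sub>m n) $$ (k, j)" using kj by simp
qed (auto simp: V_def W_def)

lemma det_V_W: "det V * det W = emb M ^ n"
  using det_mult[OF V_carrier W_carrier] V_W by simp

text \<open>The trace is taken in an unknown basis b. The matrix \<open>BB\<close> of the conjugates
  of b transforms multiplication by x into a diagonal matrix with entries \<open>Ek (l k) h\<close>,
  so the trace is their sum once \<open>BB\<close> is known to be invertible.\<close>

lemma field_trace_K:
  assumes x: "x = Ek z h"
  shows "to_ac (field_trace K x) = (\<Sum>k<n. Ek (l k) h)"
proof -
  let ?R = "\<lambda>t. \<exists>n b A. is_basis K n b \<and> (\<forall>j<n. x * b j = (\<Sum>i<n. to_ac (A i j) * b i)) \<and> t = (\<Sum>i<n. A i i)"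
  have xK: "x \<in> K" using x by (simp add: K_def)
  have Kmult: "x * y \<in> K" if "y \<in> K" for y using K_subfield xK that by (auto simp: is_subfield_of_clos_def)
  have "\<exists>t. ?R t"
  proof -
    have "\<exists>c. x * z ^ j = (\<Sum>i<n. to_ac (c i) * z ^ i)" if "j < n" for j
      using power_basis Kmult[of "z ^ j"] that by (auto simp: is_basis_def)
    then obtain c where "\<And>j. j < n \<Longrightarrow> x * z ^ j = (\<Sum>i<n. to_ac (c j i) * z ^ i)" by metis
    hence "?R (\<Sum>i<n. c i i)" using power_basis
      by (intro exI[of _ n] exI[of _ "\<lambda>i. z ^ i"] exI[of _ "\<lambda>i j. c j i"]) auto
    thus ?thesis by blast
  qed
  hence "?R (field_trace K x)" unfolding field_trace_def by (rule someI_ex)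
  then obtain n' b A where "is_basis K n' b" and 
    "\<forall>j<n'. x * b j = (\<Sum>i<n'. to_ac (A i j) * b i)" and tr: "field_trace K x = (\<Sum>i<n'. A i i)"
    by blast
  moreover have n': "n' = n" using calculation(1) power_basis by (rule is_basis_card_unique)
  ultimately have B: "is_basis K n b" and xb: "\<And>j. j < n \<Longrightarrow> x * b j = (\<Sum>i<n. to_ac (A i j) * b i)" by auto
  have "\<exists>f. b j = Ek z f" if "j < n" for j using B that by (auto simp: is_basis_def K_def)
  then obtain f where f: "\<And>j. j < n \<Longrightarrow> b j = Ek z (f j)" by metis
  have "\<exists>c. z ^ i = (\<Sum>j<n. to_ac (c j) * b j)" if "i < n" for i
    using B that power_basis by (auto simp: is_basis_def)
  then obtain g where g: "\<And>i. i < n \<Longrightarrow> z ^ i = (\<Sum>j<n. to_ac (g i j) * b j)" by metis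
  have rel: "Ek (l k) h * Ek (l k) (f j) = (\<Sum>i<n. to_ac (A i j) * Ek (l k) (f i))" if kj: "k < n" "j < n" for k j
  proof -
    have "Ek z (h * f j - (\<Sum>i<n. smult (A i j) (f i))) = 0"
      using xb[OF kj(2)] f kj by (simp add: Ek_diff Ek_mult Ek_sum Ek_smult x)
    hence "Ek (l k) (h * f j - (\<Sum>i<n. smult (A i j) (f i))) = 0" by (rule Ek_conj[OF _ l_root[OF kj(1)]])
    thus ?thesis by (simp add: Ek_diff Ek_mult Ek_sum Ek_smult)
  qed
  have relg: "l k ^ i = (\<Sum>j<n. to_ac (g i j) * Ek (l k) (f j))" if ki: "k < n" "i < n" for k i
  proof -
    have "Ek z (monom 1 i - (\<Sum>j<n. smult (g i j) (f j))) = 0"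
      using g[OF ki(2)] f by (simp add: Ek_diff Ek_sum Ek_smult Ek_monom)
    hence "Ek (l k) (monom 1 i - (\<Sum>j<n. smult (g i j) (f j))) = 0" by (rule Ek_conj[OF _ l_root[OF ki(1)]])
    thus ?thesis by (simp add: Ek_diff Ek_sum Ek_smult Ek_monom)
  qed
  define BB where "BB = mat n n (\<lambda>(k,j). Ek (l k) (f j))"
  define G where "G = mat n n (\<lambda>(j,i). to_ac (g i j))"
  define AA where "AA = mat n n (\<lambda>(i,j). to_ac (A i j))"
  \<comment> \<open>An explicit inverse of \<open>BB\<close>: the change of basis gives
    \<open>BB * G = V\<close>, and by \<open>V_W\<close> the matrix W divided by M inverts
    V.\<close>
  define H where "H = G * (inverse (emb M) \<cdot>\<^sub>m W)"
  have carr3 [simp]: "BB \<in> carrier_mat n n" "G \<in> carrier_mat n n" "AA \<in> carrier_mat n n"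
    by (auto simp: BB_def G_def AA_def)
  have carrH [simp]: "H \<in> carrier_mat n n" unfolding H_def by (rule mult_carrier_mat[of _ n n]) auto
  note carr = carr3 carrH
  have BG: "BB * G = V"
  proof (rule eq_matI)
    fix k i assume "k < dim_row V" "i < dim_col V"
    hence ki: "k < n" "i < n" by (auto simp: V_def)
    thus "(BB * G) $$ (k, i) = V $$ (k, i)"
      using relg[OF ki] by (simp add: BB_def G_def V_def scalar_prod_def atLeast0LessThan mult.commute)
  qed (auto simp: V_def BB_def G_def)
  have "BB * H = (BB * G) * (inverse (emb M) \<cdot>\<^sub>m W)"
    unfolding H_def by (rule assoc_mult_mat[symmetric, of _ n n _ n _ n]) auto
  also have "\<dots> = inverse (emb M) \<cdot>\<^sub>m (V * W)" unfolding BG by (rule mult_smult_distrib[of _ n n _ n]) auto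
  also have "\<dots> = 1\<^sub>m n" unfolding V_W using M_nz by (intro eq_matI) auto
  finally have BH: "BB * H = 1\<^sub>m n" .
  hence HB: "H * BB = 1\<^sub>m n" by (rule mat_mult_left_right_inverse[OF carr(1,4)])
  have BA: "(BB * AA) $$ (k, i) = Ek (l k) h * BB $$ (k, i)" if ki: "k < n" "i < n" for k i
    using rel[OF ki] ki by (simp add: BB_def AA_def scalar_prod_def atLeast0LessThan mult.commute)
  have "AA = (H * BB) * AA" unfolding HB by (rule left_mult_one_mat[OF carr(3), symmetric])
  also have "\<dots> = H * (BB * AA)" by (rule assoc_mult_mat[of _ n n _ n _ n]) auto
  finally have AA: "AA = H * (BB * AA)" .
  have entry: "to_ac (A i i) = (\<Sum>k<n. H $$ (i, k) * (Ek (l k) h * BB $$ (k, i)))" if i: "i < n" for i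
  proof -
    have "to_ac (A i i) = AA $$ (i, i)" using i by (simp add: AA_def)
    also have "\<dots> = (H * (BB * AA)) $$ (i, i)" using AA by simp
    also have "\<dots> = (\<Sum>k<n. H $$ (i, k) * (BB * AA) $$ (k, i))"
      by (rule mat_mult_entry[OF carr(4) mult_carrier_mat[OF carr(1,3)] i i])
    also have "\<dots> = (\<Sum>k<n. H $$ (i, k) * (Ek (l k) h * BB $$ (k, i)))" using BA i by simp
    finally show ?thesis .
  qed
  have "to_ac (field_trace K x) = (\<Sum>i<n. to_ac (A i i))" unfolding tr n' by (rule to_ac_sum)
  also have "\<dots> = (\<Sum>i<n. \<Sum>k<n. H $$ (i, k) * (Ek (l k) h * BB $$ (k, i)))" by (intro sum.cong) (auto simp: entry)
  also have "\<dots> = (\<Sum>k<n. \<Sum>i<n. H $$ (i, k) * (Ek (l k) h * BB $$ (k, i)))" by (rule sum.swap)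
  also have "\<dots> = (\<Sum>k<n. Ek (l k) h * (\<Sum>i<n. BB $$ (k, i) * H $$ (i, k)))"
    by (simp add: sum_distrib_left mult_ac)
  also have "\<dots> = (\<Sum>k<n. Ek (l k) h)"
  proof (intro sum.cong refl)
    fix k assume "k \<in> {..<n}"
    hence k: "k < n" by simp
    have "(\<Sum>i<n. BB $$ (k, i) * H $$ (i, k)) = (BB * H) $$ (k, k)"
      by (rule mat_mult_entry[OF carr(1,4) k k, symmetric])
    also have "\<dots> = 1" unfolding BH using k by simp
    finally show "Ek (l k) h * (\<Sum>i<n. BB $$ (k, i) * H $$ (i, k)) = Ek (l k) h" by simp
  qed
  finally show ?thesis .
qed

lemma disc_power_basis: "to_ac (disc_tuple K (\<lambda>i. z ^ i)) = det V * det V"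
proof -
  have tr: "to_ac (field_trace K (z ^ i * z ^ j)) = (\<Sum>k<n. l k ^ i * l k ^ j)" for i j
  proof -
    have "z ^ i * z ^ j = Ek z (monom 1 (i + j))" by (simp add: Ek_monom power_add)
    from field_trace_K[OF this] show ?thesis by (simp add: Ek_monom power_add)
  qed
  have "to_ac (disc_tuple K (\<lambda>i. z ^ i)) = det_nat n (\<lambda>i j. to_ac (field_trace K (z ^ i * z ^ j)))"
    by (simp add: disc_tuple_def ext_degree_K det_nat_def to_ac_sum to_ac_prod)
  also have "\<dots> = det (mat n n (\<lambda>(i,j). \<Sum>k<n. l k ^ i * l k ^ j))"
    unfolding det_nat_eq_det tr ..
  also have "mat n n (\<lambda>(i,j). \<Sum>k<n. l k ^ i * l k ^ j) = transpose_mat V * V"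
    by (intro eq_matI) (auto simp: V_def scalar_prod_def atLeast0LessThan)
  also have "det \<dots> = det V * det V"
    by (simp add: det_mult[of _ n] det_transpose[of _ n])
  finally show ?thesis .
qed

text \<open>The powers of z have discriminant d = (det V)^2. As det V det W = M^n with det W
  integral, a prime R dividing d would make M^(2n)/R integral, hence a polynomial.\<close>

lemma disc_not_divisible:
  assumes R: "irreducible R" "\<not> R dvd M"
  shows "\<exists>d\<in>disc_ideal K. \<not> R dvd d"
proof -
  have zK: "z ^ i \<in> int_closure K" if "i < n" for i
    using power_basis that lam Phi_lc
    by (auto simp: int_closure_altdef is_basis_def integral_elem_def intro!: integral_elem_power[unfolded integral_elem_def])
  have iV: "integral_elem (det V)"
    by (rule integral_elem_det[OF V_carrier]) (auto simp: V_def intro!: integral_elem_power l_integral)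
  have iL: "integral_elem (coeff (Lag k) i)" for k i unfolding Lag_def
    by (intro integral_coeff_prod) (auto simp: coeff_pCons l_integral integral_elem_minus split: nat.splits)
  have iW: "integral_elem (det W)"
    by (rule integral_elem_det[OF W_carrier]) (auto simp: W_def intro!: integral_elem_add_mult iL l_integral)
  have "integral_elem (to_ac (disc_tuple K (\<lambda>i. z ^ i)))"
    unfolding disc_power_basis by (intro integral_elem_add_mult iV)
  then obtain d where d: "disc_tuple K (\<lambda>i. z ^ i) = to_fract d" by (rule integral_fract)
  have din: "d \<in> disc_ideal K"
    unfolding disc_ideal_def mem_Collect_eq
    by (intro exI[of _ 1] exI[of _ "\<lambda>_. 1"] exI[of _ "\<lambda>_ i. z ^ i"]) (auto simp: ext_degree_K zK d)
  have ed: "emb d = det V * det V" using disc_power_basis d by (simp add: emb_def)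
  have "\<not> R dvd d"
  proof
    assume "R dvd d"
    then obtain e where e: "d = R * e" by (elim dvdE)
    have R0: "R \<noteq> 0" using R by auto
    have "emb R * (emb e * (det W * det W)) = (det V * det V) * (det W * det W)" by (simp flip: ed add: e mult.assoc)
    also have "\<dots> = (det V * det W) * (det V * det W)" by (simp only: mult_ac)
    also have "\<dots> = emb (M ^ (2 * n))" by (simp add: det_V_W mult_2 power_add)
    finally have eq: "emb R * (emb e * (det W * det W)) = emb (M ^ (2 * n))" .
    have "to_ac (to_fract (M ^ (2 * n)) / to_fract R) = emb e * (det W * det W)"
      using eq R0 by (simp add: emb_def field_simps)
    moreover have "integral_elem (emb e * (det W * det W))" by (intro integral_elem_add_mult iW integral_elem_emb)
    ultimately have "integral_elem (to_ac (to_fract (M ^ (2 * n)) / to_fract R))" by simp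
    then obtain p where "to_fract (M ^ (2 * n)) / to_fract R = to_fract p" by (rule integral_fract)
    hence "to_fract (M ^ (2 * n)) = to_fract (R * p)" using R0 by (simp add: field_simps)
    hence "M ^ (2 * n) = R * p" by (simp only: to_fract_eq_iff)
    hence "R dvd M" using irreducible_dvd_power[OF R(1), of M "2 * n"] by simp
    thus False using R(2) by simp
  qed
  thus ?thesis using din by blast
qed

end

lemma disc_rel_prime_K:
  assumes "\<And>R. irreducible R \<Longrightarrow> R dvd g \<Longrightarrow> \<not> R dvd M"
  shows "disc_rel_prime K g"
proof -
  obtain l where "map_poly emb Phi = (\<Prod>i<n. [:- l i, 1:])" by (rule conjugates_exist)
  from disc_not_divisible[OF this] show ?thesis using assms unfolding disc_rel_prime_def by blast
qed

end

section \<open>Quotients by principal ideals\<close>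

text \<open>A common form of the rings F_q[t] and O_K, so that the quotients of both are treated in
  one locale.\<close>

definition type_subring :: "'b::comm_ring_1 set \<Rightarrow> 'b ring" where
  "type_subring S = \<lparr>carrier = S, monoid.mult = (*), one = 1, ring.zero = 0, add = (+)\<rparr>"

lemma type_subring_simps [simp]:
  "carrier (type_subring S) = S" "monoid.mult (type_subring S) = (*)" "one (type_subring S) = 1"
  "ring.zero (type_subring S) = 0" "add (type_subring S) = (+)"
  by (simp_all add: type_subring_def)

locale principal_quotient =
  fixes S :: "'b::comm_ring_1 set" and \<alpha> :: 'b
  assumes S0: "0 \<in> S" and S1: "1 \<in> S" and Sadd: "x \<in> S \<Longrightarrow> y \<in> S \<Longrightarrow> x + y \<in> S"
    and Sminus: "x \<in> S \<Longrightarrow> - x \<in> S" and Smult: "x \<in> S \<Longrightarrow> y \<in> S \<Longrightarrow> x * y \<in> S" and \<alpha>: "\<alpha> \<in> S"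
begin

abbreviation R :: "'b ring" where "R \<equiv> type_subring S"
definition I :: "'b set" where "I = {\<alpha> * x | x. x \<in> S}"

sublocale R: cring R
  by (intro cringI abelian_groupI comm_monoidI)
    (auto simp: S0 S1 Sadd Smult algebra_simps intro!: bexI[of _ "- _"] Sminus)

lemma R_minus: "x \<in> S \<Longrightarrow> \<ominus>\<^bsub>R\<^esub> x = - x"
  by (rule R.minus_equality) (auto simp: Sminus)

lemma ideal_I: "ideal I R"
proof (rule idealI[OF R.ring_axioms])
  show "subgroup I (add_monoid R)"
  proof (rule group.subgroupI[OF R.a_group])
    show "I \<subseteq> carrier (add_monoid R)" using \<alpha> Smult by (auto simp: I_def)
    show "I \<noteq> {}" using S0 by (auto simp: I_def)
    show "inv\<^bsub>add_monoid R\<^esub> a \<in> I" if aI: "a \<in> I" for a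
    proof -
      obtain x where x: "a = \<alpha> * x" "x \<in> S" using aI by (auto simp: I_def)
      have "inv\<^bsub>add_monoid R\<^esub> a = - a" using R_minus[of a] x \<alpha> Smult by (simp add: a_inv_def)
      thus ?thesis using x Sminus by (auto simp: I_def intro!: exI[of _ "- x"])
    qed
    show "a \<otimes>\<^bsub>add_monoid R\<^esub> b \<in> I" if aI: "a \<in> I" "b \<in> I" for a b
    proof -
      obtain x y where "a = \<alpha> * x" "x \<in> S" "b = \<alpha> * y" "y \<in> S" using aI by (auto simp: I_def)
      thus ?thesis using Sadd by (auto simp: I_def distrib_left intro!: exI[of _ "x + y"])
    qed
  qed
  fix a x assume a: "a \<in> I" and x: "x \<in> carrier R"
  obtain y where y: "a = \<alpha> * y" "y \<in> S" using a by (auto simp: I_def)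
  have "x * a = \<alpha> * (x * y)" "a * x = \<alpha> * (x * y)" using y by (simp_all add: mult_ac)
  moreover have "\<alpha> * (x * y) \<in> I" using x y Smult unfolding I_def by auto
  ultimately show "x \<otimes>\<^bsub>R\<^esub> a \<in> I" "a \<otimes>\<^bsub>R\<^esub> x \<in> I" by (simp_all only: type_subring_simps)
qed

sublocale I: ideal I R by (rule ideal_I)

lemma carrier_quot: "carrier (R Quot I) = (\<lambda>a. I +>\<^bsub>R\<^esub> a) ` S"
  by (auto simp: FactRing_def A_RCOSETS_def')

lemma coset_eq_iff:
  assumes "a \<in> S" "b \<in> S" shows "I +>\<^bsub>R\<^esub> a = I +>\<^bsub>R\<^esub> b \<longleftrightarrow> a - b \<in> I"
proof -
  have "I +>\<^bsub>R\<^esub> a = I +>\<^bsub>R\<^esub> b \<longleftrightarrow> a \<ominus>\<^bsub>R\<^esub> b \<in> I"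
    using R.quotient_eq_iff_same_a_r_cos[OF ideal_I, of a b] assms by auto
  thus ?thesis using assms by (simp add: a_minus_def R_minus)
qed

lemma coset_pow: assumes "a \<in> S" shows "(I +>\<^bsub>R\<^esub> a) [^]\<^bsub>R Quot I\<^esub> (k::nat) = I +>\<^bsub>R\<^esub> (a ^ k)"
proof -
  interpret h: ring_hom_ring R "R Quot I" "(+>\<^bsub>R\<^esub>) I" by (rule I.rcos_ring_hom_ring)
  have pw: "a [^]\<^bsub>R\<^esub> k = a ^ k" by (induction k) (simp_all add: mult.commute)
  have "(I +>\<^bsub>R\<^esub> a) [^]\<^bsub>R Quot I\<^esub> k = I +>\<^bsub>R\<^esub> (a [^]\<^bsub>R\<^esub> k)" using h.hom_nat_pow[of a k] assms by simp
  thus ?thesis by (simp add: pw)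
qed

lemma pow_in_S: "a \<in> S \<Longrightarrow> a ^ k \<in> S" by (induction k) (auto intro: S1 Smult)

lemma carmichael_iff:
  "carmichael_ideal R I \<longleftrightarrow> finite (carrier (R Quot I)) \<and> \<not> Ring.field (R Quot I) \<and>
    (\<forall>a\<in>S. a ^ card (carrier (R Quot I)) - a \<in> I)"
  unfolding carmichael_ideal_def carmichael_ring_def
  by (auto simp: carrier_quot coset_pow coset_eq_iff pow_in_S)

lemma quot_fieldI:
  assumes one: "1 \<notin> I" and inv: "\<And>a. a \<in> S \<Longrightarrow> a \<notin> I \<Longrightarrow> \<exists>b\<in>S. a * b - 1 \<in> I"
  shows "Ring.field (R Quot I)"
proof -
  have "maximalideal I R"
  proof (rule maximalidealI[OF ideal_I])
    show "carrier R \<noteq> I" using one S1 by auto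
    fix J assume J: "ideal J R" "I \<subseteq> J" "J \<subseteq> carrier R"
    interpret J: ideal J R by fact
    show "J = I \<or> J = carrier R"
    proof (cases "J = I")
      case False
      then obtain a where a: "a \<in> J" "a \<notin> I" using J(2) by blast
      hence aS: "a \<in> S" using J(3) by auto
      obtain b where b: "b \<in> S" "a * b - 1 \<in> I" using inv[OF aS a(2)] by blast
      have "a * b \<in> J" using J.I_r_closed[OF a(1), of b] b by simp
      moreover have "a * b - 1 \<in> J" using b J(2) by blast
      hence "\<ominus>\<^bsub>R\<^esub> (a * b - 1) \<in> J" and "a * b - 1 \<in> S" using J.a_inv_closed J(3) by auto
      hence "- (a * b - 1) \<in> J" by (simp only: R_minus)
      ultimately have "a * b + - (a * b - 1) \<in> J" using J.a_closed[of "a * b" "- (a * b - 1)"] by simp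
      hence "1 \<in> J" by simp
      hence "J = carrier R" using J.one_imp_carrier by simp
      thus ?thesis ..
    qed simp
  qed
  thus ?thesis by (rule maximalideal.quotient_is_field[OF _ R.cring_axioms])
qed

lemma quot_not_fieldI:
  assumes ab: "a \<in> S" "b \<in> S" "a * b \<in> I" "a \<notin> I" "b \<notin> I"
  shows "\<not> Ring.field (R Quot I)"
proof
  assume "Ring.field (R Quot I)"
  then interpret Q: Ring.field "R Quot I" .
  have z: "\<zero>\<^bsub>R Quot I\<^esub> = I +>\<^bsub>R\<^esub> 0"
    using R.a_coset_add_zero[OF I.a_subset] by (simp add: FactRing_def)
  have c: "I +>\<^bsub>R\<^esub> x \<in> carrier (R Quot I)" if "x \<in> S" for x using that by (simp add: carrier_quot)
  have iff0: "I +>\<^bsub>R\<^esub> x = \<zero>\<^bsub>R Quot I\<^esub> \<longleftrightarrow> x \<in> I" if "x \<in> S" for x unfolding z using coset_eq_iff[OF that S0] by simp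
  have "(I +>\<^bsub>R\<^esub> a) \<otimes>\<^bsub>R Quot I\<^esub> (I +>\<^bsub>R\<^esub> b) = I +>\<^bsub>R\<^esub> (a * b)"
    using I.rcoset_mult_add[of a b] ab by (simp add: FactRing_def)
  also have "\<dots> = \<zero>\<^bsub>R Quot I\<^esub>" using iff0[of "a * b"] ab Smult by simp
  finally have "I +>\<^bsub>R\<^esub> a = \<zero>\<^bsub>R Quot I\<^esub> \<or> I +>\<^bsub>R\<^esub> b = \<zero>\<^bsub>R Quot I\<^esub>"
    using Q.integral c ab by blast
  thus False using iff0 ab by blast
qed

lemma card_quot:
  assumes T: "finite T" "T \<subseteq> S" and surj: "\<And>a. a \<in> S \<Longrightarrow> \<exists>t\<in>T. a - t \<in> I"
    and inj: "\<And>t u. t \<in> T \<Longrightarrow> u \<in> T \<Longrightarrow> t - u \<in> I \<Longrightarrow> t = u"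
  shows "finite (carrier (R Quot I))" "card (carrier (R Quot I)) = card T"
proof -
  have eq: "carrier (R Quot I) = (\<lambda>a. I +>\<^bsub>R\<^esub> a) ` T"
  proof
    show "carrier (R Quot I) \<subseteq> (\<lambda>a. I +>\<^bsub>R\<^esub> a) ` T"
    proof
      fix c assume "c \<in> carrier (R Quot I)"
      then obtain a where a: "c = I +>\<^bsub>R\<^esub> a" "a \<in> S" by (auto simp: carrier_quot)
      obtain t where t: "t \<in> T" "a - t \<in> I" using surj[OF a(2)] by blast
      hence "c = I +>\<^bsub>R\<^esub> t" using a T(2) coset_eq_iff[of a t] by auto
      thus "c \<in> (\<lambda>a. I +>\<^bsub>R\<^esub> a) ` T" using t by blast
    qed
    show "(\<lambda>a. I +>\<^bsub>R\<^esub> a) ` T \<subseteq> carrier (R Quot I)" using T(2) by (auto simp: carrier_quot)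
  qed
  have "inj_on (\<lambda>a. I +>\<^bsub>R\<^esub> a) T"
  proof (rule inj_onI)
    fix t u assume tu: "t \<in> T" "u \<in> T" "I +>\<^bsub>R\<^esub> t = I +>\<^bsub>R\<^esub> u"
    hence "t - u \<in> I" using coset_eq_iff[of t u] T(2) by auto
    thus "t = u" using inj tu by blast
  qed
  thus "finite (carrier (R Quot I))" "card (carrier (R Quot I)) = card T"
    unfolding eq using T(1) by (simp_all add: card_image)
qed

end

section \<open>Square-free polynomials that are not Carmichael\<close>

lemma poly_quotient: "principal_quotient (UNIV :: 'a::{finite,field} poly set) g"
  by unfold_locales auto

lemma carmichael_poly_eq:
  "carmichael_poly g \<longleftrightarrow> carmichael_ideal (type_subring UNIV) (principal_quotient.I UNIV g)"
proof -
  interpret principal_quotient "UNIV :: 'a poly set" g by (rule poly_quotient)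
  have "(ring_of_type_algebra :: 'a poly ring) = type_subring UNIV"
    by (simp add: ring_of_type_algebra_def type_subring_def)
  thus ?thesis by (simp add: carmichael_poly_def I_def)
qed

lemma squarefree_dvdI:
  fixes g A :: "'a::field poly"
  assumes "squarefree g" "g \<noteq> 0" "\<And>Q. irreducible Q \<Longrightarrow> Q dvd g \<Longrightarrow> Q dvd A"
  shows "g dvd A"
  using assms
proof (induction "degree g" arbitrary: g rule: less_induct)
  case less
  show ?case
  proof (cases "degree g = 0")
    case True
    hence "is_unit g" using less.prems by (simp add: is_unit_iff_degree)
    thus ?thesis by (rule unit_imp_dvd)
  next
    case False
    hence "degree g > 0" by simp
    then obtain Q where Q: "irreducible Q" "lead_coeff Q = 1" "Q dvd g" by (rule exists_monic_irreducible_factor)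
    then obtain g1 where g1: "g = Q * g1" by (elim dvdE)
    have nz: "Q \<noteq> 0" "g1 \<noteq> 0" using g1 less.prems by auto
    have nd: "\<not> Q dvd g1"
    proof
      assume "Q dvd g1"
      hence "Q ^ 2 dvd g" unfolding g1 power2_eq_square by (rule mult_dvd_mono[OF dvd_refl])
      thus False using less.prems(1) Q(1) by (auto simp: squarefree_def)
    qed
    have "squarefree g1" using less.prems(1) unfolding g1 squarefree_def by (metis dvd_mult)
    moreover have "degree g1 < degree g" unfolding g1 using nz irreducible_poly_degree_pos[OF Q(1)] by (simp add: degree_mult_eq)
    ultimately have "g1 dvd A" using less.hyps[of g1] less.prems(3) nz g1 by (metis dvd_mult)
    then obtain B where B: "A = g1 * B" by (elim dvdE)
    have "Q dvd A" using less.prems(3) Q by blast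
    hence "Q dvd B" using nd irreducible_dvd_mult_iff[OF Q(1)] B by blast
    thus ?thesis unfolding B g1 by (metis mult.commute mult_dvd_mono dvd_refl)
  qed
qed

lemma root_in_ac:
  assumes "irreducible (Q :: 'a::{finite,field} poly)" obtains \<beta> where "ac.ev \<beta> Q = 0"
  using alg_closed_imp_poly_has_root[of "map_poly to_ac Q"] irreducible_poly_degree_pos[OF assms]
  by (auto simp: ac.ev_def)

lemma (in fq_algebra) frob_period_mult:
  "(y :: 'b) ^ (q ^ r) = y \<Longrightarrow> y ^ (q ^ (r * k)) = y"
  by (induction k) (simp_all add: power_add power_mult)

text \<open>For reducible g the quotient is not a field, so some A violates A^(q^deg g) = A modulo g
  and, as g is square-free, already modulo a prime factor R. If deg R divided deg g, this power map
  would be the identity modulo R.\<close>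

lemma not_carmichael_poly_cases:
  fixes g :: "'a::{finite,field} poly"
  assumes g: "degree g > 0" "squarefree g" "\<not> carmichael_poly g"
  obtains P where "P \<in> monic_irr" "P dvd g" "irreducible g \<or> \<not> degree P dvd degree g"
proof -
  have g0: "g \<noteq> 0" using g(1) by auto
  interpret Q: principal_quotient "UNIV :: 'a poly set" g by (rule poly_quotient)
  have II: "x \<in> Q.I \<longleftrightarrow> g dvd x" for x by (auto simp: Q.I_def dvd_def)
  show ?thesis
  proof (cases "irreducible g")
    case True
    then show ?thesis using that exists_monic_irreducible_factor[OF g(1)] by (metis (mono_tags) mem_Collect_eq monic_irr_def)
  next
    case False
    have "\<not> is_unit g" using g(1) g0 by (simp add: is_unit_iff_degree)
    then obtain a b where ab: "g = a * b" "\<not> is_unit a" "\<not> is_unit b"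
      using False g0 by (auto simp: irreducible_def)
    have nz: "a \<noteq> 0" "b \<noteq> 0" using ab(1) g0 by auto
    have pos: "degree a > 0" "degree b > 0" using ab nz by (auto simp: is_unit_iff_degree)
    have deg: "degree g = degree a + degree b" unfolding ab(1) using nz by (rule degree_mult_eq)
    have nf: "\<not> Ring.field (Q.R Quot Q.I)"
    proof (rule Q.quot_not_fieldI)
      show "a * b \<in> Q.I" unfolding II by (simp flip: ab(1))
      show "a \<notin> Q.I" "b \<notin> Q.I" unfolding II using dvd_imp_degree_le[of g a] dvd_imp_degree_le[of g b] nz pos deg by auto
    qed auto
    let ?T = "{p :: 'a poly. degree p < degree g}"
    have cT: "card ?T = CARD('a) ^ degree g" "finite ?T" using card_polys_degree_less[OF g(1), where 'a='a] by auto
    have surj: "\<exists>t\<in>?T. p - t \<in> Q.I" for p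
    proof -
      have "degree (p mod g) < degree g" using degree_mod_less[OF g0, of p] g(1) by auto
      moreover have "g dvd p - p mod g" by (simp add: minus_mod_eq_mult_div)
      ultimately show ?thesis by (auto simp: II)
    qed
    have inj: "t = u" if "t \<in> ?T" "u \<in> ?T" "t - u \<in> Q.I" for t u
    proof -
      have "degree (t - u) < degree g" using that by (simp add: degree_diff_less)
      thus ?thesis using that(3) unfolding II by (metis dvd_imp_degree_le eq_iff_diff_eq_0 not_less)
    qed
    have cq: "finite (carrier (Q.R Quot Q.I))" "card (carrier (Q.R Quot Q.I)) = card ?T"
      by (rule Q.card_quot[OF cT(2) subset_UNIV surj], erule (2) inj)+
    have "\<not> (\<forall>a. g dvd a ^ (CARD('a) ^ degree g) - a)"
      using g(3) unfolding carmichael_poly_eq Q.carmichael_iff cq(2) cT(1) II using nf cq(1) by simp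
    then obtain A where A: "\<not> g dvd A ^ (CARD('a) ^ degree g) - A" by blast
    then obtain R where R: "irreducible R" "R dvd g" "\<not> R dvd A ^ (CARD('a) ^ degree g) - A"
      using squarefree_dvdI[OF g(2) g0] by metis
    obtain \<beta> where \<beta>: "ac.ev \<beta> R = 0" by (rule root_in_ac[OF R(1)])
    have nd: "\<not> degree R dvd degree g"
    proof
      assume "degree R dvd degree g"
      then obtain k where k: "degree g = degree R * k" by (elim dvdE)
      have "ac.ev \<beta> A ^ (CARD('a) ^ degree g) = ac.ev \<beta> A"
        unfolding k by (rule ac.frob_period_mult[OF ac.ev_frob_period[OF R(1) \<beta>]])
      hence "ac.ev \<beta> (A ^ (CARD('a) ^ degree g) - A) = 0" by simp
      thus False using R(3) ac.ev_eq_0_iff[OF R(1) \<beta>] by blast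
    qed
    \<comment> \<open>The factor R need not be monic; its monic associate has the same
      degree.\<close>
    have "degree R > 0" using R(1) by (rule irreducible_poly_degree_pos)
    then obtain P where P: "irreducible P" "lead_coeff P = 1" "P dvd R" by (rule exists_monic_irreducible_factor)
    have "degree P = degree R"
    proof -
      obtain c where c: "R = P * c" using P(3) by (elim dvdE)
      have "is_unit c" using R(1) P(1) c by (metis irreducible_def)
      hence "degree c = 0" using is_unit_iff_degree[of c] by (cases "c = 0") auto
      moreover have "P \<noteq> 0" "c \<noteq> 0" using c R(1) by auto
      ultimately show ?thesis using c by (simp add: degree_mult_eq)
    qed
    thus ?thesis using that[of P] P R(2) nd by (auto simp: monic_irr_def intro: dvd_trans)
  qed
qed

section \<open>Carmichael ideals of cyclotomic function fields\<close>

lemma finite_mult_closed_power: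
  fixes Y :: "'b::field set"
  assumes fin: "finite Y" and z: "0 \<in> Y" and mult: "\<And>x y. x \<in> Y \<Longrightarrow> y \<in> Y \<Longrightarrow> x * y \<in> Y" and y: "y \<in> Y" "y \<noteq> 0"
  shows "y ^ (card Y - 1) = 1"
proof -
  let ?U = "Y - {0}"
  have inj: "inj_on ((*) y) ?U" using y by (auto simp: inj_on_def)
  have "(*) y ` ?U = ?U"
    by (rule card_subset_eq) (use fin y mult inj in \<open>auto simp: card_image\<close>)
  hence "prod id ?U = prod id ((*) y ` ?U)" by simp
  also have "\<dots> = (\<Prod>x\<in>?U. y * x)" using inj by (simp add: prod.reindex)
  also have "\<dots> = y ^ (card Y - 1) * prod id ?U"
    using z fin by (simp add: prod.distrib card_Diff_singleton)
  finally have "prod id ?U * 1 = prod id ?U * y ^ (card Y - 1)" by (simp add: mult.commute)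
  moreover have "prod id ?U \<noteq> 0" using fin by (subst prod_zero_iff) auto
  ultimately show ?thesis by (metis mult_left_cancel)
qed

locale inert_prime_dividing = inert_prime P M z n
  for P M :: "'a::{finite,field} poly" and z :: "'a clos" and n :: nat +
  fixes g :: "'a poly"
  assumes g: "degree g > 0" "P dvd g" and gM: "\<And>R. irreducible R \<Longrightarrow> R dvd g \<Longrightarrow> \<not> R dvd M"
begin

abbreviation OK where "OK \<equiv> int_closure K"

lemma g_nz: "g \<noteq> 0" using g by auto

lemma OK_iff: "x \<in> OK \<longleftrightarrow> x \<in> K \<and> integral_elem x" by (simp add: int_closure_altdef)

lemma z_integral: "integral_elem z" unfolding integral_elem_def using lam Phi_lc by blast

lemma E_in_OK: "E f \<in> OK" using E_in_K integral_elem_poly[OF z_integral] by (simp add: OK_iff)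

lemma emb_in_OK: "emb c \<in> OK" using E_in_OK[of "[:c:]"] by (simp only: E_const)

lemma OK_quotient: "principal_quotient OK (emb g)"
proof unfold_locales
  have K: "0 \<in> K" "1 \<in> K" "x \<in> K \<Longrightarrow> y \<in> K \<Longrightarrow> x + y \<in> K \<and> x - y \<in> K \<and> x * y \<in> K" for x y
    using K_subfield by (auto simp: is_subfield_of_clos_def)
  show "0 \<in> OK" "1 \<in> OK" using K by (auto simp: OK_iff)
  show "emb g \<in> OK" by (rule emb_in_OK)
  fix x y assume x: "x \<in> OK"
  show "- x \<in> OK" using x K(3)[of 0 x] K(1) by (auto simp: OK_iff integral_elem_minus)
  assume y: "y \<in> OK"
  show "x + y \<in> OK" "x * y \<in> OK" using x y K(3)[of x y] by (auto simp: OK_iff intro: integral_elem_add_mult)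
qed

sublocale Q: principal_quotient OK "emb g" by (rule OK_quotient)

lemma carmichael_in_iff: "carmichael_in K (emb g) \<longleftrightarrow> carmichael_ideal Q.R Q.I"
  by (simp add: carmichael_in_def Q.I_def OK_ring_def type_subring_def)

text \<open>At the primes dividing \<open>g\<close> the order generated by \<open>z\<close> is already maximal: if a prime \<open>R\<close> divided a
  minimal denominator of the integral element \<open>x = f(z) / c\<close>, then \<open>f\<close> would be nilpotent modulo \<open>R\<close>, hence
  vanish at all roots of the separable polynomial \<open>\<Phi>\<close> modulo \<open>R\<close>.\<close>

lemma localization:
  assumes x: "x \<in> OK"
  obtains s F u v where "emb s * x = E F" "u * s + v * g = 1"
proof -
  have xK: "x \<in> K" and xi: "integral_elem x" using x by (auto simp: OK_iff)
  let ?S = "\<lambda>c. c \<noteq> 0 \<and> (\<exists>F. degree F < n \<and> emb c * x = E F)"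
  obtain c0 where c0: "?S c0" using K_repr_integral[OF xK] by metis
  define c where "c = (ARG_MIN degree c. ?S c)"
  have c: "?S c" and cmin: "\<And>c'. ?S c' \<Longrightarrow> degree c \<le> degree c'"
    using arg_min_natI[of ?S c0 degree] arg_min_nat_le[of ?S _ degree] c0 unfolding c_def by auto
  obtain F where F: "degree F < n" "emb c * x = E F" using c by blast
  have nocommon: "\<not> R dvd c" if R: "irreducible R" "R dvd g" for R
  proof
    assume Rc: "R dvd c"
    then obtain c' where c': "c = R * c'" by (elim dvdE)
    have R0: "R \<noteq> 0" using R by auto
    obtain \<beta> where \<beta>: "ac.ev \<beta> R = 0" by (rule root_in_ac[OF R(1)])
    have evc: "ac.ev \<beta> c = 0" using ac.ev_eq_0_iff[OF R(1) \<beta>] Rc by blast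
    have evM: "ac.ev \<beta> M \<noteq> 0" by (rule ac_M_nz[OF R(1) \<beta> gM[OF R]])
    \<comment> \<open>Otherwise R could be cancelled from numerator and denominator, against the
      minimality of c.\<close>
    have redF: "ac.red \<beta> F \<noteq> 0"
    proof
      assume "ac.red \<beta> F = 0"
      then obtain F' where F': "F = smult R F'" by (rule ac.red_eq_0_smult[OF R(1) \<beta>])
      have "emb R * (emb c' * x) = emb R * E F'" using F(2) unfolding c' F' E_smult by (simp add: mult.assoc)
      hence "emb c' * x = E F'" using R0 by simp
      moreover have "c' \<noteq> 0" using c c' by auto
      moreover have "degree F' < n" using F(1) R0 by (simp add: F')
      ultimately have "degree c \<le> degree c'" by (intro cmin) auto
      thus False using c' R0 \<open>c' \<noteq> 0\<close> irreducible_poly_degree_pos[OF R(1)] by (simp add: degree_mult_eq)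
    qed
    let ?G = "ac.red \<beta> Phi"
    have G0: "?G \<noteq> 0" and dG: "degree ?G = n"
      using ac.red_Phi_monic[OF M_irr(2), of \<beta>] n_pos by (auto simp: n_eq)
    have sep: "poly (pderiv ?G) \<mu> \<noteq> 0" if "poly ?G \<mu> = 0" for \<mu>
      using ac.Phi_pderiv[of \<beta> M \<mu>] that evM by auto
    have "card {\<mu>. poly ?G \<mu> = 0} = n" using distinct_roots_of_pderiv(1)[OF G0 sep] dG by simp
    have "\<exists>\<mu>. poly ?G \<mu> = 0 \<and> poly (ac.red \<beta> F) \<mu> \<noteq> 0"
    proof (rule ccontr)
      assume "\<not> ?thesis"
      hence "card {\<mu>. poly ?G \<mu> = 0} \<le> degree (ac.red \<beta> F)" by (intro card_roots_le[OF redF]) auto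
      also have "\<dots> \<le> degree F" by (rule map_poly_degree_leq)
      finally show False using F(1) \<open>card {\<mu>. poly ?G \<mu> = 0} = n\<close> by simp
    qed
    then obtain \<mu> where \<mu>: "poly ?G \<mu> = 0" "poly (ac.red \<beta> F) \<mu> \<noteq> 0" by blast
    obtain a b where ab: "a > 0" "x ^ a = (\<Sum>k<a. emb (b k) * x ^ k)" by (rule integral_elem_power_eq[OF xi])
    \<comment> \<open>Multiplied by c^a, the integral equation of x writes F(z)^a with coefficients
      divisible by c, hence by R; so F^a vanishes at \<open>\<mu>\<close> modulo R.\<close>
    have "E (F ^ a) = emb c ^ a * x ^ a" unfolding E_pow by (simp flip: F(2) power_mult_distrib)
    also have "\<dots> = (\<Sum>k<a. emb (b k) * (emb c ^ a * x ^ k))" unfolding ab(2) by (simp add: sum_distrib_left mult.left_commute)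
    also have "\<dots> = (\<Sum>k<a. E (smult (b k * c ^ (a - k)) (F ^ k)))"
    proof (intro sum.cong refl)
      fix k assume "k \<in> {..<a}"
      hence "emb c ^ a = emb c ^ (a - k) * emb c ^ k" by (simp flip: power_add)
      thus "emb (b k) * (emb c ^ a * x ^ k) = E (smult (b k * c ^ (a - k)) (F ^ k))"
        unfolding E_smult E_pow by (simp flip: F(2) add: power_mult_distrib mult.assoc)
    qed
    also have "\<dots> = E (\<Sum>k<a. smult (b k * c ^ (a - k)) (F ^ k))" by (simp only: embp.hom_sum poly_sum)
    finally have "E (F ^ a - (\<Sum>k<a. smult (b k * c ^ (a - k)) (F ^ k))) = 0" by (simp only: E_diff) simp
    hence "poly (ac.red \<beta> (F ^ a - (\<Sum>k<a. smult (b k * c ^ (a - k)) (F ^ k)))) \<mu> = 0"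
      by (rule red_root_of_E_eq_0[OF _ \<mu>(1)])
    moreover have "ac.red \<beta> (\<Sum>k<a. smult (b k * c ^ (a - k)) (F ^ k)) = 0"
      unfolding ac.red_sum by (intro sum.neutral ballI) (simp add: evc)
    ultimately have "poly (ac.red \<beta> F) \<mu> ^ a = 0" by simp
    thus False using \<mu>(2) by simp
  qed
  have unit: "is_unit D" if D: "D dvd c" "D dvd g" for D
  proof (rule ccontr)
    assume "\<not> is_unit D"
    moreover have "D \<noteq> 0" using D(2) g_nz by auto
    ultimately have "degree D > 0" by (simp add: is_unit_iff_degree)
    then obtain R where "irreducible R" "lead_coeff R = 1" "R dvd D" by (rule exists_monic_irreducible_factor)
    thus False using nocommon D by (meson dvd_trans)
  qed
  obtain u v where "u * c + v * g = 1" by (rule poly_bezout[OF g_nz]) (rule unit)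
  thus ?thesis by (rule that[OF F(2)])
qed

section \<open>Representatives modulo g\<close>

lemma I_iff: "x \<in> Q.I \<longleftrightarrow> (\<exists>y\<in>OK. x = emb g * y)" by (auto simp: Q.I_def)

lemma OK_mult: "x \<in> OK \<Longrightarrow> y \<in> OK \<Longrightarrow> x * y \<in> OK" by (rule Q.Smult)

lemma OK_mod_g:
  assumes x: "x \<in> OK" obtains F where "x - E F \<in> Q.I"
proof -
  obtain s F u v where sF: "emb s * x = E F" "u * s + v * g = 1" by (rule localization[OF x])
  have "x = emb (u * s + v * g) * x" by (simp only: sF(2)) simp
  also have "\<dots> = E (smult u F) + emb g * (emb v * x)" unfolding E_smult sF(1)[symmetric] by (simp add: algebra_simps)
  finally have "x - E (smult u F) = emb g * (emb v * x)" by (simp add: algebra_simps)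
  moreover have "emb v * x \<in> OK" by (intro OK_mult emb_in_OK x)
  ultimately have "x - E (smult u F) \<in> Q.I" unfolding I_iff by blast
  thus ?thesis by (rule that)
qed

text \<open>The cofactor y of g need not lie in F_q[t][z], but s y does for some s invertible modulo
  g; membership thus becomes an identity between polynomials in z.\<close>

lemma E_in_I:
  assumes "E F \<in> Q.I" obtains s G u v where "E (smult s F - smult g G) = 0" "u * s + v * g = 1"
proof -
  obtain y where y: "y \<in> OK" "E F = emb g * y" using assms by (auto simp: I_iff)
  obtain s G u v where sG: "emb s * y = E G" "u * s + v * g = 1" by (rule localization[OF y(1)])
  have "E (smult s F - smult g G) = 0" unfolding E_diff E_smult y(2) sG(1)[symmetric] by (simp add: mult.left_commute)
  thus ?thesis using sG(2) by (rule that)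
qed

text \<open>Representatives of F_q[t][z] modulo a polynomial of degree D: powers of z below n,
  coefficients of degree below D. Both D = deg g, for O_K/(g), and D = deg P, for the residue field,
  occur.\<close>

definition box :: "nat \<Rightarrow> 'a poly poly set" where
  "box D = {F. (\<forall>i. coeff F i \<in> {c. degree c < D}) \<and> (\<forall>i\<ge>n. coeff F i = 0)}"

lemma box_card: 
  assumes D: "D > 0" shows "card (box D) = CARD('a) ^ (D * n)"
  unfolding box_def using card_polys_with_coeffs(1)[OF card_polys_degree_less(2)[OF D, where 'a='a], of n]
    card_polys_degree_less(1)[OF D, where 'a='a] D by (simp add: power_mult)

lemma box_finite: 
  assumes D: "D > 0" shows "finite (box D)"
  unfolding box_def using card_polys_with_coeffs(2)[OF card_polys_degree_less(2)[OF D, where 'a='a], of n] D by simp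

lemma box_degree: "F \<in> box D \<Longrightarrow> degree F < n"
  using degree_less_iff_coeff[OF n_pos] by (auto simp: box_def)

lemma box_coeff: "F \<in> box D \<Longrightarrow> degree (coeff F i) < D" by (auto simp: box_def)

lemma box_mod:
  assumes D: "D = degree r" "D > 0"
  obtains T G where "T \<in> box D" "E F = E T + emb r * E G"
proof -
  have r0: "r \<noteq> 0" using D by auto
  obtain Q R where QR: "F = Phi * Q + R" "degree R < n" by (rule divide_by_Phi)
  let ?T = "map_poly (\<lambda>c. c mod r) R" and ?G = "map_poly (\<lambda>c. c div r) R"
  have R: "R = ?T + smult r ?G" by (rule poly_eqI) (simp add: coeff_map_poly)
  have "?T \<in> box D" unfolding box_def
  proof (intro CollectI conjI allI impI)
    fix i show "degree (coeff ?T i) < D" using degree_mod_less[OF r0, of "coeff R i"] D by (auto simp: coeff_map_poly)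
    assume "i \<ge> n" thus "coeff ?T i = 0" using QR(2) by (simp add: coeff_map_poly coeff_eq_0)
  qed
  moreover have "E F = E ?T + emb r * E ?G"
  proof -
    have "E F = E R" unfolding QR(1) E_add E_mult using lam by simp
    also have "\<dots> = E (?T + smult r ?G)" using R by simp
    finally show ?thesis unfolding E_add E_smult .
  qed
  ultimately show ?thesis by (rule that)
qed

text \<open>By \<open>OK_mod_g\<close> every class modulo g meets F_q[t][z], so O_K/(g) has the same
  representatives as the quotient of that order.\<close>

lemma card_quotient: 
  "finite (carrier (Q.R Quot Q.I))" "card (carrier (Q.R Quot Q.I)) = CARD('a) ^ (degree g * n)"
proof -
  let ?B = "box (degree g)"
  have inj0: "F = F'" if F: "F \<in> ?B" "F' \<in> ?B" "E F - E F' \<in> Q.I" for F F'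
  proof -
    have "E (F - F') \<in> Q.I" using F(3) by (simp only: E_diff)
    then obtain s G u v where sG: "E (smult s (F - F') - smult g G) = 0" "u * s + v * g = 1"
      by (rule E_in_I)
    obtain Q R where QR: "G = Phi * Q + R" "degree R < n" by (rule divide_by_Phi)
    have "E (smult s (F - F') - smult g R) = 0"
      using sG(1) lam unfolding QR(1) E_diff E_smult E_add E_mult by simp
    moreover have "degree (smult s (F - F') - smult g R) < n"
      using box_degree[OF F(1)] box_degree[OF F(2)] QR(2)
      by (intro degree_diff_less le_less_trans[OF degree_smult_le]) auto
    ultimately have eq: "smult s (F - F') = smult g R" using E_eq_0_small_degree by fastforce
    have "coeff F i = coeff F' i" for i
    proof -
      let ?c = "coeff (F - F') i"
      \<comment> \<open>As u s + v g = 1, divisibility of s times the coefficient by g passes to the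
        coefficient itself, whose degree is too small unless it is 0.\<close>
      have "s * ?c = g * coeff R i" using arg_cong[OF eq, of "\<lambda>p. coeff p i"] by (simp only: coeff_smult)
      hence "u * (s * ?c) + g * (v * ?c) = g * (u * coeff R i + v * ?c)" by (simp add: algebra_simps)
      moreover have "(u * s + v * g) * ?c = u * (s * ?c) + g * (v * ?c)" by (simp add: algebra_simps)
      ultimately have "?c = g * (u * coeff R i + v * ?c)" by (simp only: sG(2) mult_1)
      hence "g dvd ?c" by (rule dvdI)
      moreover have "degree ?c < degree g" using box_coeff[OF F(1), of i] box_coeff[OF F(2), of i] by (simp add: degree_diff_less)
      ultimately have "?c = 0" by (metis dvd_imp_degree_le not_less)
      thus ?thesis by simp
    qed
    thus ?thesis by (rule poly_eqI)
  qed
  have injE: "inj_on E ?B"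
  proof (rule inj_onI)
    fix F F' assume F: "F \<in> ?B" "F' \<in> ?B" "E F = E F'"
    have "E F - E F' \<in> Q.I" using F(3) Q.S0 by (auto simp: I_iff intro!: bexI[of _ 0])
    thus "F = F'" using inj0 F by blast
  qed
  have fin: "finite (E ` ?B)" and sub: "E ` ?B \<subseteq> OK" using box_finite[OF g(1)] E_in_OK by auto
  have surj: "\<exists>t\<in>E ` ?B. x - t \<in> Q.I" if x: "x \<in> OK" for x
  proof -
    obtain F where F: "x - E F \<in> Q.I" by (rule OK_mod_g[OF x])
    obtain T G where TG: "T \<in> ?B" "E F = E T + emb g * E G" by (rule box_mod[OF refl g(1)])
    obtain y where y: "y \<in> OK" "x - E F = emb g * y" using F by (auto simp: I_iff)
    have "x - E T = emb g * (y + E G)" using y(2) TG(2) by (simp add: algebra_simps)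
    moreover have "y + E G \<in> OK" by (intro Q.Sadd y E_in_OK)
    ultimately show ?thesis using TG(1) unfolding I_iff by blast
  qed
  have inj: "t = t'" if "t \<in> E ` ?B" "t' \<in> E ` ?B" "t - t' \<in> Q.I" for t t' using that inj0 by auto
  note cq = Q.card_quot[OF fin sub surj]
  show "finite (carrier (Q.R Quot Q.I))" by (rule cq(1)) (use inj in auto)
  have "card (carrier (Q.R Quot Q.I)) = card (E ` ?B)" by (rule cq(2)) (use inj in auto)
  thus "card (carrier (Q.R Quot Q.I)) = CARD('a) ^ (degree g * n)"
    using injE box_card[OF g(1)] by (simp add: card_image)
qed

section \<open>The residue field at P\<close>

context
  fixes \<beta> \<mu> :: "'a alg_closure"
  assumes \<beta>: "ac.ev \<beta> P = 0" and \<mu>: "poly (ac.red \<beta> Phi) \<mu> = 0"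
begin

abbreviation res :: "'a poly poly \<Rightarrow> 'a alg_closure" where "res f \<equiv> poly (ac.red \<beta> f) \<mu>"

text \<open>Inertness again: the remainder modulo \<open>Phi\<close> has degree below n, so if it
  vanishes at \<open>\<mu>\<close>, all its coefficients are divisible by P.\<close>

lemma res_eq_0:
  assumes "res H = 0" obtains G where "E H = emb P * E G"
proof -
  obtain Q R where QR: "H = Phi * Q + R" "degree R < n" by (rule divide_by_Phi)
  have "res R = 0" using assms \<mu> unfolding QR(1) by simp
  moreover have "degree (ac.red \<beta> R) < n" using map_poly_degree_leq[of "ac.ev \<beta>" R] QR(2) by simp
  ultimately have "ac.red \<beta> R = 0" using red_small_degree_no_root[OF \<beta> \<mu>, of R] by fastforce
  then obtain G where G: "R = smult P G" by (rule ac.red_eq_0_smult[OF P_irr(1) \<beta>])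
  have "E H = emb P * E G" unfolding QR(1) E_add E_mult G E_smult using lam by simp
  thus ?thesis by (rule that)
qed

lemma res_of_E_eq:
  assumes "E F = E T + emb P * E G" shows "res F = res T"
proof -
  have "E (F - T - smult P G) = 0" unfolding E_diff E_smult using assms by simp
  hence "res (F - T - smult P G) = 0" by (rule red_root_of_E_eq_0[OF _ \<mu>])
  thus ?thesis using \<beta> by simp
qed

lemma card_range_res: "finite (range res)" "card (range res) = CARD('a) ^ (degree P * n)"
proof -
  let ?B = "box (degree P)"
  have d: "degree P > 0" using P by (rule monic_irr_degree_pos)
  have "range res = res ` ?B"
  proof
    show "range res \<subseteq> res ` ?B"
    proof
      fix y assume "y \<in> range res"
      then obtain F where F: "y = res F" by auto
      obtain T G where TG: "T \<in> ?B" "E F = E T + emb P * E G" by (rule box_mod[OF refl d])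
      thus "y \<in> res ` ?B" using res_of_E_eq[OF TG(2)] F by auto
    qed
  qed auto
  moreover have "inj_on res ?B"
  proof (rule inj_onI)
    fix F F' assume F: "F \<in> ?B" "F' \<in> ?B" "res F = res F'"
    have "res (F - F') = 0" using F(3) by simp
    moreover have "degree (ac.red \<beta> (F - F')) < n"
      using map_poly_degree_leq[of "ac.ev \<beta>" "F - F'"] degree_diff_less[of F n F'] box_degree[OF F(1)] box_degree[OF F(2)] by simp
    ultimately have "ac.red \<beta> (F - F') = 0" using red_small_degree_no_root[OF \<beta> \<mu>, of "F - F'"] by fastforce
    then obtain G where G: "F - F' = smult P G" by (rule ac.red_eq_0_smult[OF P_irr(1) \<beta>])
    have "coeff F i = coeff F' i" for i
    proof -
      have "P dvd coeff (F - F') i" unfolding G by simp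
      moreover have "degree (coeff (F - F') i) < degree P" using box_coeff[OF F(1), of i] box_coeff[OF F(2), of i] by (simp add: degree_diff_less)
      ultimately have "coeff (F - F') i = 0" by (metis dvd_imp_degree_le not_less)
      thus ?thesis by simp
    qed
    thus "F = F'" by (rule poly_eqI)
  qed
  ultimately show "finite (range res)" "card (range res) = CARD('a) ^ (degree P * n)"
    using box_finite[OF d] box_card[OF d] by (simp_all add: card_image)
qed

lemma res_power_card:
  assumes "res F \<noteq> 0" shows "res F ^ (CARD('a) ^ (degree P * n) - 1) = 1"
proof -
  have "0 \<in> range res" using rangeI[of res 0] by simp
  moreover have "x * y \<in> range res" if "x \<in> range res" "y \<in> range res" for x y
  proof -
    obtain f h where "x = res f" "y = res h" using \<open>x \<in> range res\<close> \<open>y \<in> range res\<close> by auto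
    hence "x * y = res (f * h)" by simp
    thus ?thesis by blast
  qed
  ultimately show ?thesis using finite_mult_closed_power[OF card_range_res(1), of "res F"] card_range_res(2) assms by auto
qed

text \<open>The residue field has q^(n deg P) elements, and the assumption makes the q^(n deg
  g)-power map trivial on it; hence n deg P divides n deg g.\<close>

lemma power_condition_imp_dvd:
  assumes all: "\<And>a. a \<in> OK \<Longrightarrow> a ^ (CARD('a) ^ (degree g * n)) - a \<in> Q.I"
  shows "degree P dvd degree g"
proof -
  let ?q = "CARD('a)" and ?N = "CARD('a) ^ (degree g * n)" and ?b = "degree P * n"
  have evg: "ac.ev \<beta> g = 0" using ac.ev_eq_0_iff[OF P_irr(1) \<beta>] g(2) by blast
  have 1: "res F ^ ?N = res F" for F
  proof -
    have "E (F ^ ?N - F) \<in> Q.I" using all[OF E_in_OK[of F]] by (simp only: E_diff E_pow)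
    then obtain s G u v where sG: "E (smult s (F ^ ?N - F) - smult g G) = 0" "u * s + v * g = 1"
      by (rule E_in_I)
    have "res (smult s (F ^ ?N - F) - smult g G) = 0" by (rule red_root_of_E_eq_0[OF sG(1) \<mu>])
    hence "ac.ev \<beta> s * (res F ^ ?N - res F) = 0" by (simp add: evg)
    moreover have "ac.ev \<beta> s \<noteq> 0"
    proof
      assume "ac.ev \<beta> s = 0"
      hence "ac.ev \<beta> (u * s + v * g) = 0" by (simp add: evg)
      thus False using sG(2) by simp
    qed
    ultimately show ?thesis by simp
  qed
  have b0: "?b > 0" using monic_irr_degree_pos[OF P] n_pos by simp
  have 2: "res F ^ (?q ^ ?b) = res F" for F
  proof (cases "res F = 0")
    case False
    have "?q ^ ?b = Suc (?q ^ ?b - 1)" by simp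
    thus ?thesis using res_power_card[OF False] by (metis mult_1_right power_Suc)
  qed (simp add: zero_power)
  define a where "a = degree g * n"
  \<comment> \<open>For r > 0 the polynomial X^(q^r) - X would vanish on the whole residue field,
    which has more than q^r elements.\<close>
  define r where "r = a mod ?b"
  have 3: "res F ^ (?q ^ r) = res F" for F
  proof -
    have "a = ?b * (a div ?b) + r" unfolding r_def by (rule mult_div_mod_eq[symmetric])
    moreover have "res F ^ (?q ^ a) = res F" unfolding a_def by (rule 1)
    ultimately have "res F ^ (?q ^ (?b * (a div ?b) + r)) = res F" by (simp only: )
    moreover have "res F ^ (?q ^ (?b * (a div ?b) + r)) = (res F ^ (?q ^ (?b * (a div ?b)))) ^ (?q ^ r)"
      by (simp only: power_add power_mult)
    moreover have "res F ^ (?q ^ (?b * (a div ?b))) = res F" by (rule ac.frob_period_mult[OF 2])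
    ultimately show ?thesis by (simp only: )
  qed
  have "r = 0"
  proof (rule ccontr)
    assume "r \<noteq> 0"
    have q1: "1 < ?q" using card_field_ge_2[where 'a='a] by simp
    define p where "p = monom (1 :: 'a alg_closure) (?q ^ r) - monom 1 1"
    have rb: "r < ?b" using b0 by (simp add: r_def)
    have q2: "?q ^ r > 1" using q1 \<open>r \<noteq> 0\<close> by (intro one_less_power) auto
    have "coeff p (?q ^ r) = 1" using q2 by (simp add: p_def)
    hence p0: "p \<noteq> 0" by auto
    have dp: "degree p \<le> ?q ^ r" unfolding p_def using q2
      by (intro degree_diff_le) (auto simp: degree_monom_eq)
    have "card (range res) \<le> degree p" by (rule card_roots_le[OF p0]) (auto simp: p_def poly_monom 3)
    hence "?q ^ ?b \<le> ?q ^ r" using dp card_range_res(2) by simp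
    hence "?b \<le> r" using power_increasing_iff[OF q1, of ?b r] by (simp only: )
    thus False using rb by simp
  qed
  hence "?b dvd a" by (simp only: r_def mod_eq_0_iff_dvd)
  hence "?b dvd degree g * n" by (simp only: a_def)
  thus ?thesis using n_pos by simp
qed

lemma one_notin_I: "1 \<notin> Q.I"
proof
  assume "1 \<in> Q.I"
  then obtain y where y: "y \<in> OK" "1 = emb g * y" by (auto simp: I_iff)
  have "y = to_ac (inverse (to_fract g))" using y(2) by (metis emb_def inverse_unique to_ac_inverse)
  moreover have "integral_elem y" using y by (simp add: OK_iff)
  ultimately obtain p where "inverse (to_fract g) = to_fract p" using integral_fract by metis
  hence "to_fract g * to_fract p = 1" using g_nz by (metis right_inverse to_fract_eq_0_iff)
  hence "to_fract (g * p) = to_fract 1" by simp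
  hence "g * p = 1" by (simp only: to_fract_eq_iff)
  hence "is_unit g" by (metis dvd_triv_left)
  thus False using g(1) g_nz by (simp add: is_unit_iff_degree)
qed

text \<open>Here g is P up to a unit, so an element outside the ideal has a representative with
  nonzero residue, and the inverse of this residue lifts to F_q[t][z].\<close>

lemma quotient_field:
  assumes "irreducible g" shows "Ring.field (Q.R Quot Q.I)"
proof (rule Q.quot_fieldI[OF one_notin_I])
  obtain c where c: "g = P * c" using g(2) by (elim dvdE)
  have "is_unit c" using assms P_irr(1) c by (metis irreducible_def)
  then obtain c' where c': "c * c' = 1" by (metis dvdE)
  have PI: "emb P * y \<in> Q.I" if "y \<in> OK" for y
  proof -
    have "emb P * y = emb (P * (c * c')) * y" unfolding c' by simp
    also have "\<dots> = emb g * (emb c' * y)" unfolding c by (simp add: mult.assoc)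
    finally show ?thesis using OK_mult[OF emb_in_OK that] unfolding I_iff by blast
  qed
  have Iadd: "x + y \<in> Q.I" if xy: "x \<in> Q.I" "y \<in> Q.I" for x y
  proof -
    obtain a b where "a \<in> OK" "x = emb g * a" "b \<in> OK" "y = emb g * b" using xy by (auto simp: I_iff)
    thus ?thesis unfolding I_iff using Q.Sadd by (metis distrib_left)
  qed
  have Imult: "x * y \<in> Q.I" if xy: "x \<in> Q.I" "y \<in> OK" for x y
  proof -
    obtain a where "a \<in> OK" "x = emb g * a" using xy by (auto simp: I_iff)
    thus ?thesis unfolding I_iff using OK_mult xy(2) by (metis mult.assoc)
  qed
  fix a assume a: "a \<in> OK" "a \<notin> Q.I"
  obtain F where F: "a - E F \<in> Q.I" by (rule OK_mod_g[OF a(1)])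
  have "res F \<noteq> 0"
  proof
    assume "res F = 0"
    then obtain G where "E F = emb P * E G" by (rule res_eq_0)
    hence "E F \<in> Q.I" using PI E_in_OK by simp
    hence "(a - E F) + E F \<in> Q.I" by (rule Iadd[OF F])
    thus False using a(2) by simp
  qed
  \<comment> \<open>The inverse of a nonzero element of a finite field is its power with exponent
    two less than the number of elements.\<close>
  define k where "k = CARD('a) ^ (degree P * n) - 2"
  have k: "CARD('a) ^ (degree P * n) - 1 = Suc k"
  proof -
    have "degree P * n > 0" using monic_irr_degree_pos[OF P] n_pos by simp
    hence "CARD('a) ^ 1 \<le> CARD('a) ^ (degree P * n)" by (intro power_increasing) auto
    thus ?thesis using card_field_ge_2[where 'a='a] by (simp add: k_def)
  qed
  have "res (F ^ Suc k - 1) = 0" using res_power_card[OF \<open>res F \<noteq> 0\<close>] unfolding k by simp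
  then obtain G where G: "E (F ^ Suc k - 1) = emb P * E G" by (rule res_eq_0)
  have 1: "E F * E (F ^ k) - 1 \<in> Q.I"
  proof -
    have "E F * E (F ^ k) - 1 = emb P * E G" using G unfolding E_diff E_1 power_Suc E_mult .
    thus ?thesis using PI E_in_OK by simp
  qed
  have "(a - E F) * E (F ^ k) + (E F * E (F ^ k) - 1) \<in> Q.I"
    by (intro Iadd Imult F E_in_OK 1)
  hence "a * E (F ^ k) - 1 \<in> Q.I" by (simp add: algebra_simps)
  thus "\<exists>b\<in>OK. a * b - 1 \<in> Q.I" using E_in_OK by blast
qed

end

theorem not_carmichael_in_K:
  assumes "irreducible g \<or> \<not> degree P dvd degree g"
  shows "\<not> carmichael_in K (emb g)"
proof
  assume "carmichael_in K (emb g)"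
  hence nf: "\<not> Ring.field (Q.R Quot Q.I)" and all: "\<And>a. a \<in> OK \<Longrightarrow> a ^ (CARD('a) ^ (degree g * n)) - a \<in> Q.I"
    unfolding carmichael_in_iff Q.carmichael_iff card_quotient(2) by auto
  obtain \<beta> where \<beta>: "ac.ev \<beta> P = 0" by (rule root_in_ac[OF P_irr(1)])
  have "degree (ac.red \<beta> Phi) > 0" using ac.red_Phi_monic(1)[OF M_irr(2), of \<beta>] n_pos by (simp add: n_eq)
  then obtain \<mu> where \<mu>: "poly (ac.red \<beta> Phi) \<mu> = 0" using ac_root by blast
  show False using assms quotient_field[OF \<beta> \<mu>] power_condition_imp_dvd[OF \<beta> \<mu> all] nf by blast
qed

end

theorem theorem5p8:
  fixes g :: "'a::{finite,field} poly"
  assumes "degree g > 0" and "squarefree g" and "\<not> carmichael_poly g"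
  shows "infinite {K. \<exists>M. degree M > 0 \<and> K = cyclotomic_field M \<and>
            disc_rel_prime K g \<and> \<not> carmichael_in K (emb g)}"
proof
  let ?A = "{K. \<exists>M. degree M > 0 \<and> K = cyclotomic_field M \<and> disc_rel_prime K g \<and> \<not> carmichael_in K (emb g)}"
  assume fin: "finite ?A"
  obtain P where Pm: "P \<in> monic_irr" "P dvd g" "irreducible g \<or> \<not> degree P dvd degree g"
    by (rule not_carmichael_poly_cases[OF assms])
  have g0: "g \<noteq> 0" using assms(1) by auto
  \<comment> \<open>Finitely many fields would have bounded degree.\<close>
  have "\<exists>K\<in>?A. ext_degree K > N" for N
  proof -
    \<comment> \<open>Since deg M > deg g, the irreducible M shares no factor with g; since deg M >
      N, the degree q^(deg M) - 1 of the field exceeds N.\<close>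
    obtain M where Mm: "M \<in> monic_irr" "degree M > max N (degree g)"
      and prim: "\<And>i. i > 0 \<Longrightarrow> M dvd P ^ i - 1 \<Longrightarrow> CARD('a) ^ degree M - 1 \<le> i"
      by (rule exists_modulus_with_primitive_root[OF Pm(1)]) blast
    define n where "n = CARD('a) ^ degree M - 1"
    have M1: "lead_coeff M = 1" using Mm(1) by (simp add: monic_irr_def)
    have q1: "CARD('a) > 1" using card_field_ge_2[where 'a='a] by simp
    have "degree M < 2 ^ degree M" by (rule less_exp)
    also have "2 ^ degree M \<le> CARD('a) ^ degree M" by (rule power_mono[OF card_field_ge_2]) simp
    finally have "n \<ge> degree M" by (simp add: n_def)
    have "n > 0" using Mm(2) \<open>n \<ge> degree M\<close> by simp
    hence "degree (map_poly emb (carlitz_Phi M)) > 0" using carlitz_Phi_monic(1)[OF M1] by (simp add: n_def)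
    then obtain z where z: "poly (map_poly emb (carlitz_Phi M)) z = 0"
      using alg_closed_imp_poly_has_root by blast
    have small: "\<not> M dvd R" if "R dvd g" "R \<noteq> 0" for R
      using that Mm(2) g0 by (metis dvd_imp_degree_le dvd_trans le_antisym max.strict_boundedE not_less)
    interpret inert_prime_dividing P M z n g
    proof unfold_locales
      show "P \<in> monic_irr" by fact
      show "M \<in> monic_irr" by fact
      show "degree g > 0" by fact
      show "P dvd g" by fact
      show "\<not> M dvd P" using small[OF Pm(2)] Pm(1) by (auto simp: monic_irr_def)
      show "n \<le> i" if "i > 0" "M dvd P ^ i - 1" for i using prim that by (simp add: n_def)
      show "n = CARD('a) ^ degree M - 1" by (rule n_def)
      show "poly (map_poly emb (carlitz_Phi M)) z = 0" by (rule z)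
      fix R assume R: "irreducible R" "R dvd g"
      show "\<not> R dvd M"
      proof
        assume "R dvd M"
        then obtain c where c: "M = R * c" by (elim dvdE)
        have "is_unit c" using Mm(1) R(1) c by (metis (mono_tags) mem_Collect_eq monic_irr_def irreducible_def)
        hence "M dvd R" unfolding c by (metis dvd_refl mult_unit_dvd_iff)
        thus False using small[OF R(2)] R(1) by auto
      qed
    qed
    have "K \<in> ?A" using cyclotomic_field_eq disc_rel_prime_K[OF gM] not_carmichael_in_K[OF Pm(3)] Mm(2)
      by (intro CollectI exI[of _ M]) auto
    moreover have "ext_degree K > N" using ext_degree_K \<open>n \<ge> degree M\<close> Mm(2) by simp
    ultimately show ?thesis by blast
  qed
  hence "\<exists>K\<in>?A. ext_degree K > Max (ext_degree ` ?A)" by blast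
  thus False using fin by (meson Max_ge finite_imageI imageI not_less)
qed

end
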